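(* Let $X$ be a real Banach space and let $k>1$ be an integer. Then the set of real extreme points of the closed unit ball of $\mathcal{P}_I(^kX)$ (the space of integral $k$-homogeneous polynomials on $X$ with the integral norm) is $$\{\pm\phi^k : \phi\in X^*,\ \|\phi\|=1\}.$$
   Context: A $k$-homogeneous polynomial $P\colon X\to\mathbb{R}$ is a function of the form $P(x)=A(x,\dots,x)$ with $A$ a continuous symmetric $k$-linear form. $P$ is integral if there is a regular Borel measure $\mu$ of bounded variation on $(B_{X^*},w^* )$ such that $P(x)=\int_{B_{X^*}}\phi(x)^k\,d\mu(\phi)$ for all $x\in X$; its integral norm $\|P\|_{\mathcal{P}_I(^kX)}$ is the infimum of $|\mu|(B_{X^*})$ over all such representing measures $\mu$. $\mathcal{P}_I(^kX)$ is the Banach space of integral $k$-homogeneous polynomials with this norm. For $\phi\in X^*$, $\phi^k$ denotes the polynomial $x\mapsto\phi(x)^k$. A point $x\in B_Z$ (closed unit ball of a Banach space $Z$) is a real extreme point if $\{x+\zeta y:\zeta\in\mathbb{R},|\zeta|\le 1\}\subset B_Z$ with $y\in Z$ implies $y=0$. *)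

theory Defs
  imports "HOL-Analysis.Analysis"
begin

section \<open>Real signed measures\<close>

text \<open>A real signed measure is represented by a set function, of which only the values on
  \<open>sets M\<close> matter; the measure component of \<open>M\<close> plays no role, only its \<open>\<sigma>\<close>-algebra does.\<close>

definition signed_measure :: "'b measure \<Rightarrow> ('b set \<Rightarrow> real) \<Rightarrow> bool" where
  "signed_measure M \<mu> \<longleftrightarrow>
     \<mu> {} = 0 \<and>
     (\<forall>A :: nat \<Rightarrow> 'b set. range A \<subseteq> sets M \<longrightarrow> disjoint_family A \<longrightarrow>
        (\<lambda>i. \<mu> (A i)) sums \<mu> (\<Union>i. A i))"

definition variation :: "'b measure \<Rightarrow> ('b set \<Rightarrow> real) \<Rightarrow> 'b set \<Rightarrow> ennreal" where
  "variation M \<mu> A =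
     (SUP \<P> \<in> {\<P>. finite \<P> \<and> \<P> \<subseteq> sets M \<and> disjoint \<P> \<and> \<Union>\<P> = A}. \<Sum>B\<in>\<P>. ennreal \<bar>\<mu> B\<bar>)"

text \<open>The Jordan decomposition \<open>\<mu>\<^sup>\<plusminus> = (\<bar>\<mu>\<bar> \<plusminus> \<mu>) / 2\<close>, for \<open>\<mu>\<close> of bounded variation.\<close>

definition pos_variation :: "'b measure \<Rightarrow> ('b set \<Rightarrow> real) \<Rightarrow> 'b measure" where
  "pos_variation M \<mu> =
     measure_of (space M) (sets M) (\<lambda>A. ennreal ((enn2real (variation M \<mu> A) + \<mu> A) / 2))"

definition neg_variation :: "'b measure \<Rightarrow> ('b set \<Rightarrow> real) \<Rightarrow> 'b measure" where
  "neg_variation M \<mu> =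
     measure_of (space M) (sets M) (\<lambda>A. ennreal ((enn2real (variation M \<mu> A) - \<mu> A) / 2))"

definition signed_integral :: "'b measure \<Rightarrow> ('b set \<Rightarrow> real) \<Rightarrow> ('b \<Rightarrow> real) \<Rightarrow> real" where
  "signed_integral M \<mu> f =
     integral\<^sup>L (pos_variation M \<mu>) f - integral\<^sup>L (neg_variation M \<mu>) f"

definition borel_sigma :: "'b topology \<Rightarrow> 'b measure" where
  "borel_sigma T = sigma (topspace T) {U. openin T U}"

definition regular_borel_measure_bv :: "'b topology \<Rightarrow> ('b set \<Rightarrow> real) \<Rightarrow> bool" where
  "regular_borel_measure_bv T \<mu> \<longleftrightarrow>
     signed_measure (borel_sigma T) \<mu> \<and>
     variation (borel_sigma T) \<mu> (topspace T) < \<infinity> \<and>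
     (\<forall>A \<in> sets (borel_sigma T). \<forall>\<epsilon>>0. \<exists>K U.
        compactin T K \<and> closedin T K \<and> openin T U \<and> K \<subseteq> A \<and> A \<subseteq> U \<and>
        variation (borel_sigma T) \<mu> (U - K) < ennreal \<epsilon>)"

section \<open>Integral homogeneous polynomials\<close>

text \<open>For real-valued functionals the strong operator topology, i.e. the topology of pointwise
  convergence, is the weak-star topology of the dual.\<close>

definition weak_star_dual_ball :: "('a::real_normed_vector \<Rightarrow>\<^sub>L real) topology" where
  "weak_star_dual_ball = subtopology strong_operator_topology (cball 0 1)"

text \<open>A \<open>k\<close>-linear form is encoded as a function of sequences that depends only on the first
  \<open>k\<close> entries; for such functions continuity in the product topology on \<open>nat \<Rightarrow> 'a\<close> is
  joint continuity in these entries.\<close>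

definition continuous_symmetric_multilinear_form ::
    "nat \<Rightarrow> ((nat \<Rightarrow> 'a::real_normed_vector) \<Rightarrow> real) \<Rightarrow> bool" where
  "continuous_symmetric_multilinear_form k A \<longleftrightarrow>
     (\<forall>x y. (\<forall>i<k. x i = y i) \<longrightarrow> A x = A y) \<and>
     (\<forall>x. \<forall>i<k. linear (\<lambda>v. A (x(i := v)))) \<and>
     (\<forall>x \<pi>. \<pi> permutes {..<k} \<longrightarrow> A (x \<circ> \<pi>) = A x) \<and>
     continuous_on UNIV A"

definition homogeneous_polynomial :: "nat \<Rightarrow> ('a::real_normed_vector \<Rightarrow> real) \<Rightarrow> bool" where
  "homogeneous_polynomial k P \<longleftrightarrow>
     (\<exists>A. continuous_symmetric_multilinear_form k A \<and> (\<forall>x. P x = A (\<lambda>_. x)))"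

definition represents ::
    "nat \<Rightarrow> (('a::real_normed_vector \<Rightarrow>\<^sub>L real) set \<Rightarrow> real) \<Rightarrow> ('a \<Rightarrow> real) \<Rightarrow> bool" where
  "represents k \<mu> P \<longleftrightarrow>
     regular_borel_measure_bv weak_star_dual_ball \<mu> \<and>
     (\<forall>x. P x = signed_integral (borel_sigma weak_star_dual_ball) \<mu>
                  (\<lambda>\<phi>. blinfun_apply \<phi> x ^ k))"

definition integral_polynomials :: "nat \<Rightarrow> ('a::real_normed_vector \<Rightarrow> real) set" where
  "integral_polynomials k = {P. homogeneous_polynomial k P \<and> (\<exists>\<mu>. represents k \<mu> P)}"

text \<open>Only meaningful on \<^term>\<open>integral_polynomials k\<close>, where the infimum is over a nonempty set.\<close>

definition integral_norm :: "nat \<Rightarrow> ('a::real_normed_vector \<Rightarrow> real) \<Rightarrow> real" where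
  "integral_norm k P =
     Inf {enn2real (variation (borel_sigma weak_star_dual_ball) \<mu> (cball 0 1)) |\<mu>.
            represents k \<mu> P}"

section \<open>Real extreme points\<close>

definition unit_ball :: "('a \<Rightarrow> real) set \<Rightarrow> (('a \<Rightarrow> real) \<Rightarrow> real) \<Rightarrow> ('a \<Rightarrow> real) set" where
  "unit_ball Z N = {P \<in> Z. N P \<le> 1}"

text \<open>Real extreme points of the closed unit ball of a normed space \<open>Z\<close> of real functions, with
  pointwise operations and norm \<open>N\<close>.\<close>

definition real_extreme_points ::
    "('a \<Rightarrow> real) set \<Rightarrow> (('a \<Rightarrow> real) \<Rightarrow> real) \<Rightarrow> ('a \<Rightarrow> real) set" where
  "real_extreme_points Z N =
     {P \<in> unit_ball Z N.
        \<forall>Q \<in> Z. {(\<lambda>x. P x + \<zeta> * Q x) |\<zeta>::real. \<bar>\<zeta>\<bar> \<le> 1} \<subseteq> unit_ball Z N \<longrightarrow> Q = (\<lambda>_. 0)}"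

end

theory Submission
  imports Defs
begin

text \<open>
  The unit ball consists of the polynomials \<open>x \<mapsto> \<integral> \<psi>(x)\<^sup>k d\<mu>(\<psi>)\<close> with \<open>\<bar>\<mu>\<bar> \<le> 1\<close> in total: the infimum that
  defines the integral norm is attained (\<open>integral_norm_attained\<close>). Given representing measures
  whose total variations tend to the infimum, the values of their Jordan parts converge along a
  suitable filter to finitely additive set functions. On a compact Hausdorff space such a set
  function can be replaced by a regular, countably additive measure without changing the integrals
  of continuous functions (\<open>weak_limit_of_measures\<close>), and the dual ball is compact by the theorem of
  Banach and Alaoglu.

  Let \<open>P\<close> be an extreme point, represented by \<open>\<mu>\<close> with \<open>\<bar>\<mu>\<bar> \<le> 1\<close>. A Borel set \<open>A\<close> with complement
  \<open>B\<close> splits \<open>P\<close> into \<open>P\<^sub>A + P\<^sub>B\<close>, by restricting \<open>\<mu>\<close> to \<open>A\<close> and to \<open>B\<close>. Multiplying the two pieces of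
  \<open>\<mu>\<close> by \<open>1 + \<zeta>\<bar>\<mu>\<bar>(B)\<close> and \<open>1 - \<zeta>\<bar>\<mu>\<bar>(A)\<close> does not increase the total variation, so that
  \<open>Q = \<bar>\<mu>\<bar>(B) P\<^sub>A - \<bar>\<mu>\<bar>(A) P\<^sub>B\<close> satisfies \<open>P + \<zeta>Q\<close> in the unit ball for \<open>\<bar>\<zeta>\<bar> \<le> 1\<close>, and extremality gives
  \<open>Q = 0\<close>. Hence every \<open>P\<^sub>A\<close> is a multiple of \<open>P\<close> (\<open>extreme_point_proportional\<close>). Letting \<open>A\<close> shrink to
  a point \<open>\<phi>\<close> of the support of \<open>\<bar>\<mu>\<bar>\<close> shows that \<open>P\<close> is a multiple of \<open>\<phi>\<^sup>k\<close>; the factor has modulus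
  one after normalization of \<open>\<phi>\<close>, since otherwise \<open>P\<close> could be moved along its own line. The case
  \<open>P = 0\<close> is excluded by the existence of a functional of norm one, for which the Hahn-Banach theorem
  is proved via minimal sublinear functionals.

  Conversely, let \<open>\<parallel>\<phi>\<parallel> = 1\<close> and let \<open>\<phi>\<^sup>k\<close> be the midpoint of \<open>R\<^sub>1\<close> and \<open>R\<^sub>2\<close> in the unit ball,
  represented by \<open>\<mu>\<^sub>1\<close> and \<open>\<mu>\<^sub>2\<close>. Take a unit vector \<open>x\<close> with \<open>\<phi>(x)\<close> close to 1, and \<open>y\<close> in the kernel of
  \<open>\<phi>\<close>. As \<open>\<phi>(x + ty)\<^sup>k\<close> does not depend on \<open>t\<close>, its coefficient at \<open>t\<^sup>2\<close> vanishes, which says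
  \<open>\<integral> \<psi>(x)\<^bsup>k-2\<^esup> \<psi>(y)\<^sup>2 d(\<mu>\<^sub>1 + \<mu>\<^sub>2) = 0\<close>; this is where \<open>k > 1\<close> enters. On the other hand
  \<open>\<integral> \<psi>(x)\<^sup>k d\<mu>\<^sub>i\<close> almost equals its largest possible value 1, so that \<open>\<psi>(x)\<^bsup>k-2\<^esup> d\<mu>\<^sub>i\<close> almost equals
  \<open>d\<bar>\<mu>\<^sub>i\<bar>\<close>. Together, \<open>\<integral> \<psi>(y)\<^sup>2 d\<bar>\<mu>\<^sub>i\<bar>\<close> is small (\<open>second_moment_le\<close>): both measures almost live on
  functionals that vanish at \<open>y\<close>. Writing \<open>z\<close> as a multiple of \<open>x\<close> plus a vector of the kernel, one
  finds \<open>R\<^sub>1(z)\<close> close to \<open>\<phi>(z)\<^sup>k\<close> (\<open>moment_near_maximum\<close>), and in the limit \<open>R\<^sub>1 = \<phi>\<^sup>k\<close>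
  (\<open>power_not_midpoint\<close>).
\<close>

section \<open>The variation of a signed measure\<close>

text \<open>
  Partitions are sets of sets, but they are mostly produced as indexed families. Different indices
  can share only the empty set as a value, where \<open>\<mu>\<close> vanishes, so nothing is lost in passing from
  one form to the other.
\<close>

lemma sum_abs_image_disjoint:
  fixes \<mu> :: "'b set \<Rightarrow> real"
  assumes "\<mu> {} = 0" and fin: "finite I" and disj: "disjoint_family_on B I"
  shows "(\<Sum>C\<in>B ` I. ennreal \<bar>\<mu> C\<bar>) = (\<Sum>i\<in>I. ennreal \<bar>\<mu> (B i)\<bar>)"
proof -
  have "sum (\<lambda>C. ennreal \<bar>\<mu> C\<bar>) (B ` I) = sum ((\<lambda>C. ennreal \<bar>\<mu> C\<bar>) \<circ> B) I"
  proof (rule sum.reindex_nontrivial[OF fin])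
    fix i j assume "i \<in> I" "j \<in> I" "i \<noteq> j" "B i = B j"
    then have "B i = {}" using disj unfolding disjoint_family_on_def by fastforce
    then show "ennreal \<bar>\<mu> (B i)\<bar> = 0" using assms(1) by simp
  qed
  then show ?thesis by simp
qed

text \<open>
  A disjoint family inside \<open>A\<close> becomes a partition of \<open>A\<close> once the rest of \<open>A\<close> is added as one
  more block.
\<close>

lemma sum_abs_le_variation:
  fixes \<mu> :: "'b set \<Rightarrow> real"
  assumes "\<mu> {} = 0" and fin: "finite I" and disj: "disjoint_family_on B I"
    and B: "\<And>i. i \<in> I \<Longrightarrow> B i \<in> sets M" and sub: "(\<Union>i\<in>I. B i) \<subseteq> A" and A: "A \<in> sets M"
  shows "(\<Sum>i\<in>I. ennreal \<bar>\<mu> (B i)\<bar>) \<le> variation M \<mu> A"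
proof -
  define R where "R = A - (\<Union>i\<in>I. B i)"
  have R: "R \<in> sets M" unfolding R_def using A B fin by (intro sets.Diff sets.finite_UN) auto
  have "insert R (B ` I) \<in> {\<P>. finite \<P> \<and> \<P> \<subseteq> sets M \<and> disjoint \<P> \<and> \<Union>\<P> = A}"
  proof (intro CollectI conjI)
    show "finite (insert R (B ` I))" using fin by simp
    show "insert R (B ` I) \<subseteq> sets M" using R B by auto
    show "disjoint (insert R (B ` I))"
      using disj unfolding disjoint_def R_def disjoint_family_on_def by fast
    show "\<Union> (insert R (B ` I)) = A" using sub unfolding R_def by auto
  qed
  then have "(\<Sum>C\<in>insert R (B ` I). ennreal \<bar>\<mu> C\<bar>) \<le> variation M \<mu> A"
    unfolding variation_def by (rule SUP_upper)
  moreover have "(\<Sum>C\<in>B ` I. ennreal \<bar>\<mu> C\<bar>) \<le> (\<Sum>C\<in>insert R (B ` I). ennreal \<bar>\<mu> C\<bar>)"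
    using fin by (intro sum_mono2) auto
  ultimately show ?thesis
    using sum_abs_image_disjoint[of \<mu> I B, OF assms(1) fin disj] by (simp del: sum_ennreal)
qed

lemma abs_le_variation:
  fixes \<mu> :: "'b set \<Rightarrow> real"
  assumes "\<mu> {} = 0" "A \<in> sets M"
  shows "ennreal \<bar>\<mu> A\<bar> \<le> variation M \<mu> A"
  using sum_abs_le_variation[of \<mu> "{()}" "\<lambda>_. A" M A] assms
  by (simp add: disjoint_family_on_def)

lemma variation_least:
  fixes \<mu> :: "'b set \<Rightarrow> real"
  assumes "\<And>\<P>. finite \<P> \<Longrightarrow> \<P> \<subseteq> sets M \<Longrightarrow> disjoint \<P> \<Longrightarrow> \<Union>\<P> = A \<Longrightarrow>
    (\<Sum>B\<in>\<P>. ennreal \<bar>\<mu> B\<bar>) \<le> c"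
  shows "variation M \<mu> A \<le> c"
  unfolding variation_def using assms by (intro SUP_least) auto

lemma variation_empty:
  fixes \<mu> :: "'b set \<Rightarrow> real"
  assumes "\<mu> {} = 0"
  shows "variation M \<mu> {} = 0"
proof -
  have "variation M \<mu> {} \<le> 0"
  proof (rule variation_least)
    fix \<P> :: "'b set set" assume "\<Union>\<P> = {}"
    then have "\<And>B. B \<in> \<P> \<Longrightarrow> B = {}" by auto
    then show "(\<Sum>B\<in>\<P>. ennreal \<bar>\<mu> B\<bar>) \<le> 0" using assms by (intro eq_refl sum.neutral) auto
  qed
  then show ?thesis by simp
qed

lemma variation_mono:
  fixes \<mu> :: "'b set \<Rightarrow> real"
  assumes "\<mu> {} = 0" "A \<subseteq> B" "A \<in> sets M" "B \<in> sets M"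
  shows "variation M \<mu> A \<le> variation M \<mu> B"
proof (rule variation_least)
  fix \<P> :: "'b set set" assume P: "finite \<P>" "\<P> \<subseteq> sets M" "disjoint \<P>" "\<Union>\<P> = A"
  show "(\<Sum>B\<in>\<P>. ennreal \<bar>\<mu> B\<bar>) \<le> variation M \<mu> B"
    using P assms
    by (intro sum_abs_le_variation[of \<mu> \<P> "\<lambda>C. C"])
       (auto simp: disjoint_def disjoint_family_on_def)
qed

lemma variation_superadditive:
  fixes \<mu> :: "'b set \<Rightarrow> real"
  assumes "\<mu> {} = 0" "A \<in> sets M" "B \<in> sets M" "A \<inter> B = {}"
  shows "variation M \<mu> A + variation M \<mu> B \<le> variation M \<mu> (A \<union> B)"
proof -
  let ?S = "\<lambda>A. {\<P>. finite \<P> \<and> \<P> \<subseteq> sets M \<and> disjoint \<P> \<and> \<Union>\<P> = A}"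
  have ne: "?S C \<noteq> {}" if "C \<in> sets M" for C
    using that by (auto intro!: exI[of _ "{C}"] simp: disjoint_def)
  have "(\<Sum>C\<in>\<P>. ennreal \<bar>\<mu> C\<bar>) + (\<Sum>C\<in>\<Q>. ennreal \<bar>\<mu> C\<bar>) \<le> variation M \<mu> (A \<union> B)"
    if P: "\<P> \<in> ?S A" and Q: "\<Q> \<in> ?S B" for \<P> \<Q>
  proof -
    have PQ: "\<P> \<inter> \<Q> \<subseteq> {{}}" using P Q assms(4) by auto
    then have "(\<Sum>C\<in>\<P> \<inter> \<Q>. ennreal \<bar>\<mu> C\<bar>) = 0"
      using assms(1) by (intro sum.neutral) auto
    moreover have "(\<Sum>C\<in>\<P>. ennreal \<bar>\<mu> C\<bar>) + (\<Sum>C\<in>\<Q>. ennreal \<bar>\<mu> C\<bar>) =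
        (\<Sum>C\<in>\<P> \<union> \<Q>. ennreal \<bar>\<mu> C\<bar>) + (\<Sum>C\<in>\<P> \<inter> \<Q>. ennreal \<bar>\<mu> C\<bar>)"
      using P Q by (intro sum.union_inter[symmetric]) auto
    moreover have "(\<Sum>C\<in>\<P> \<union> \<Q>. ennreal \<bar>\<mu> C\<bar>) \<le> variation M \<mu> (A \<union> B)"
    proof (rule sum_abs_le_variation[of \<mu> "\<P> \<union> \<Q>" "\<lambda>C. C"])
      show "disjoint_family_on (\<lambda>C. C) (\<P> \<union> \<Q>)"
        using P Q assms(4) unfolding disjoint_family_on_def disjoint_def by blast
    qed (use P Q assms in auto)
    ultimately show ?thesis by simp
  qed
  then have "variation M \<mu> A + (\<Sum>C\<in>\<Q>. ennreal \<bar>\<mu> C\<bar>) \<le> variation M \<mu> (A \<union> B)"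
    if "\<Q> \<in> ?S B" for \<Q>
    unfolding variation_def[of M \<mu> A] ennreal_SUP_add_left[OF ne[OF assms(2)], symmetric]
    using that by (intro SUP_least) auto
  then show ?thesis
    unfolding variation_def[of M \<mu> B] ennreal_SUP_add_right[OF ne[OF assms(3)]]
    by (intro SUP_least) auto
qed

lemma signed_measure_sums:
  assumes "signed_measure M \<mu>" "range A \<subseteq> sets M" "disjoint_family (A :: nat \<Rightarrow> _)"
  shows "(\<lambda>i. \<mu> (A i)) sums \<mu> (\<Union>i. A i)"
  using assms unfolding signed_measure_def by blast

text \<open>
  A partition of the union is refined by intersecting each of its blocks with the \<open>A i\<close>;
  countable additivity of \<open>\<mu>\<close> bounds each block by the sum over its pieces.
\<close>

lemma variation_countably_subadditive:
  assumes \<mu>: "signed_measure M \<mu>" and A: "range A \<subseteq> sets M" "disjoint_family (A :: nat \<Rightarrow> _)"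
  shows "variation M \<mu> (\<Union>i. A i) \<le> (\<Sum>i. variation M \<mu> (A i))"
proof (rule variation_least)
  have \<mu>0: "\<mu> {} = 0" using \<mu> by (simp add: signed_measure_def)
  fix \<P> :: "'a set set" assume P: "finite \<P>" "\<P> \<subseteq> sets M" "disjoint \<P>" "\<Union>\<P> = (\<Union>i. A i)"
  have 1: "ennreal \<bar>\<mu> B\<bar> \<le> (\<Sum>i. ennreal \<bar>\<mu> (B \<inter> A i)\<bar>)" if B: "B \<in> \<P>" for B
  proof -
    have "(\<lambda>i. \<mu> (B \<inter> A i)) sums \<mu> (\<Union>i. B \<inter> A i)"
      using A P B by (intro signed_measure_sums[OF \<mu>]) (auto simp: disjoint_family_on_def)
    moreover have "(\<Union>i. B \<inter> A i) = B" using P B by auto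
    ultimately have "(\<lambda>n. \<Sum>i<n. \<mu> (B \<inter> A i)) \<longlonglongrightarrow> \<mu> B" by (simp add: sums_def)
    then have "(\<lambda>n. ennreal \<bar>\<Sum>i<n. \<mu> (B \<inter> A i)\<bar>) \<longlonglongrightarrow> ennreal \<bar>\<mu> B\<bar>"
      by (intro tendsto_ennrealI tendsto_rabs)
    moreover have "ennreal \<bar>\<Sum>i<n. \<mu> (B \<inter> A i)\<bar> \<le> (\<Sum>i. ennreal \<bar>\<mu> (B \<inter> A i)\<bar>)" for n
    proof -
      have "ennreal \<bar>\<Sum>i<n. \<mu> (B \<inter> A i)\<bar> \<le> ennreal (\<Sum>i<n. \<bar>\<mu> (B \<inter> A i)\<bar>)"
        by (intro ennreal_leI sum_abs)
      also have "\<dots> = (\<Sum>i<n. ennreal \<bar>\<mu> (B \<inter> A i)\<bar>)" by simp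
      also have "\<dots> \<le> (\<Sum>i. ennreal \<bar>\<mu> (B \<inter> A i)\<bar>)" by (intro sum_le_suminf) auto
      finally show ?thesis .
    qed
    ultimately show ?thesis using LIMSEQ_le_const2 by blast
  qed
  have "(\<Sum>B\<in>\<P>. ennreal \<bar>\<mu> B\<bar>) \<le> (\<Sum>B\<in>\<P>. \<Sum>i. ennreal \<bar>\<mu> (B \<inter> A i)\<bar>)"
    by (intro sum_mono 1)
  also have "\<dots> = (\<Sum>i. \<Sum>B\<in>\<P>. ennreal \<bar>\<mu> (B \<inter> A i)\<bar>)" by (intro suminf_sum[symmetric]) auto
  also have "\<dots> \<le> (\<Sum>i. variation M \<mu> (A i))"
  proof (intro suminf_le summableI)
    fix i
    show "(\<Sum>B\<in>\<P>. ennreal \<bar>\<mu> (B \<inter> A i)\<bar>) \<le> variation M \<mu> (A i)"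
      using P A
      by (intro sum_abs_le_variation[of \<mu> \<P> "\<lambda>B. B \<inter> A i", OF \<mu>0])
         (auto simp: disjoint_family_on_def disjoint_def)
  qed
  finally show "(\<Sum>B\<in>\<P>. ennreal \<bar>\<mu> B\<bar>) \<le> (\<Sum>i. variation M \<mu> (A i))" .
qed

lemma variation_countably_additive:
  assumes \<mu>: "signed_measure M \<mu>" and A: "range A \<subseteq> sets M" "disjoint_family (A :: nat \<Rightarrow> _)"
  shows "(\<Sum>i. variation M \<mu> (A i)) = variation M \<mu> (\<Union>i. A i)"
proof (rule antisym)
  have \<mu>0: "\<mu> {} = 0" using \<mu> by (simp add: signed_measure_def)
  have Ai: "A i \<in> sets M" for i using A by auto
  have fin: "(\<Sum>i<n. variation M \<mu> (A i)) \<le> variation M \<mu> (\<Union>i<n. A i)" for n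
  proof (induction n)
    case (Suc n)
    have "(\<Sum>i<Suc n. variation M \<mu> (A i)) \<le> variation M \<mu> (\<Union>i<n. A i) + variation M \<mu> (A n)"
      using Suc by (simp add: add_right_mono)
    also have "\<dots> \<le> variation M \<mu> ((\<Union>i<n. A i) \<union> A n)"
    proof (rule variation_superadditive[of \<mu>])
      have "A i \<inter> A n = {}" if "i < n" for i
        using A(2) that unfolding disjoint_family_on_def by (metis UNIV_I less_irrefl)
      then show "(\<Union>i<n. A i) \<inter> A n = {}" by blast
      show "(\<Union>i<n. A i) \<in> sets M" "A n \<in> sets M" using Ai by (auto intro: sets.finite_UN)
    qed (fact \<mu>0)
    also have "(\<Union>i<n. A i) \<union> A n = (\<Union>i<Suc n. A i)" by (auto simp: less_Suc_eq)
    finally show ?case .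
  qed simp
  show "(\<Sum>i. variation M \<mu> (A i)) \<le> variation M \<mu> (\<Union>i. A i)"
  proof (rule suminf_le_const[OF summableI])
    fix n
    have "variation M \<mu> (\<Union>i<n. A i) \<le> variation M \<mu> (\<Union>i. A i)"
      using Ai by (intro variation_mono[of \<mu>, OF \<mu>0]) auto
    then show "(\<Sum>i<n. variation M \<mu> (A i)) \<le> variation M \<mu> (\<Union>i. A i)" using fin[of n] by simp
  qed
qed (rule variation_countably_subadditive[OF assms])

section \<open>Signed measures of bounded variation and their integrals\<close>

definition bounded_signed :: "'b measure \<Rightarrow> ('b set \<Rightarrow> real) \<Rightarrow> bool" where
  "bounded_signed M \<mu> \<longleftrightarrow> signed_measure M \<mu> \<and> variation M \<mu> (space M) < \<infinity>"

lemma bounded_signed_empty: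
  "bounded_signed M \<mu> \<Longrightarrow> \<mu> {} = 0"
  by (simp add: bounded_signed_def signed_measure_def)

lemma variation_finite:
  assumes "bounded_signed M \<mu>" "A \<in> sets M"
  shows "variation M \<mu> A < \<infinity>"
proof -
  have "variation M \<mu> A \<le> variation M \<mu> (space M)"
    using assms by (intro variation_mono bounded_signed_empty sets.sets_into_space) auto
  then show ?thesis using assms unfolding bounded_signed_def by (meson le_less_trans)
qed

abbreviation total_var :: "'b measure \<Rightarrow> ('b set \<Rightarrow> real) \<Rightarrow> 'b set \<Rightarrow> real" where
  "total_var M \<mu> A \<equiv> enn2real (variation M \<mu> A)"

lemma ennreal_total_var:
  "bounded_signed M \<mu> \<Longrightarrow> A \<in> sets M \<Longrightarrow> ennreal (total_var M \<mu> A) = variation M \<mu> A"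
  using variation_finite[of M \<mu> A] by (simp add: less_top)

lemma abs_le_total_var:
  assumes "bounded_signed M \<mu>" "A \<in> sets M"
  shows "\<bar>\<mu> A\<bar> \<le> total_var M \<mu> A"
proof -
  have "ennreal \<bar>\<mu> A\<bar> \<le> ennreal (total_var M \<mu> A)"
    using abs_le_variation[of \<mu> A M, OF bounded_signed_empty[OF assms(1)] assms(2)]
      ennreal_total_var[OF assms] by simp
  then show ?thesis by (simp add: ennreal_le_iff)
qed

lemma bounded_signed_sums:
  assumes "bounded_signed M \<mu>" "range A \<subseteq> sets M" "disjoint_family (A :: nat \<Rightarrow> _)"
  shows "(\<lambda>i. \<mu> (A i)) sums \<mu> (\<Union>i. A i)"
  using assms signed_measure_sums unfolding bounded_signed_def by blast

lemma total_var_sums: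
  assumes \<mu>: "bounded_signed M \<mu>" and A: "range A \<subseteq> sets M" "disjoint_family (A :: nat \<Rightarrow> _)"
  shows "(\<lambda>i. total_var M \<mu> (A i)) sums total_var M \<mu> (\<Union>i. A i)"
proof -
  have Ai: "A i \<in> sets M" for i using A by auto
  then have U: "(\<Union>i. A i) \<in> sets M" by auto
  have eq: "(\<Sum>i. ennreal (total_var M \<mu> (A i))) = ennreal (total_var M \<mu> (\<Union>i. A i))"
    unfolding ennreal_total_var[OF \<mu> Ai] ennreal_total_var[OF \<mu> U]
    using \<mu> A by (intro variation_countably_additive) (simp_all add: bounded_signed_def)
  have "(\<lambda>i. ennreal (total_var M \<mu> (A i))) sums ennreal (total_var M \<mu> (\<Union>i. A i))"
    unfolding eq[symmetric] by (intro summable_sums summableI)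
  then show ?thesis
    using sums_ennreal[of "\<lambda>i. total_var M \<mu> (A i)" "total_var M \<mu> (\<Union>i. A i)"]
    by simp
qed

text \<open>
  Both Jordan parts are obtained at once, \<open>s\<close> being the sign in front of \<open>\<mu>\<close>.
\<close>

lemma measure_of_half_sum:
  assumes \<mu>: "bounded_signed M \<mu>" and s: "s = 1 \<or> s = -1"
  defines "N \<equiv> measure_of (space M) (sets M) (\<lambda>A. ennreal ((total_var M \<mu> A + s * \<mu> A) / 2))"
  shows "finite_measure N" "sets N = sets M"
    "\<And>A. A \<in> sets M \<Longrightarrow> measure N A = (total_var M \<mu> A + s * \<mu> A) / 2"
proof -
  let ?g = "\<lambda>A. (total_var M \<mu> A + s * \<mu> A) / 2"
  have nn: "0 \<le> ?g A" if "A \<in> sets M" for A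
    using abs_le_total_var[OF \<mu> that] s by auto
  show sets: "sets N = sets M" unfolding N_def by simp
  have em: "emeasure N A = ennreal (?g A)" if "A \<in> sets M" for A
    unfolding N_def
  proof (rule emeasure_measure_of_sigma[OF sets.sigma_algebra_axioms _ _ that])
    show "positive (sets M) (\<lambda>A. ennreal (?g A))"
      using bounded_signed_empty[OF \<mu>] variation_empty[of \<mu> M] by (simp add: positive_def)
    show "countably_additive (sets M) (\<lambda>A. ennreal (?g A))"
      unfolding countably_additive_def
    proof (intro allI impI)
      fix A :: "nat \<Rightarrow> 'a set" assume A: "range A \<subseteq> sets M" "disjoint_family A"
      have "(\<lambda>i. ?g (A i)) sums ?g (\<Union>i. A i)"
        by (intro sums_divide sums_add sums_mult total_var_sums[OF \<mu> A]
            bounded_signed_sums[OF \<mu> A])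
      then show "(\<Sum>i. ennreal (?g (A i))) = ennreal (?g (\<Union>i. A i))"
        using nn A by (intro suminf_ennreal_eq) auto
    qed
  qed
  show "finite_measure N"
    by (rule finite_measureI) (use em[of "space M"] sets_eq_imp_space_eq[OF sets] in auto)
  show "measure N A = ?g A" if "A \<in> sets M" for A
    using em[OF that] nn[OF that] by (simp add: measure_def)
qed

lemma
  assumes "bounded_signed M \<mu>"
  shows finite_measure_pos_variation: "finite_measure (pos_variation M \<mu>)"
    and sets_pos_variation: "sets (pos_variation M \<mu>) = sets M"
    and measure_pos_variation:
      "A \<in> sets M \<Longrightarrow> measure (pos_variation M \<mu>) A = (total_var M \<mu> A + \<mu> A) / 2"
  using measure_of_half_sum[OF assms, of 1] by (auto simp: pos_variation_def)

lemma
  assumes "bounded_signed M \<mu>"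
  shows finite_measure_neg_variation: "finite_measure (neg_variation M \<mu>)"
    and sets_neg_variation: "sets (neg_variation M \<mu>) = sets M"
    and measure_neg_variation:
      "A \<in> sets M \<Longrightarrow> measure (neg_variation M \<mu>) A = (total_var M \<mu> A - \<mu> A) / 2"
  using measure_of_half_sum[OF assms, of "-1"] by (auto simp: neg_variation_def)

lemma
  fixes N1 N2 :: "'b measure"
  assumes N1: "finite_measure N1" "sets N1 = sets M" and N2: "finite_measure N2" "sets N2 = sets M"
    and \<mu>: "\<And>A. A \<in> sets M \<Longrightarrow> \<mu> A = measure N1 A - measure N2 A"
  shows bounded_signed_diff: "bounded_signed M \<mu>"
    and variation_diff_le:
      "A \<in> sets M \<Longrightarrow> variation M \<mu> A \<le> ennreal (measure N1 A + measure N2 A)"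
proof -
  interpret N1: finite_measure N1 by fact
  interpret N2: finite_measure N2 by fact
  show var: "variation M \<mu> A \<le> ennreal (measure N1 A + measure N2 A)" if A: "A \<in> sets M" for A
  proof (rule variation_least)
    fix \<P> assume P: "finite \<P>" "\<P> \<subseteq> sets M" "disjoint \<P>" "\<Union>\<P> = A"
    have dj: "disjoint_family_on (\<lambda>B. B) \<P>"
      using P(3) by (auto simp: disjoint_def disjoint_family_on_def)
    have "(\<Sum>B\<in>\<P>. \<bar>\<mu> B\<bar>) \<le> (\<Sum>B\<in>\<P>. measure N1 B + measure N2 B)"
    proof (rule sum_mono)
      fix B assume "B \<in> \<P>"
      then have "B \<in> sets M" using P by auto
      then show "\<bar>\<mu> B\<bar> \<le> measure N1 B + measure N2 B"
        using \<mu>[of B] measure_nonneg[of N1 B] measure_nonneg[of N2 B] by linarith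
    qed
    also have "\<dots> = measure N1 (\<Union>B\<in>\<P>. B) + measure N2 (\<Union>B\<in>\<P>. B)"
      unfolding sum.distrib
      using N1.finite_measure_finite_Union[of \<P> "\<lambda>B. B"] N2.finite_measure_finite_Union[of \<P> "\<lambda>B. B"]
        P dj N1(2) N2(2) by simp
    also have "(\<Union>B\<in>\<P>. B) = A" using P by simp
    finally show "(\<Sum>B\<in>\<P>. ennreal \<bar>\<mu> B\<bar>) \<le> ennreal (measure N1 A + measure N2 A)"
      by (simp add: ennreal_leI del: ennreal_plus)
  qed
  have "signed_measure M \<mu>"
    unfolding signed_measure_def
  proof (intro conjI allI impI)
    show "\<mu> {} = 0" using \<mu>[of "{}"] by simp
    fix A :: "nat \<Rightarrow> 'b set" assume A: "range A \<subseteq> sets M" "disjoint_family A"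
    then have Ai: "A i \<in> sets M" for i by auto
    have "(\<lambda>i. measure N1 (A i) - measure N2 (A i)) sums (measure N1 (\<Union>i. A i) - measure N2 (\<Union>i. A i))"
      using A N1(2) N2(2)
      by (intro sums_diff N1.finite_measure_UNION N2.finite_measure_UNION) auto
    then show "(\<lambda>i. \<mu> (A i)) sums \<mu> (\<Union>i. A i)"
      using \<mu>[OF Ai] \<mu>[of "\<Union>i. A i"] Ai by auto
  qed
  moreover have "variation M \<mu> (space M) < \<infinity>"
    using var[of "space M"] by (simp add: le_less_trans)
  ultimately show "bounded_signed M \<mu>" by (simp add: bounded_signed_def)
qed

text \<open>
  For \<open>y > 0\<close>, the number of levels \<open>1/n, \<dots>, n/n\<close> strictly below \<open>y\<close> is \<open>\<lceil>n y\<rceil> - 1\<close>, so that \<open>y\<close> is determined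
  up to \<open>1/n\<close> by counting them.
\<close>

lemma counting_levels:
  fixes y :: real and n :: nat
  assumes y: "0 \<le> y" "y \<le> 1" and n: "n > 0"
  shows "(\<Sum>i=1..n. of_bool (real i / n < y)) / n \<le> y"
    and "y \<le> (1 + (\<Sum>i=1..n. of_bool (real i / n < y))) / n"
proof -
  define c where "c = nat (\<lceil>n * y\<rceil> - 1)"
  have ny: "n * y \<le> n" using y n by (simp add: mult_left_le)
  have "{i \<in> {1..n}. real i / n < y} = {1..c}"
  proof (intro set_eqI iffI)
    fix i assume "i \<in> {i \<in> {1..n}. real i / n < y}"
    then have i: "1 \<le> i" "real i < n * y" using n by (auto simp: field_simps)
    then have "int i < \<lceil>n * y\<rceil>" by (simp add: less_ceiling_iff)
    then show "i \<in> {1..c}" using i unfolding c_def by auto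
  next
    fix i assume i: "i \<in> {1..c}"
    then have "int i < \<lceil>n * y\<rceil>" unfolding c_def by auto
    then have "real i < n * y" by (simp add: less_ceiling_iff)
    moreover from this have "i < n" using ny by linarith
    ultimately show "i \<in> {i \<in> {1..n}. real i / n < y}" using i n by (auto simp: field_simps)
  qed
  then have card: "(\<Sum>i=1..n. of_bool (real i / n < y)) = real c"
    by (simp add: sum_of_bool_eq Int_def)
  have 0: "0 \<le> n * y" using y by simp
  have "real c \<le> n * y" "n * y \<le> 1 + real c"
    unfolding c_def using 0 by linarith+
  then show "(\<Sum>i=1..n. of_bool (real i / n < y)) / n \<le> y"
    and "y \<le> (1 + (\<Sum>i=1..n. of_bool (real i / n < y))) / n"
    unfolding card using n by (simp_all add: field_simps)
qed

text \<open>
  Summing the indicators of the level sets counts the levels below \<open>f\<close>.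
\<close>

lemma
  fixes N :: "'b measure"
  assumes "finite_measure N" and f: "f \<in> borel_measurable N"
    and f01: "\<And>x. x \<in> space N \<Longrightarrow> 0 \<le> f x \<and> f x \<le> 1" and n: "n > 0"
  shows level_sum_le_integral:
      "(\<Sum>i=1..n. measure N {x \<in> space N. real i / n < f x}) / n \<le> integral\<^sup>L N f" (is "?L / n \<le> _")
    and integral_le_level_sum:
      "integral\<^sup>L N f \<le> (\<Sum>i=1..n. measure N {x \<in> space N. real i / n < f x}) / n + measure N (space N) / n"
proof -
  interpret finite_measure N by fact
  let ?s = "\<lambda>x. (\<Sum>i=1..n. indicat_real {x \<in> space N. real i / n < f x} x)"
  have S: "{x \<in> space N. real i / n < f x} \<in> sets N" for i using f by measurable
  have s: "?s x = (\<Sum>i=1..n. of_bool (real i / n < f x))" if "x \<in> space N" for x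
    using that by (intro sum.cong) (auto simp: indicator_def)
  have int: "integrable N (indicat_real {x \<in> space N. real i / n < f x})" for i
    using S by (intro integrable_real_indicator) (auto simp: emeasure_finite less_top[symmetric])
  have ints: "integrable N ?s" using int by auto
  have intf: "integrable N f"
    by (rule integrable_const_bound[of _ 1]) (use f f01 in auto)
  have Ls: "integral\<^sup>L N ?s = ?L"
    using int S by (subst Bochner_Integration.integral_sum) (auto simp: Int_absorb1 intro!: sum.cong)
  have "integral\<^sup>L N (\<lambda>x. ?s x / n) \<le> integral\<^sup>L N f"
    using ints intf counting_levels(1) f01 n s by (intro integral_mono) (auto simp del: of_bool_eq)
  then show "?L / n \<le> integral\<^sup>L N f" using Ls by simp
  have "integral\<^sup>L N f \<le> integral\<^sup>L N (\<lambda>x. (1 + ?s x) / n)"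
    using ints intf counting_levels(2) f01 n s by (intro integral_mono) (auto simp del: of_bool_eq)
  also have "\<dots> = (measure N (space N) + ?L) / n" using ints Ls by simp
  finally show "integral\<^sup>L N f \<le> ?L / n + measure N (space N) / n" by (simp add: add_divide_distrib)
qed

abbreviation level_sum :: "'b measure \<Rightarrow> ('b set \<Rightarrow> real) \<Rightarrow> ('b \<Rightarrow> real) \<Rightarrow> nat \<Rightarrow> real" where
  "level_sum M \<mu> f n \<equiv> (\<Sum>i=1..n. \<mu> {x \<in> space M. real i / n < f x}) / n"

text \<open>
  This layer-cake formula expresses an integral through values of the measure alone, and linearly
  in them. It extends to signed measures, where it replaces a computation of Jordan parts: the
  Jordan parts do not depend linearly on the signed measure.
\<close>

lemma level_sums_tendsto_integral:
  fixes N :: "'b measure"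
  assumes N: "finite_measure N" "f \<in> borel_measurable N" "\<And>x. x \<in> space N \<Longrightarrow> 0 \<le> f x \<and> f x \<le> 1"
  shows "(\<lambda>n. level_sum N (measure N) f n) \<longlonglongrightarrow> integral\<^sup>L N f"
proof (rule real_tendsto_sandwich)
  show "(\<lambda>n. integral\<^sup>L N f - measure N (space N) / n) \<longlonglongrightarrow> integral\<^sup>L N f"
    using tendsto_diff[OF tendsto_const lim_const_over_n] by fastforce
  show "\<forall>\<^sub>F n in sequentially. integral\<^sup>L N f - measure N (space N) / n
      \<le> level_sum N (measure N) f n"
    using eventually_gt_at_top[of 0]
  proof eventually_elim
    case (elim n)
    then show ?case using integral_le_level_sum[OF N, of n] by linarith
  qed
  show "\<forall>\<^sub>F n in sequentially. level_sum N (measure N) f n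
      \<le> integral\<^sup>L N f"
    using eventually_gt_at_top[of 0]
  proof eventually_elim
    case (elim n)
    then show ?case using level_sum_le_integral[OF N, of n] by simp
  qed
qed simp

text \<open>
  Boundedness on the whole space, rather than almost everywhere, makes the notion independent of
  the measure: a function of this class is integrable for all finite measures at once.
\<close>

definition bdd_measurable :: "'b measure \<Rightarrow> ('b \<Rightarrow> real) \<Rightarrow> bool" where
  "bdd_measurable M f \<longleftrightarrow> f \<in> borel_measurable M \<and> (\<exists>C. \<forall>x\<in>space M. \<bar>f x\<bar> \<le> C)"

lemma bdd_measurableI:
  "f \<in> borel_measurable M \<Longrightarrow> (\<And>x. x \<in> space M \<Longrightarrow> \<bar>f x\<bar> \<le> C) \<Longrightarrow> bdd_measurable M f"
  by (auto simp: bdd_measurable_def)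

lemma bdd_measurable_integrable:
  assumes "bdd_measurable M f" "finite_measure N" "sets N = sets M"
  shows "integrable N f"
proof -
  interpret finite_measure N by fact
  obtain C where "f \<in> borel_measurable M" "\<forall>x\<in>space M. \<bar>f x\<bar> \<le> C"
    using assms by (auto simp: bdd_measurable_def)
  then show ?thesis
    using assms(3) sets_eq_imp_space_eq[OF assms(3)] measurable_cong_sets[OF assms(3) refl]
    by (intro integrable_const_bound[of _ C]) auto
qed

lemma bdd_measurable_mult:
  assumes "bdd_measurable M f" "bdd_measurable M g"
  shows "bdd_measurable M (\<lambda>x. f x * g x)"
proof -
  obtain C D where "\<forall>x\<in>space M. \<bar>f x\<bar> \<le> C" "\<forall>x\<in>space M. \<bar>g x\<bar> \<le> D"
    using assms by (auto simp: bdd_measurable_def)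
  then have "\<bar>f x * g x\<bar> \<le> C * D" if "x \<in> space M" for x
    using that unfolding abs_mult by (intro mult_mono) (auto intro: order_trans[OF abs_ge_zero])
  then show ?thesis
    using assms by (intro bdd_measurableI[of _ _ "C * D"]) (auto simp: bdd_measurable_def)
qed

lemma bdd_measurable_const: "bdd_measurable M (\<lambda>_. c)"
  by (rule bdd_measurableI[of _ _ "\<bar>c\<bar>"]) auto

lemma bdd_measurable_indicator: "A \<in> sets M \<Longrightarrow> bdd_measurable M (indicator A)"
  by (rule bdd_measurableI[of _ _ 1]) (auto simp: indicator_def)

lemma bdd_measurable_add:
  assumes "bdd_measurable M f" "bdd_measurable M g"
  shows "bdd_measurable M (\<lambda>x. f x + g x)"
proof -
  obtain C D where "\<forall>x\<in>space M. \<bar>f x\<bar> \<le> C" "\<forall>x\<in>space M. \<bar>g x\<bar> \<le> D"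
    using assms by (auto simp: bdd_measurable_def)
  then show ?thesis
    using assms by (intro bdd_measurableI[of _ _ "C + D"])
      (auto simp: bdd_measurable_def intro: order_trans[OF abs_triangle_ineq] add_mono)
qed

text \<open>
  The layer-cake formula covers functions with values in the unit interval; every bounded function
  reduces to these by an affine substitution.
\<close>

lemma bdd_measurable_normalize:
  assumes "bdd_measurable M f"
  obtains g a b where "bdd_measurable M g" "\<And>x. x \<in> space M \<Longrightarrow> 0 \<le> g x \<and> g x \<le> 1"
    "f = (\<lambda>x. a * g x + b * 1)"
proof -
  obtain C where C: "\<forall>x\<in>space M. \<bar>f x\<bar> \<le> C" and f: "f \<in> borel_measurable M"
    using assms by (auto simp: bdd_measurable_def)
  \<comment> \<open>\<open>C\<close> itself may be 0 or, on an empty space, negative.\<close>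
  define D where "D = \<bar>C\<bar> + 1"
  have D: "D > 0" "\<And>x. x \<in> space M \<Longrightarrow> \<bar>f x\<bar> \<le> D" using C unfolding D_def by force+
  let ?g = "\<lambda>x. (f x + D) / (2 * D)"
  have g: "0 \<le> ?g x \<and> ?g x \<le> 1" if "x \<in> space M" for x
    using D(1) D(2)[OF that] by (auto simp: field_simps)
  show ?thesis
  proof (rule that[of ?g "2 * D" "- D"])
    show "bdd_measurable M ?g"
    proof (rule bdd_measurableI)
      show "?g \<in> borel_measurable M" using f by measurable
      show "\<bar>?g x\<bar> \<le> 1" if "x \<in> space M" for x using g[OF that] by (subst abs_of_nonneg) auto
    qed
    show "f = (\<lambda>x. 2 * D * ?g x + - D * 1)" using D by (auto simp: field_simps)
  qed (use g in auto)
qed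

lemma space_variations:
  assumes "bounded_signed M \<mu>"
  shows "space (pos_variation M \<mu>) = space M" "space (neg_variation M \<mu>) = space M"
  using sets_pos_variation[OF assms] sets_neg_variation[OF assms] sets_eq_imp_space_eq by blast+

lemma integrable_pos_variation:
  "bounded_signed M \<mu> \<Longrightarrow> bdd_measurable M f \<Longrightarrow> integrable (pos_variation M \<mu>) f"
  by (rule bdd_measurable_integrable[OF _ finite_measure_pos_variation sets_pos_variation])

lemma integrable_neg_variation:
  "bounded_signed M \<mu> \<Longrightarrow> bdd_measurable M f \<Longrightarrow> integrable (neg_variation M \<mu>) f"
  by (rule bdd_measurable_integrable[OF _ finite_measure_neg_variation sets_neg_variation])

lemma affine_functionals_eq:
  assumes f: "bdd_measurable M f"
    and F: "\<And>g a b. bdd_measurable M g \<Longrightarrow> F (\<lambda>x. a * g x + b * 1) = a * F g + b * F (\<lambda>_. 1)"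
    and G: "\<And>g a b. bdd_measurable M g \<Longrightarrow> G (\<lambda>x. a * g x + b * 1) = a * G g + b * G (\<lambda>_. 1)"
    and eq: "\<And>g. bdd_measurable M g \<Longrightarrow> (\<And>x. x \<in> space M \<Longrightarrow> 0 \<le> g x \<and> g x \<le> 1) \<Longrightarrow> F g = (G g :: real)"
  shows "F f = G f"
proof -
  obtain g a b where g: "bdd_measurable M g" "\<And>x. x \<in> space M \<Longrightarrow> 0 \<le> g x \<and> g x \<le> 1"
    and f: "f = (\<lambda>x. a * g x + b * 1)"
    using bdd_measurable_normalize[OF f] by blast
  show ?thesis
    unfolding f F[OF g(1)] G[OF g(1)] using eq[OF g] eq[OF bdd_measurable_const] by simp
qed

lemma signed_integral_cong:
  assumes "bounded_signed M \<mu>" "\<And>x. x \<in> space M \<Longrightarrow> f x = g x"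
  shows "signed_integral M \<mu> f = signed_integral M \<mu> g"
  unfolding signed_integral_def using assms
  by (intro arg_cong2[where f = "(-)"] Bochner_Integration.integral_cong) (simp_all add: space_variations)

lemma signed_integral_linear:
  assumes \<mu>: "bounded_signed M \<mu>" and f: "bdd_measurable M f" and g: "bdd_measurable M g"
  shows "signed_integral M \<mu> (\<lambda>x. a * f x + b * g x) =
    a * signed_integral M \<mu> f + b * signed_integral M \<mu> g"
  unfolding signed_integral_def
  using integrable_pos_variation[OF \<mu> f] integrable_pos_variation[OF \<mu> g]
    integrable_neg_variation[OF \<mu> f] integrable_neg_variation[OF \<mu> g]
  by (simp add: algebra_simps)

lemma signed_integral_const:
  assumes \<mu>: "bounded_signed M \<mu>"
  shows "signed_integral M \<mu> (\<lambda>_. c) = c * \<mu> (space M)"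
  unfolding signed_integral_def
  by (simp add: space_variations[OF \<mu>] measure_pos_variation[OF \<mu>] measure_neg_variation[OF \<mu>] field_simps)

lemma level_sums_tendsto_diff_integral:
  assumes N1: "finite_measure N1" "sets N1 = sets M" and N2: "finite_measure N2" "sets N2 = sets M"
    and \<mu>: "\<And>A. A \<in> sets M \<Longrightarrow> \<mu> A = measure N1 A - measure N2 A"
    and f: "f \<in> borel_measurable M" "\<And>x. x \<in> space M \<Longrightarrow> 0 \<le> f x \<and> f x \<le> 1"
  shows "(\<lambda>n. level_sum M \<mu> f n) \<longlonglongrightarrow>
    integral\<^sup>L N1 f - integral\<^sup>L N2 f"
proof -
  have sp: "space N1 = space M" "space N2 = space M"
    using N1 N2 sets_eq_imp_space_eq by blast+
  have f': "f \<in> borel_measurable N1" "f \<in> borel_measurable N2"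
    using f(1) N1(2) N2(2) measurable_cong_sets by blast+
  have A: "{x \<in> space M. real i / n < f x} \<in> sets M" for i n using f(1) by measurable
  have "(\<lambda>n. level_sum M (measure N1) f n
      - level_sum M (measure N2) f n) \<longlonglongrightarrow>
      integral\<^sup>L N1 f - integral\<^sup>L N2 f"
    using level_sums_tendsto_integral[OF N1(1) f'(1)] level_sums_tendsto_integral[OF N2(1) f'(2)] f(2)
    by (intro tendsto_diff) (auto simp: sp)
  then show ?thesis
    using \<mu>[OF A] by (simp add: sum_subtractf diff_divide_distrib)
qed

lemma level_sums_tendsto_signed_integral:
  assumes \<mu>: "bounded_signed M \<mu>"
    and f: "f \<in> borel_measurable M" "\<And>x. x \<in> space M \<Longrightarrow> 0 \<le> f x \<and> f x \<le> 1"
  shows "(\<lambda>n. level_sum M \<mu> f n) \<longlonglongrightarrow> signed_integral M \<mu> f"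
  unfolding signed_integral_def
  by (rule level_sums_tendsto_diff_integral[OF _ _ _ _ _ f])
     (simp_all add: \<mu> finite_measure_pos_variation finite_measure_neg_variation
       sets_pos_variation sets_neg_variation measure_pos_variation measure_neg_variation diff_divide_distrib
       add_divide_distrib)

text \<open>
  The integral can be computed from any representation of \<open>\<mu>\<close> as a difference of finite measures,
  because the level sums see only \<open>\<mu>\<close> itself.
\<close>

lemma signed_integral_diff_measures:
  assumes N1: "finite_measure N1" "sets N1 = sets M" and N2: "finite_measure N2" "sets N2 = sets M"
    and \<mu>: "\<And>A. A \<in> sets M \<Longrightarrow> \<mu> A = measure N1 A - measure N2 A"
    and f: "bdd_measurable M f"
  shows "signed_integral M \<mu> f = integral\<^sup>L N1 f - integral\<^sup>L N2 f"
proof (rule affine_functionals_eq[OF f])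
  have bm: "bounded_signed M \<mu>" by (rule bounded_signed_diff[OF N1 N2 \<mu>])
  fix g a b assume g: "bdd_measurable M g"
  show "signed_integral M \<mu> (\<lambda>x. a * g x + b * 1) = a * signed_integral M \<mu> g + b * signed_integral M \<mu> (\<lambda>_. 1)"
    by (rule signed_integral_linear[OF bm g bdd_measurable_const])
  show "integral\<^sup>L N1 (\<lambda>x. a * g x + b * 1) - integral\<^sup>L N2 (\<lambda>x. a * g x + b * 1) =
      a * (integral\<^sup>L N1 g - integral\<^sup>L N2 g) + b * (integral\<^sup>L N1 (\<lambda>_. 1) - integral\<^sup>L N2 (\<lambda>_. 1))"
    using bdd_measurable_integrable[OF g N1] bdd_measurable_integrable[OF g N2]
      bdd_measurable_integrable[OF bdd_measurable_const N1, of b]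
      bdd_measurable_integrable[OF bdd_measurable_const N2, of b] by (simp add: algebra_simps)
  assume "\<And>x. x \<in> space M \<Longrightarrow> 0 \<le> g x \<and> g x \<le> 1"
  then show "signed_integral M \<mu> g = integral\<^sup>L N1 g - integral\<^sup>L N2 g"
    using g by (intro LIMSEQ_unique[OF level_sums_tendsto_signed_integral[OF bm]
        level_sums_tendsto_diff_integral[OF N1 N2 \<mu>]]) (auto simp: bdd_measurable_def)
qed

text \<open>
  The level sums of the combination are the combinations of the level sums.
\<close>

lemma
  assumes \<mu>: "bounded_signed M \<mu>" and \<nu>: "bounded_signed M \<nu>"
  shows bounded_signed_linear: "bounded_signed M (\<lambda>A. a * \<mu> A + b * \<nu> A)"
    and variation_linear_le: "A \<in> sets M \<Longrightarrow> variation M (\<lambda>A. a * \<mu> A + b * \<nu> A) A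
      \<le> ennreal (\<bar>a\<bar> * total_var M \<mu> A + \<bar>b\<bar> * total_var M \<nu> A)"
    and signed_integral_linear_measure: "bdd_measurable M f \<Longrightarrow>
      signed_integral M (\<lambda>A. a * \<mu> A + b * \<nu> A) f = a * signed_integral M \<mu> f + b * signed_integral M \<nu> f"
proof -
  let ?\<xi> = "\<lambda>A. a * \<mu> A + b * \<nu> A"
  have \<mu>0: "\<mu> {} = 0" "\<nu> {} = 0" using \<mu> \<nu> bounded_signed_empty by blast+
  have var: "variation M ?\<xi> A \<le> ennreal (\<bar>a\<bar> * total_var M \<mu> A + \<bar>b\<bar> * total_var M \<nu> A)"
    if A: "A \<in> sets M" for A
  proof (rule variation_least)
    fix \<P> assume P: "finite \<P>" "\<P> \<subseteq> sets M" "disjoint \<P>" "\<Union>\<P> = A"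
    have tv: "(\<Sum>B\<in>\<P>. \<bar>\<mu>' B\<bar>) \<le> total_var M \<mu>' A" if "bounded_signed M \<mu>'" for \<mu>'
    proof -
      have "(\<Sum>B\<in>\<P>. ennreal \<bar>\<mu>' B\<bar>) \<le> variation M \<mu>' A"
        using P bounded_signed_empty[OF that] A
        by (intro sum_abs_le_variation[of \<mu>' \<P> "\<lambda>C. C"]) (auto simp: disjoint_def disjoint_family_on_def)
      also have "\<dots> = ennreal (total_var M \<mu>' A)"
        using ennreal_total_var[OF that A] by simp
      finally show ?thesis by (simp add: sum_nonneg)
    qed
    have "(\<Sum>B\<in>\<P>. \<bar>?\<xi> B\<bar>) \<le> (\<Sum>B\<in>\<P>. \<bar>a\<bar> * \<bar>\<mu> B\<bar> + \<bar>b\<bar> * \<bar>\<nu> B\<bar>)"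
      by (intro sum_mono order_trans[OF abs_triangle_ineq]) (simp add: abs_mult)
    also have "\<dots> = \<bar>a\<bar> * (\<Sum>B\<in>\<P>. \<bar>\<mu> B\<bar>) + \<bar>b\<bar> * (\<Sum>B\<in>\<P>. \<bar>\<nu> B\<bar>)"
      by (simp add: sum.distrib sum_distrib_left)
    also have "\<dots> \<le> \<bar>a\<bar> * total_var M \<mu> A + \<bar>b\<bar> * total_var M \<nu> A"
      using tv[OF \<mu>] tv[OF \<nu>] by (intro add_mono mult_left_mono) auto
    finally show "(\<Sum>B\<in>\<P>. ennreal \<bar>?\<xi> B\<bar>)
        \<le> ennreal (\<bar>a\<bar> * total_var M \<mu> A + \<bar>b\<bar> * total_var M \<nu> A)"
      by (simp add: ennreal_leI del: ennreal_plus)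
  qed
  then show "A \<in> sets M \<Longrightarrow> variation M ?\<xi> A
    \<le> ennreal (\<bar>a\<bar> * total_var M \<mu> A + \<bar>b\<bar> * total_var M \<nu> A)" .
  have "signed_measure M ?\<xi>"
    unfolding signed_measure_def
    using \<mu>0 by (auto intro!: sums_add sums_mult bounded_signed_sums[OF \<mu>] bounded_signed_sums[OF \<nu>])
  moreover have "variation M ?\<xi> (space M) < \<infinity>"
    using var[of "space M"] by (simp add: le_less_trans)
  ultimately show bm: "bounded_signed M ?\<xi>" by (simp add: bounded_signed_def)
  assume f: "bdd_measurable M f"
  show "signed_integral M ?\<xi> f = a * signed_integral M \<mu> f + b * signed_integral M \<nu> f"
  proof (rule affine_functionals_eq[OF f])
    fix g c d assume g: "bdd_measurable M g"
    show "signed_integral M ?\<xi> (\<lambda>x. c * g x + d * 1) = c * signed_integral M ?\<xi> g + d * signed_integral M ?\<xi> (\<lambda>_. 1)"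
      by (rule signed_integral_linear[OF bm g bdd_measurable_const])
    show "a * signed_integral M \<mu> (\<lambda>x. c * g x + d * 1) + b * signed_integral M \<nu> (\<lambda>x. c * g x + d * 1) =
        c * (a * signed_integral M \<mu> g + b * signed_integral M \<nu> g)
        + d * (a * signed_integral M \<mu> (\<lambda>_. 1) + b * signed_integral M \<nu> (\<lambda>_. 1))"
      unfolding signed_integral_linear[OF \<mu> g bdd_measurable_const]
        signed_integral_linear[OF \<nu> g bdd_measurable_const] by (simp add: algebra_simps)
    assume g01: "\<And>x. x \<in> space M \<Longrightarrow> 0 \<le> g x \<and> g x \<le> 1"
    have g': "g \<in> borel_measurable M" using g by (simp add: bdd_measurable_def)
    have "(\<lambda>n. a * (level_sum M \<mu> g n)
        + b * (level_sum M \<nu> g n))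
        \<longlonglongrightarrow> a * signed_integral M \<mu> g + b * signed_integral M \<nu> g"
      by (intro tendsto_add tendsto_mult_left level_sums_tendsto_signed_integral \<mu> \<nu> g' g01)
    then have "(\<lambda>n. level_sum M ?\<xi> g n)
        \<longlonglongrightarrow> a * signed_integral M \<mu> g + b * signed_integral M \<nu> g"
      by (simp add: sum.distrib sum_distrib_left add_divide_distrib)
    then show "signed_integral M ?\<xi> g = a * signed_integral M \<mu> g + b * signed_integral M \<nu> g"
      using LIMSEQ_unique level_sums_tendsto_signed_integral[OF bm g' g01] by blast
  qed
qed

text \<open>
  For levels \<open>i/n \<ge> 0\<close>, the set where \<open>indicator A x * f x\<close> exceeds \<open>i/n\<close> is the intersection of \<open>A\<close>
  with the corresponding set of \<open>f\<close>, so that the level sums of the two integrals agree.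
\<close>

lemma
  assumes \<mu>: "bounded_signed M \<mu>" and A: "A \<in> sets M"
  shows bounded_signed_restrict: "bounded_signed M (\<lambda>B. \<mu> (A \<inter> B))"
    and variation_restrict_le: "B \<in> sets M \<Longrightarrow> variation M (\<lambda>B. \<mu> (A \<inter> B)) B \<le> variation M \<mu> (A \<inter> B)"
    and signed_integral_restrict: "bdd_measurable M f \<Longrightarrow>
      signed_integral M (\<lambda>B. \<mu> (A \<inter> B)) f = signed_integral M \<mu> (\<lambda>x. indicator A x * f x)"
proof -
  let ?\<xi> = "\<lambda>B. \<mu> (A \<inter> B)"
  have \<mu>0: "\<mu> {} = 0" using \<mu> bounded_signed_empty by blast
  have var: "variation M ?\<xi> B \<le> variation M \<mu> (A \<inter> B)" if B: "B \<in> sets M" for B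
  proof (rule variation_least)
    fix \<P> assume P: "finite \<P>" "\<P> \<subseteq> sets M" "disjoint \<P>" "\<Union>\<P> = B"
    show "(\<Sum>B\<in>\<P>. ennreal \<bar>?\<xi> B\<bar>) \<le> variation M \<mu> (A \<inter> B)"
      using P A B \<mu>0 
      by (intro sum_abs_le_variation[of \<mu> \<P> "\<lambda>C. A \<inter> C"]) (auto simp: disjoint_def disjoint_family_on_def)
  qed
  then show "B \<in> sets M \<Longrightarrow> variation M ?\<xi> B \<le> variation M \<mu> (A \<inter> B)" .
  have "(\<lambda>i. \<mu> (A \<inter> B i)) sums \<mu> (A \<inter> (\<Union>i. B i))"
    if "range B \<subseteq> sets M" "disjoint_family B" for B :: "nat \<Rightarrow> _"
  proof -
    have "(\<lambda>i. \<mu> (A \<inter> B i)) sums \<mu> (\<Union>i. A \<inter> B i)"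
      using that A by (intro bounded_signed_sums[OF \<mu>]) (auto simp: disjoint_family_on_def)
    then show ?thesis by (simp only: Int_UN_distrib)
  qed
  then have "signed_measure M ?\<xi>"
    unfolding signed_measure_def using \<mu>0 by auto
  moreover have "variation M ?\<xi> (space M) < \<infinity>"
    using var[of "space M"] variation_finite[OF \<mu>, of "A \<inter> space M"] A by (simp add: le_less_trans)
  ultimately show bm: "bounded_signed M ?\<xi>" by (simp add: bounded_signed_def)
  have eq: "signed_integral M ?\<xi> g = signed_integral M \<mu> (\<lambda>x. indicator A x * g x)"
    if g: "bdd_measurable M g" "\<And>x. x \<in> space M \<Longrightarrow> 0 \<le> g x \<and> g x \<le> 1" for g
  proof -
    have "bdd_measurable M (\<lambda>x. indicator A x * g x)"
      using g A by (intro bdd_measurable_mult bdd_measurable_indicator)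
    then have "(\<lambda>n. (\<Sum>i=1..n. \<mu> {x \<in> space M. real i / n < indicator A x * g x}) / n)
        \<longlonglongrightarrow> signed_integral M \<mu> (\<lambda>x. indicator A x * g x)"
      using g by (intro level_sums_tendsto_signed_integral[OF \<mu>])
        (auto simp: bdd_measurable_def indicator_def)
    moreover have "{x \<in> space M. real i / n < indicator A x * g x} = A \<inter> {x \<in> space M. real i / n < g x}"
      for i n :: nat
      using divide_nonneg_nonneg[of "real i" "real n"] sets.sets_into_space[OF A] by (auto simp: indicator_def not_less split: if_splits simp del: divide_nonneg_nonneg)
    moreover have "(\<lambda>n. (\<Sum>i=1..n. \<mu> (A \<inter> {x \<in> space M. real i / n < g x})) / n)
        \<longlonglongrightarrow> signed_integral M ?\<xi> g"
      using g by (intro level_sums_tendsto_signed_integral[OF bm]) (auto simp: bdd_measurable_def)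
    ultimately show ?thesis using LIMSEQ_unique by fastforce
  qed
  assume f: "bdd_measurable M f"
  show "signed_integral M ?\<xi> f = signed_integral M \<mu> (\<lambda>x. indicator A x * f x)"
  proof (rule affine_functionals_eq[OF f _ _ eq])
    fix g c d assume g: "bdd_measurable M g"
    show "signed_integral M ?\<xi> (\<lambda>x. c * g x + d * 1) = c * signed_integral M ?\<xi> g + d * signed_integral M ?\<xi> (\<lambda>_. 1)"
      by (rule signed_integral_linear[OF bm g bdd_measurable_const])
    note A1 = bdd_measurable_mult[OF bdd_measurable_indicator[OF A] g]
      bdd_measurable_mult[OF bdd_measurable_indicator[OF A] bdd_measurable_const[of M 1]]
    show "signed_integral M \<mu> (\<lambda>x. indicator A x * (c * g x + d * 1)) =
        c * signed_integral M \<mu> (\<lambda>x. indicator A x * g x) + d * signed_integral M \<mu> (\<lambda>x. indicator A x * 1)"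
      unfolding signed_integral_linear[OF \<mu> A1, symmetric] by (simp add: algebra_simps)
  qed
qed

text \<open>
  The integral against \<open>\<bar>\<mu>\<bar>\<close>, which is the sum of the Jordan parts.
\<close>

definition variation_integral :: "'b measure \<Rightarrow> ('b set \<Rightarrow> real) \<Rightarrow> ('b \<Rightarrow> real) \<Rightarrow> real" where
  "variation_integral M \<mu> f = integral\<^sup>L (pos_variation M \<mu>) f + integral\<^sup>L (neg_variation M \<mu>) f"

lemma variation_integral_linear:
  assumes \<mu>: "bounded_signed M \<mu>" and f: "bdd_measurable M f" and g: "bdd_measurable M g"
  shows "variation_integral M \<mu> (\<lambda>x. a * f x + b * g x) =
    a * variation_integral M \<mu> f + b * variation_integral M \<mu> g"
  unfolding variation_integral_def
  using integrable_pos_variation[OF \<mu> f] integrable_pos_variation[OF \<mu> g]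
    integrable_neg_variation[OF \<mu> f] integrable_neg_variation[OF \<mu> g]
  by (simp add: algebra_simps)

lemma variation_integral_const:
  assumes \<mu>: "bounded_signed M \<mu>"
  shows "variation_integral M \<mu> (\<lambda>_. c) = c * total_var M \<mu> (space M)"
  unfolding variation_integral_def
  by (simp add: space_variations[OF \<mu>] measure_pos_variation[OF \<mu>] measure_neg_variation[OF \<mu>] field_simps)

lemma abs_signed_integral_le_variation_integral:
  assumes \<mu>: "bounded_signed M \<mu>" and f: "bdd_measurable M f" and g: "bdd_measurable M g"
    and fg: "\<And>x. x \<in> space M \<Longrightarrow> \<bar>f x\<bar> \<le> g x"
  shows "\<bar>signed_integral M \<mu> f\<bar> \<le> variation_integral M \<mu> g"
proof -
  have *: "\<bar>integral\<^sup>L N f\<bar> \<le> integral\<^sup>L N g"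
    if "integrable N f" "integrable N g" "space N = space M" for N
  proof -
    have "\<bar>integral\<^sup>L N f\<bar> \<le> integral\<^sup>L N (\<lambda>x. \<bar>f x\<bar>)" by simp
    also have "\<dots> \<le> integral\<^sup>L N g" using that fg by (intro integral_mono) auto
    finally show ?thesis .
  qed
  show ?thesis
    unfolding signed_integral_def variation_integral_def
    using *[OF integrable_pos_variation[OF \<mu> f] integrable_pos_variation[OF \<mu> g] space_variations(1)[OF \<mu>]]
      *[OF integrable_neg_variation[OF \<mu> f] integrable_neg_variation[OF \<mu> g] space_variations(2)[OF \<mu>]]
    by linarith
qed

lemma abs_signed_integral_le:
  assumes \<mu>: "bounded_signed M \<mu>" and f: "bdd_measurable M f"
    and C: "\<And>x. x \<in> space M \<Longrightarrow> \<bar>f x\<bar> \<le> C"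
  shows "\<bar>signed_integral M \<mu> f\<bar> \<le> C * total_var M \<mu> (space M)"
  using abs_signed_integral_le_variation_integral[OF \<mu> f bdd_measurable_const C]
  by (simp add: variation_integral_const[OF \<mu>])

section \<open>Regular Borel measures on compact Hausdorff spaces\<close>

lemma space_borel_sigma: "space (borel_sigma T) = topspace T"
  unfolding borel_sigma_def by (rule space_measure_of) (auto dest: openin_subset)

lemma sets_borel_sigma: "sets (borel_sigma T) = sigma_sets (topspace T) {U. openin T U}"
  unfolding borel_sigma_def by (rule sets_measure_of) (auto dest: openin_subset)

abbreviation borel_sets :: "'b topology \<Rightarrow> 'b set set" where
  "borel_sets T \<equiv> sets (borel_sigma T)"

lemma openin_borel_sigma: "openin T U \<Longrightarrow> U \<in> borel_sets T"
  by (simp add: sets_borel_sigma sigma_sets.Basic)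

lemma closedin_borel_sigma:
  assumes "closedin T C"
  shows "C \<in> borel_sets T"
proof -
  have "topspace T - (topspace T - C) \<in> borel_sets T"
    using assms by (intro sets.Diff openin_borel_sigma) (auto simp: closedin_def)
  moreover have "topspace T - (topspace T - C) = C" using closedin_subset[OF assms] by auto
  ultimately show ?thesis by simp
qed

lemma continuous_map_borel_sigma:
  assumes "continuous_map T euclideanreal f"
  shows "f \<in> borel_measurable (borel_sigma T)"
proof (rule borel_measurableI)
  fix S :: "real set" assume "open S"
  then have "openin T {x \<in> topspace T. f x \<in> S}"
    using assms by (intro openin_continuous_map_preimage) auto
  moreover have "{x \<in> topspace T. f x \<in> S} = f -` S \<inter> space (borel_sigma T)"
    by (auto simp: space_borel_sigma)
  ultimately show "f -` S \<inter> space (borel_sigma T) \<in> borel_sets T"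
    using openin_borel_sigma by metis
qed

text \<open>
  Closed sets take the place of compact ones, as the notion is used on compact spaces only. It is
  stated for set functions because it is applied both to measures and to variations.
\<close>

definition regular_set_function :: "'b topology \<Rightarrow> ('b set \<Rightarrow> real) \<Rightarrow> bool" where
  "regular_set_function T f \<longleftrightarrow> (\<forall>A \<in> borel_sets T. \<forall>\<epsilon>>0.
    \<exists>K U. closedin T K \<and> openin T U \<and> K \<subseteq> A \<and> A \<subseteq> U \<and> f (U - K) < \<epsilon>)"

lemma regular_set_functionE:
  assumes "regular_set_function T f" "A \<in> borel_sets T" "\<epsilon> > 0"
  obtains K U where "closedin T K" "openin T U" "K \<subseteq> A" "A \<subseteq> U" "f (U - K) < \<epsilon>"
  using assms(1)[unfolded regular_set_function_def, rule_format, OF assms(2,3)]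
  by (elim exE conjE) (rule that)

definition regular_measure :: "'b topology \<Rightarrow> 'b measure \<Rightarrow> bool" where
  "regular_measure T N \<longleftrightarrow> finite_measure N \<and> sets N = borel_sets T \<and> regular_set_function T (measure N)"

lemma ennreal_less_add: "x < top \<Longrightarrow> 0 < e \<Longrightarrow> x < x + ennreal e"
  by (cases x rule: ennreal_cases) (auto simp flip: ennreal_plus simp: ennreal_less_iff)

text \<open>
  Finitely additive set functions arise as limits of measures along a filter. Such a limit need not
  be countably additive. The construction below, that of the Riesz representation theorem with a
  set function in place of a functional, turns it into a regular measure: approximation of open sets
  by closed sets from within, of arbitrary sets by open sets from without, and Caratheodory's
  criterion.
\<close>

locale additive_content =
  fixes T :: "'b topology" and \<nu> :: "'b set \<Rightarrow> real"
  assumes compact: "compact_space T" and Hausdorff: "Hausdorff_space T"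
    and nonneg: "A \<in> borel_sets T \<Longrightarrow> 0 \<le> \<nu> A"
    and additive: "A \<in> borel_sets T \<Longrightarrow> B \<in> borel_sets T \<Longrightarrow> A \<inter> B = {} \<Longrightarrow>
      \<nu> (A \<union> B) = \<nu> A + \<nu> B"
begin

lemma mono:
  assumes "A \<in> borel_sets T" "B \<in> borel_sets T" "A \<subseteq> B"
  shows "\<nu> A \<le> \<nu> B"
proof -
  have "\<nu> (A \<union> (B - A)) = \<nu> A + \<nu> (B - A)" using assms by (intro additive) auto
  moreover have "A \<union> (B - A) = B" using assms by auto
  moreover have "0 \<le> \<nu> (B - A)" using assms by (intro nonneg) auto
  ultimately show ?thesis by simp
qed

lemma subadditive:
  assumes "A \<in> borel_sets T" "B \<in> borel_sets T"
  shows "\<nu> (A \<union> B) \<le> \<nu> A + \<nu> B"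
proof -
  have "\<nu> (A \<union> (B - A)) = \<nu> A + \<nu> (B - A)" using assms by (intro additive) auto
  moreover have "\<nu> (B - A) \<le> \<nu> B" using assms by (intro mono) auto
  moreover have "A \<union> (B - A) = A \<union> B" by auto
  ultimately show ?thesis by simp
qed

definition inner_content :: "'b set \<Rightarrow> ennreal" where
  "inner_content V = (SUP C\<in>{C. closedin T C \<and> C \<subseteq> V}. ennreal (\<nu> C))"

definition outer_content :: "'b set \<Rightarrow> ennreal" where
  "outer_content E = (INF V\<in>{V. openin T V \<and> E \<subseteq> V}. inner_content V)"

lemma inner_upper: "closedin T C \<Longrightarrow> C \<subseteq> V \<Longrightarrow> ennreal (\<nu> C) \<le> inner_content V"
  unfolding inner_content_def by (rule SUP_upper) auto

lemma inner_mono: "V \<subseteq> W \<Longrightarrow> inner_content V \<le> inner_content W"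
  unfolding inner_content_def by (rule SUP_subset_mono) auto

lemma inner_le:
  assumes "V \<in> borel_sets T"
  shows "inner_content V \<le> ennreal (\<nu> V)"
  unfolding inner_content_def
  using assms by (intro SUP_least ennreal_leI mono) (auto intro: closedin_borel_sigma)

lemma outer_le: "openin T V \<Longrightarrow> E \<subseteq> V \<Longrightarrow> outer_content E \<le> inner_content V"
  unfolding outer_content_def by (rule INF_lower) auto

lemma outer_mono: "E \<subseteq> F \<Longrightarrow> outer_content E \<le> outer_content F"
  unfolding outer_content_def by (rule INF_superset_mono) auto

lemma outer_open: "openin T V \<Longrightarrow> outer_content V = inner_content V"
  unfolding outer_content_def by (intro antisym INF_lower INF_greatest inner_mono) auto

lemma outer_finite:
  assumes "E \<subseteq> topspace T"
  shows "outer_content E < top"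
proof -
  have "outer_content E \<le> ennreal (\<nu> (topspace T))"
    using order_trans[OF outer_le[OF openin_topspace assms] inner_le] 
    by (simp add: openin_borel_sigma)
  then show ?thesis by (simp add: le_less_trans)
qed

lemma inner_empty: "inner_content {} = 0"
proof -
  have "\<nu> ({} \<union> {}) = \<nu> {} + \<nu> {}" by (rule additive) auto
  then show ?thesis using inner_le[of "{}"] by simp
qed

text \<open>
  Normality splits a closed subset of \<open>V \<union> W\<close> into closed subsets of \<open>V\<close> and of \<open>W\<close>.
\<close>

lemma inner_Un:
  assumes V: "openin T V" and W: "openin T W"
  shows "inner_content (V \<union> W) \<le> inner_content V + inner_content W"
  unfolding inner_content_def[of "V \<union> W"]
proof (rule SUP_least, clarify)
  fix C assume C: "closedin T C" "C \<subseteq> V \<union> W"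
  have "closedin T (C - V)" "closedin T (C - W)" "disjnt (C - V) (C - W)"
    using C V W by (auto simp: disjnt_def)
  then obtain A B where AB: "openin T A" "openin T B" "C - V \<subseteq> A" "C - W \<subseteq> B" "disjnt A B"
    using compact_Hausdorff_or_regular_imp_normal_space[OF compact] Hausdorff
    unfolding normal_space_def by meson
  have cl: "closedin T (C - A)" "closedin T (C - B)" using C AB by auto
  have "C = (C - A) \<union> (C - B)" using AB by (auto simp: disjnt_def)
  then have "\<nu> C \<le> \<nu> (C - A) + \<nu> (C - B)"
    using subadditive[of "C - A" "C - B"] cl closedin_borel_sigma by metis
  then have "ennreal (\<nu> C) \<le> ennreal (\<nu> (C - A)) + ennreal (\<nu> (C - B))"
    using cl nonneg closedin_borel_sigma by (metis ennreal_leI ennreal_plus)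
  also have "\<dots> \<le> inner_content V + inner_content W"
    using cl AB by (intro add_mono inner_upper) auto
  finally show "ennreal (\<nu> C) \<le> inner_content V + inner_content W" .
qed

lemma inner_UN_finite:
  assumes V: "\<And>i::nat. openin T (V i)"
  shows "inner_content (\<Union>i<n. V i) \<le> (\<Sum>i<n. inner_content (V i))"
proof (induction n)
  case 0
  then show ?case by (simp add: inner_empty)
next
  case (Suc n)
  have "(\<Union>i<Suc n. V i) = (\<Union>i<n. V i) \<union> V n" by (auto simp: less_Suc_eq)
  then have "inner_content (\<Union>i<Suc n. V i) \<le> inner_content (\<Union>i<n. V i) + inner_content (V n)"
    using V by (simp only:) (intro inner_Un openin_Union, auto)
  also have "\<dots> \<le> (\<Sum>i<Suc n. inner_content (V i))"
    using Suc by (simp add: add_right_mono)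
  finally show ?case .
qed

text \<open>
  Countable subadditivity comes from compactness: a closed set covered by all the \<open>V i\<close> is already
  covered by finitely many.
\<close>

lemma inner_UN:
  assumes V: "\<And>i::nat. openin T (V i)"
  shows "inner_content (\<Union>i. V i) \<le> (\<Sum>i. inner_content (V i))"
  unfolding inner_content_def[of "\<Union>i. V i"]
proof (rule SUP_least, clarify)
  fix C assume C: "closedin T C" "C \<subseteq> (\<Union>i. V i)"
  then have "compactin T C" using compact closedin_compact_space by blast
  then obtain \<F> where F: "finite \<F>" "\<F> \<subseteq> range V" "C \<subseteq> \<Union>\<F>"
    using compactinD[of T C "range V"] C V by blast
  then obtain I where I: "finite I" "\<F> = V ` I" by (meson finite_subset_image)
  obtain n where n: "I \<subseteq> {..<n}" using I(1) finite_nat_iff_bounded by auto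
  have "ennreal (\<nu> C) \<le> inner_content (\<Union>i<n. V i)"
    using C F(3) n unfolding I(2) by (intro inner_upper) blast+
  also have "\<dots> \<le> (\<Sum>i<n. inner_content (V i))" by (rule inner_UN_finite[OF V])
  also have "\<dots> \<le> (\<Sum>i. inner_content (V i))" by (intro sum_le_suminf) auto
  finally show "ennreal (\<nu> C) \<le> (\<Sum>i. inner_content (V i))" .
qed

lemma outer_approx: "outer_content E < c \<Longrightarrow> \<exists>V. openin T V \<and> E \<subseteq> V \<and> inner_content V < c"
  unfolding outer_content_def INF_less_iff by blast

lemma outer_UN:
  assumes A: "\<And>i::nat. A i \<subseteq> topspace T"
  shows "outer_content (\<Union>i. A i) \<le> (\<Sum>i. outer_content (A i))"
proof (rule ennreal_le_epsilon)
  fix e :: real assume e: "0 < e"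
  have "outer_content (A n) < outer_content (A n) + ennreal (e * (1/2)^Suc n)" for n
    using outer_finite[OF A, of n] e by (intro ennreal_less_add) auto
  then have "\<exists>V. openin T V \<and> A n \<subseteq> V \<and> inner_content V < outer_content (A n) + ennreal (e * (1/2)^Suc n)" for n
    by (rule outer_approx)
  then obtain V where V: "\<And>n. openin T (V n)" "\<And>n. A n \<subseteq> V n"
    "\<And>n. inner_content (V n) < outer_content (A n) + ennreal (e * (1/2)^Suc n)" by metis
  have "outer_content (\<Union>i. A i) \<le> inner_content (\<Union>i. V i)"
    using V by (intro outer_le) auto
  also have "\<dots> \<le> (\<Sum>i. inner_content (V i))" by (rule inner_UN) (rule V)
  also have "\<dots> \<le> (\<Sum>n. outer_content (A n) + ennreal (e * (1/2) ^ Suc n))"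
    using V(3) by (intro suminf_le less_imp_le) auto
  also have "\<dots> = (\<Sum>n. outer_content (A n)) + (\<Sum>n. ennreal (e * (1/2) ^ Suc n))"
    by (subst suminf_add[symmetric]) auto
  also have "(\<Sum>n. ennreal (e * (1/2) ^ Suc n)) = ennreal e"
    using e sums_mult[OF power_half_series, of e] by (intro suminf_ennreal_eq) auto
  finally show "outer_content (\<Union>i. A i) \<le> (\<Sum>n. outer_content (A n)) + ennreal e" .
qed

lemma outer_measure_space_outer: "outer_measure_space (Pow (topspace T)) outer_content"
  unfolding outer_measure_space_def
proof (intro conjI)
  show "positive (Pow (topspace T)) outer_content"
    using outer_open[OF openin_empty] inner_empty by (simp add: positive_def)
  show "increasing (Pow (topspace T)) outer_content" by (simp add: increasing_def outer_mono)
  show "countably_subadditive (Pow (topspace T)) outer_content"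
    unfolding countably_subadditive_def by (intro allI impI outer_UN) auto
qed

text \<open>
  A closed subset \<open>C\<close> of \<open>W \<inter> V\<close> that almost exhausts the content of \<open>W \<inter> V\<close> leaves \<open>W - C\<close> as an
  open neighbourhood of \<open>E - V\<close>; closed subsets of \<open>W - C\<close> are disjoint from \<open>C\<close>, and \<open>\<nu>\<close> is
  additive on the two.
\<close>

lemma outer_split:
  assumes V: "openin T V" and E: "E \<subseteq> topspace T"
  shows "outer_content (E \<inter> V) + outer_content (E - V) \<le> outer_content E"
  unfolding outer_content_def[of E]
proof (rule INF_greatest, clarify)
  fix W assume W: "openin T W" "E \<subseteq> W"
  have *: "ennreal (\<nu> C) + outer_content (E - V) \<le> inner_content W" if C: "closedin T C" "C \<subseteq> W \<inter> V" for C
  proof -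
    have "outer_content (E - V) \<le> inner_content (W - C)"
      using W C by (intro outer_le openin_diff) auto
    moreover have "ennreal (\<nu> C) + ennreal (\<nu> D) \<le> inner_content W" if D: "closedin T D" "D \<subseteq> W - C" for D
    proof -
      have "\<nu> (C \<union> D) = \<nu> C + \<nu> D"
        using C D by (intro additive closedin_borel_sigma) auto
      then have "ennreal (\<nu> C) + ennreal (\<nu> D) = ennreal (\<nu> (C \<union> D))"
        using nonneg[OF closedin_borel_sigma[OF C(1)]] nonneg[OF closedin_borel_sigma[OF D(1)]] by simp
      also have "\<dots> \<le> inner_content W" using C D by (intro inner_upper closedin_Un) auto
      finally show ?thesis .
    qed
    then have "ennreal (\<nu> C) + inner_content (W - C) \<le> inner_content W"
      unfolding inner_content_def[of "W - C"]
      by (subst ennreal_SUP_add_right) (auto intro!: SUP_least exI[of _ "{}"])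
    ultimately show ?thesis by (meson add_left_mono order_trans)
  qed
  have "outer_content (E \<inter> V) \<le> inner_content (W \<inter> V)" using W V by (intro outer_le) auto
  moreover have "inner_content (W \<inter> V) + outer_content (E - V) \<le> inner_content W"
    unfolding inner_content_def[of "W \<inter> V"]
    by (subst ennreal_SUP_add_left[symmetric]) (auto intro!: SUP_least exI[of _ "{}"] *[simplified])
  ultimately show "outer_content (E \<inter> V) + outer_content (E - V) \<le> inner_content W" by (meson add_right_mono order_trans)
qed

lemma open_lambda_system:
  assumes V: "openin T V"
  shows "V \<in> lambda_system (topspace T) (Pow (topspace T)) outer_content"
  unfolding lambda_system_def
proof (intro CollectI conjI ballI)
  show VT: "V \<in> Pow (topspace T)" using V openin_subset by auto
  fix E assume "E \<in> Pow (topspace T)"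
  then have E: "E \<subseteq> topspace T" by simp
  have eq: "V \<inter> E = E \<inter> V" "(topspace T - V) \<inter> E = E - V" using E by auto
  \<comment> \<open>Finite subadditivity is the countable one for a sequence that is empty from the third set on.\<close>
  let ?B = "\<lambda>i::nat. if i = 0 then E \<inter> V else if i = 1 then E - V else {}"
  have "outer_content (\<Union>i. ?B i) \<le> (\<Sum>i. outer_content (?B i))" using E by (intro outer_UN) auto
  also have "\<dots> = (\<Sum>i\<in>{0,1}. outer_content (?B i))"
    using outer_open[OF openin_empty] inner_empty by (intro suminf_finite) auto
  also have "\<dots> = outer_content (E \<inter> V) + outer_content (E - V)" by simp
  also have "(\<Union>i. ?B i) = E" by (auto split: if_splits)
  finally show "outer_content (V \<inter> E) + outer_content ((topspace T - V) \<inter> E) = outer_content E"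
    unfolding eq using outer_split[OF V E] by (rule antisym[rotated])
qed

definition content_measure :: "'b measure" where
  "content_measure = measure_of (topspace T) (borel_sets T) outer_content"

lemma sets_content_measure: "sets content_measure = borel_sets T"
  unfolding content_measure_def using sets.sigma_sets_eq[of "borel_sigma T"] sets.space_closed[of "borel_sigma T"]
  by (simp add: space_borel_sigma)

lemma emeasure_content_measure:
  assumes "A \<in> borel_sets T"
  shows "emeasure content_measure A = outer_content A"
proof -
  let ?L = "lambda_system (topspace T) (Pow (topspace T)) outer_content"
  have ms: "measure_space (topspace T) ?L outer_content"
    using sigma_algebra.caratheodory_lemma[OF sigma_algebra_Pow outer_measure_space_outer] .
  then have sa: "sigma_algebra (topspace T) ?L" by (simp add: measure_space_def)
  have "borel_sets T \<subseteq> ?L"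
    unfolding sets_borel_sigma
    by (rule sigma_algebra.sigma_sets_subset[OF sa]) (auto intro: open_lambda_system)
  moreover have "sigma_algebra (topspace T) (borel_sets T)"
    using sets.sigma_algebra_axioms[of "borel_sigma T"] by (simp add: space_borel_sigma)
  ultimately have "measure_space (topspace T) (borel_sets T) outer_content"
    using measure_down[OF ms] by blast
  then show ?thesis
    unfolding content_measure_def measure_space_def using assms by (auto intro: emeasure_measure_of_sigma)
qed

lemma space_content_measure: "space content_measure = topspace T"
  using sets_eq_imp_space_eq[OF sets_content_measure] by (simp add: space_borel_sigma)

lemma finite_content_measure: "finite_measure content_measure"
  using outer_finite[of "topspace T"] emeasure_content_measure[of "topspace T"]
  by (intro finite_measureI) (simp add: space_content_measure openin_borel_sigma)

text \<open>
  Passing to the regular measure can only decrease the mass of open sets, while the total mass is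
  kept. These two facts suffice to identify the integrals of continuous functions.
\<close>

lemma content_measure_open_le:
  assumes V: "openin T V"
  shows "measure content_measure V \<le> \<nu> V"
proof -
  have "emeasure content_measure V \<le> ennreal (\<nu> V)"
    using inner_le V by (simp add: emeasure_content_measure openin_borel_sigma outer_open)
  then show ?thesis
    using nonneg V openin_borel_sigma unfolding measure_def by (intro enn2real_leI) auto
qed

lemma content_measure_space: "measure content_measure (topspace T) = \<nu> (topspace T)"
proof (rule antisym[OF content_measure_open_le])
  have "ennreal (\<nu> (topspace T)) \<le> emeasure content_measure (topspace T)"
    using inner_upper[of "topspace T" "topspace T"]
    by (simp add: emeasure_content_measure openin_borel_sigma outer_open)
  then show "\<nu> (topspace T) \<le> measure content_measure (topspace T)"
    using finite_measure.emeasure_eq_measure[OF finite_content_measure] by simp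
qed simp

lemma content_measure_outer_regular:
  assumes A: "A \<in> borel_sets T" and e: "e > 0"
  obtains U where "openin T U" "A \<subseteq> U" "measure content_measure (U - A) < e"
proof -
  interpret finite_measure content_measure by (rule finite_content_measure)
  have AT: "A \<subseteq> topspace T" using sets.sets_into_space[OF A] by (simp add: space_borel_sigma)
  have "outer_content A < outer_content A + ennreal e"
    using outer_finite[OF AT] e by (rule ennreal_less_add)
  then obtain U where U: "openin T U" "A \<subseteq> U" "inner_content U < outer_content A + ennreal e"
    using outer_approx by blast
  then have "emeasure content_measure U < emeasure content_measure A + ennreal e"
    using A by (simp add: emeasure_content_measure openin_borel_sigma outer_open)
  then have "ennreal (measure content_measure U) < ennreal (measure content_measure A + e)"
    using e by (simp add: emeasure_eq_measure)
  then have "measure content_measure U < measure content_measure A + e"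
    by (subst (asm) ennreal_less_iff) auto
  then have "measure content_measure (U - A) < e"
    using U A by (subst finite_measure_Diff) (auto simp: sets_content_measure openin_borel_sigma)
  then show ?thesis using that U by blast
qed

lemma regular_content_measure: "regular_measure T content_measure"
  unfolding regular_measure_def regular_set_function_def
proof (intro conjI ballI allI impI finite_content_measure sets_content_measure)
  interpret finite_measure content_measure by (rule finite_content_measure)
  fix A and e :: real assume A: "A \<in> borel_sets T" and e: "e > 0"
  have AT: "A \<subseteq> topspace T" using sets.sets_into_space[OF A] by (simp add: space_borel_sigma)
  obtain U where U: "openin T U" "A \<subseteq> U" "measure content_measure (U - A) < e / 2"
    using content_measure_outer_regular[OF A, of "e/2"] e by auto
  have A': "topspace T - A \<in> borel_sets T" using A by (auto simp: openin_borel_sigma)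
  obtain W where W: "openin T W" "topspace T - A \<subseteq> W" "measure content_measure (W - (topspace T - A)) < e / 2"
    using content_measure_outer_regular[OF A', of "e/2"] e by auto
  let ?K = "topspace T - W"
  have "U - ?K \<subseteq> (U - A) \<union> (W - (topspace T - A))"
    using openin_subset[OF U(1)] by auto
  then have "measure content_measure (U - ?K) \<le> measure content_measure ((U - A) \<union> (W - (topspace T - A)))"
    using U W A A'
    by (intro finite_measure_mono) (auto simp: sets_content_measure intro!: sets.Un sets.Diff openin_borel_sigma[of T U] openin_borel_sigma[of T W])
  also have "\<dots> \<le> measure content_measure (U - A) + measure content_measure (W - (topspace T - A))"
    using U W A A' by (intro measure_Un_le) (auto simp: sets_content_measure openin_borel_sigma)
  also have "\<dots> < e" using U W by simp
  finally show "\<exists>K U. closedin T K \<and> openin T U \<and> K \<subseteq> A \<and> A \<subseteq> U \<and> measure content_measure (U - K) < e"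
    using U W by (intro exI[of _ ?K] exI[of _ U]) auto
qed

end

section \<open>Limits of sequences of measures\<close>

text \<open>
  A filter that plays the part of an ultrafilter, or of a Banach limit. The sequences themselves
  serve as the index set of a product of compact intervals, in which \<open>n \<mapsto> (s \<mapsto> s n)\<close> has a cluster
  point by Tychonoff's theorem; the filter selects the indices that approach this point.
\<close>

lemma limit_filter_exists:
  obtains G :: "nat filter" where "G \<noteq> bot" "G \<le> sequentially"
    "\<forall>s :: nat \<Rightarrow> real. Bseq s \<longrightarrow> (\<exists>l. (s \<longlongrightarrow> l) G)"
proof -
  define c where "c s = (if Bseq s then SOME K. \<forall>n. \<bar>s n\<bar> \<le> K else 0)" for s :: "nat \<Rightarrow> real"
  define X where "X n = (\<lambda>s. if Bseq s then s n else 0 :: real)" for n :: nat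
  have c: "\<bar>X n s\<bar> \<le> c s" for n s
  proof (cases "Bseq s")
    case True
    then have "\<exists>K. \<forall>n. \<bar>s n\<bar> \<le> K" by (auto simp: Bseq_def)
    from someI_ex[OF this] have "\<forall>n. \<bar>s n\<bar> \<le> c s" unfolding c_def using True by simp
    then show ?thesis using True by (simp add: X_def)
  qed (simp add: X_def c_def)
  let ?K = "PiE UNIV (\<lambda>s. cball 0 (c s)) :: ((nat \<Rightarrow> real) \<Rightarrow> real) set"
  have "compactin (product_topology (\<lambda>_. euclidean) UNIV) ?K"
    unfolding compactin_PiE by auto
  then have "compact ?K" unfolding euclidean_product_topology by simp
  moreover have "eventually (\<lambda>x. x \<in> ?K) (filtermap X sequentially)"
    unfolding eventually_filtermap
    using c by (intro always_eventually allI) (auto simp: PiE_def Pi_def)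
  moreover have "filtermap X sequentially \<noteq> bot" by (simp add: filtermap_bot_iff)
  ultimately obtain L where L: "inf (nhds L) (filtermap X sequentially) \<noteq> bot"
    unfolding compact_filter by blast
  define G where "G = inf sequentially (filtercomap X (nhds L))"
  have "G \<noteq> bot"
  proof
    assume "G = bot"
    then have "eventually (\<lambda>_. False) G" by simp
    then obtain P Q where P: "eventually P sequentially" and Q: "eventually Q (filtercomap X (nhds L))"
      and PQ: "\<And>n. P n \<Longrightarrow> Q n \<Longrightarrow> False"
      unfolding G_def eventually_inf by auto
    obtain R where R: "eventually R (nhds L)" "\<And>n. R (X n) \<Longrightarrow> Q n"
      using Q unfolding eventually_filtercomap by blast
    have "eventually (\<lambda>x. \<not> R x) (filtermap X sequentially)"
      unfolding eventually_filtermap using P by (rule eventually_mono) (use R PQ in blast)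
    then have "eventually (\<lambda>x. False) (inf (nhds L) (filtermap X sequentially))"
      unfolding eventually_inf using R(1) by blast
    then show False using L by (simp add: trivial_limit_def)
  qed
  moreover have "G \<le> sequentially" unfolding G_def by simp
  moreover have "\<exists>l. (s \<longlongrightarrow> l) G" if s: "Bseq s" for s :: "nat \<Rightarrow> real"
  proof -
    have "(X \<longlongrightarrow> L) G"
      unfolding G_def filterlim_iff_le_filtercomap by simp
    then have "((\<lambda>n. X n s) \<longlongrightarrow> L s) G"
    proof (intro topological_tendstoI)
      fix S assume XL: "(X \<longlongrightarrow> L) G" and S: "open S" "L s \<in> S"
      have "open ((\<lambda>x. x s) -` S :: ((nat \<Rightarrow> real) \<Rightarrow> real) set)"
        by (rule open_vimage[OF S(1) continuous_on_product_coordinates])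
      then show "\<forall>\<^sub>F n in G. X n s \<in> S" using topological_tendstoD[OF XL] S(2) by fastforce
    qed
    then show ?thesis using s by (auto simp: X_def)
  qed
  ultimately show ?thesis using that by blast
qed

text \<open>
  The limit of the values on sets is a finitely additive \<open>\<nu>\<close>, and \<open>m\<close> is the regular measure attached
  to it. For continuous \<open>f\<close> with values in the unit interval the level sets \<open>{f > i/j}\<close> are open, and
  \<open>m \<le> \<nu>\<close> on open sets bounds the level sums of \<open>\<integral>f dm\<close> by the limit of those of \<open>\<integral>f dN\<^sub>n\<close>. The same
  inequality for \<open>- f\<close> is the reverse one; that \<open>- f\<close> again reduces to values in the unit interval uses
  the equality of the total masses.
\<close>

theorem weak_limit_of_measures:
  fixes N :: "nat \<Rightarrow> 'b measure"
  assumes T: "compact_space T" "Hausdorff_space T"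
    and N: "\<And>n. finite_measure (N n)" "\<And>n. sets (N n) = borel_sets T"
    and c: "\<And>n. measure (N n) (topspace T) \<le> c"
    and G: "G \<noteq> bot" "\<forall>s :: nat \<Rightarrow> real. Bseq s \<longrightarrow> (\<exists>l. (s \<longlongrightarrow> l) G)"
  obtains m where "regular_measure T m"
    "((\<lambda>n. measure (N n) (topspace T)) \<longlongrightarrow> measure m (topspace T)) G"
    "\<forall>f. continuous_map T euclideanreal f \<longrightarrow> ((\<lambda>n. integral\<^sup>L (N n) f) \<longlongrightarrow> integral\<^sup>L m f) G"
proof -
  have spN: "space (N n) = topspace T" for n
    using sets_eq_imp_space_eq[OF N(2)] by (simp add: space_borel_sigma)
  have le_c: "measure (N n) A \<le> c" for n A
    using finite_measure.bounded_measure[OF N(1), of n A] c[of n] by (simp add: spN)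
  have "\<exists>l. ((\<lambda>n. measure (N n) A) \<longlongrightarrow> l) G" for A
    using le_c[of _ A] by (intro G(2)[rule_format] BseqI'[of _ c]) auto
  then obtain \<nu> where \<nu>: "\<And>A. ((\<lambda>n. measure (N n) A) \<longlongrightarrow> \<nu> A) G" by metis
  interpret \<nu>: additive_content T \<nu>
  proof
    show "compact_space T" "Hausdorff_space T" by fact+
    show "0 \<le> \<nu> A" for A by (rule tendsto_lowerbound[OF \<nu> _ G(1)]) simp
    fix A B assume AB: "A \<in> borel_sets T" "B \<in> borel_sets T" "A \<inter> B = {}"
    have "measure (N n) (A \<union> B) = measure (N n) A + measure (N n) B" for n
      using AB by (intro finite_measure.finite_measure_Union N) (auto simp: N)
    then have "((\<lambda>n. measure (N n) (A \<union> B)) \<longlongrightarrow> \<nu> A + \<nu> B) G"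
      by (simp add: tendsto_add \<nu>)
    then show "\<nu> (A \<union> B) = \<nu> A + \<nu> B" by (rule tendsto_unique[OF G(1) \<nu>])
  qed
  let ?m = "\<nu>.content_measure"
  have fm: "finite_measure ?m" by (rule \<nu>.finite_content_measure)
  have upper01: "integral\<^sup>L ?m f \<le> L"
    if f: "continuous_map T euclideanreal f" "\<And>x. x \<in> topspace T \<Longrightarrow> 0 \<le> f x \<and> f x \<le> 1"
      and L: "((\<lambda>n. integral\<^sup>L (N n) f) \<longlongrightarrow> L) G" for f L
  proof -
    have fb: "f \<in> borel_measurable (borel_sigma T)" by (rule continuous_map_borel_sigma[OF f(1)])
    have fm': "f \<in> borel_measurable ?m" "\<And>n. f \<in> borel_measurable (N n)"
      using fb by (auto simp: measurable_cong_sets[OF \<nu>.sets_content_measure refl] measurable_cong_sets[OF N(2) refl])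
    have "integral\<^sup>L ?m f \<le> L + \<nu> (topspace T) / j" if j: "j > 0" for j :: nat
    proof -
      let ?S = "\<lambda>i. {x \<in> topspace T. real i / j < f x}"
      have S: "openin T (?S i)" for i
      proof -
        have "openin T {x \<in> topspace T. f x \<in> {real i / j<..}}"
          using f(1) by (intro openin_continuous_map_preimage) auto
        then show ?thesis by simp
      qed
      have "(\<Sum>i=1..j. \<nu> (?S i)) / j \<le> L"
      proof (rule tendsto_le[OF G(1) L])
        show "((\<lambda>n. (\<Sum>i=1..j. measure (N n) (?S i)) / j) \<longlongrightarrow> (\<Sum>i=1..j. \<nu> (?S i)) / j) G"
          using j by (intro tendsto_divide tendsto_sum \<nu> tendsto_const) auto
        show "\<forall>\<^sub>F n in G. (\<Sum>i=1..j. measure (N n) (?S i)) / j \<le> integral\<^sup>L (N n) f"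
          using level_sum_le_integral[OF N(1) fm'(2) _ j] f(2) by (simp add: spN)
      qed
      moreover have "integral\<^sup>L ?m f \<le> (\<Sum>i=1..j. measure ?m (?S i)) / j + measure ?m (topspace T) / j"
        using integral_le_level_sum[OF fm fm'(1) _ j] f(2) by (simp add: \<nu>.space_content_measure)
      moreover have "(\<Sum>i=1..j. measure ?m (?S i)) / j \<le> (\<Sum>i=1..j. \<nu> (?S i)) / j"
        using \<nu>.content_measure_open_le[OF S] by (intro divide_right_mono sum_mono) auto
      ultimately show ?thesis
        unfolding \<nu>.content_measure_space by (meson add_right_mono order_trans)
    qed
    then have "\<forall>\<^sub>F j in sequentially. integral\<^sup>L ?m f \<le> L + \<nu> (topspace T) / real j"
      by (intro eventually_mono[OF eventually_gt_at_top[of 0]])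
    moreover have "(\<lambda>j. L + \<nu> (topspace T) / real j) \<longlonglongrightarrow> L + 0"
      by (intro tendsto_add tendsto_const lim_const_over_n)
    ultimately show ?thesis
      using tendsto_lowerbound[of "\<lambda>j. L + \<nu> (topspace T) / real j" "L + 0" sequentially] by simp
  qed
  have int: "integrable (N n) f" "integrable ?m f" and conv: "\<exists>L. ((\<lambda>n. integral\<^sup>L (N n) f) \<longlongrightarrow> L) G"
    and upper: "((\<lambda>n. integral\<^sup>L (N n) f) \<longlongrightarrow> L) G \<Longrightarrow> integral\<^sup>L ?m f \<le> L"
    if f: "continuous_map T euclideanreal f" for f n L
  proof -
    have "compactin euclideanreal (f ` topspace T)"
      using image_compactin[OF _ f] T(1) by (simp add: compact_space_def)
    then have "bounded (f ` topspace T)" by (simp add: compact_imp_bounded)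
    then obtain D where D: "D > 0" "\<And>x. x \<in> topspace T \<Longrightarrow> \<bar>f x\<bar> \<le> D"
      unfolding bounded_pos by auto
    have bf: "bdd_measurable (borel_sigma T) f"
      using D(2) by (intro bdd_measurableI[of _ _ D] continuous_map_borel_sigma f) (simp add: space_borel_sigma)
    show int: "integrable (N n) f" "integrable ?m f" for n
      by (rule bdd_measurable_integrable[OF bf N] bdd_measurable_integrable[OF bf fm \<nu>.sets_content_measure])+
    have "\<bar>integral\<^sup>L (N n) f\<bar> \<le> D * c" for n
    proof -
      have "\<bar>integral\<^sup>L (N n) f\<bar> \<le> integral\<^sup>L (N n) (\<lambda>x. \<bar>f x\<bar>)" by simp
      also have "\<dots> \<le> integral\<^sup>L (N n) (\<lambda>_. D)"
        using D(2) int(1) finite_measure.integrable_const[OF N(1)] by (intro integral_mono) (auto simp: spN)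
      also have "\<dots> \<le> D * c" using c[of n] D(1) by (simp add: spN mult.commute)
      finally show ?thesis .
    qed
    then show "\<exists>L. ((\<lambda>n. integral\<^sup>L (N n) f) \<longlongrightarrow> L) G"
      by (intro G(2)[rule_format] BseqI'[of _ "D * c"]) simp
    assume L: "((\<lambda>n. integral\<^sup>L (N n) f) \<longlongrightarrow> L) G"
    let ?g = "\<lambda>x. (f x + D) / (2 * D)"
    have g: "0 \<le> ?g x \<and> ?g x \<le> 1" if "x \<in> topspace T" for x
      using D(1) D(2)[OF that] by (auto simp: field_simps)
    have gc: "continuous_map T euclideanreal ?g"
      using f D(1) by (intro continuous_map_real_divide continuous_map_add continuous_map_canonical_const) auto
    have eq: "integral\<^sup>L M ?g = (integral\<^sup>L M f + D * measure M (topspace T)) / (2 * D)"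
      if "integrable M f" "finite_measure M" "space M = topspace T" for M
      using that D(1) finite_measure.integrable_const[OF that(2), of D] by (simp add: field_simps)
    have "((\<lambda>n. (integral\<^sup>L (N n) f + D * measure (N n) (topspace T)) / (2 * D)) \<longlongrightarrow>
        (L + D * \<nu> (topspace T)) / (2 * D)) G"
      using D(1) by (intro tendsto_intros L \<nu>) auto
    then have "((\<lambda>n. integral\<^sup>L (N n) ?g) \<longlongrightarrow> (L + D * \<nu> (topspace T)) / (2 * D)) G"
      unfolding eq[OF int(1) N(1) spN] .
    from upper01[OF gc g this] show "integral\<^sup>L ?m f \<le> L"
      unfolding eq[OF int(2) fm \<nu>.space_content_measure] \<nu>.content_measure_space
      using D(1) by (simp add: divide_le_cancel)
  qed
  have "\<forall>f. continuous_map T euclideanreal f \<longrightarrow> ((\<lambda>n. integral\<^sup>L (N n) f) \<longlongrightarrow> integral\<^sup>L ?m f) G"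
  proof (intro allI impI)
    fix f assume f: "continuous_map T euclideanreal f"
    obtain L where L: "((\<lambda>n. integral\<^sup>L (N n) f) \<longlongrightarrow> L) G" using conv[OF f] by blast
    have "((\<lambda>n. integral\<^sup>L (N n) (\<lambda>x. - f x)) \<longlongrightarrow> - L) G" using tendsto_minus[OF L] by simp
    from upper[OF continuous_map_minus[OF f] this] have "L \<le> integral\<^sup>L ?m f" by simp
    then have "integral\<^sup>L ?m f = L" using upper[OF f L] by simp
    then show "((\<lambda>n. integral\<^sup>L (N n) f) \<longlongrightarrow> integral\<^sup>L ?m f) G" using L by simp
  qed
  then show ?thesis
    by (rule that[OF \<nu>.regular_content_measure, rotated]) (use \<nu>[of "topspace T"] \<nu>.content_measure_space in simp)
qed

section \<open>The weak-star topology of the dual ball\<close>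

lemma topspace_dual_ball: "topspace weak_star_dual_ball = cball 0 1"
  by (simp add: weak_star_dual_ball_def strong_operator_topology_topspace)

lemma continuous_map_weak_star_evaluation:
  "continuous_map weak_star_dual_ball euclideanreal (\<lambda>\<phi>. blinfun_apply \<phi> x)"
  unfolding weak_star_dual_ball_def
  by (intro continuous_map_from_subtopology strong_operator_topology_continuous_evaluation)

lemma dual_ball_apply_le:
  assumes "\<phi> \<in> cball 0 1"
  shows "\<bar>blinfun_apply \<phi> x\<bar> \<le> norm x"
proof -
  have "\<bar>blinfun_apply \<phi> x\<bar> \<le> norm \<phi> * norm x" using norm_blinfun[of \<phi> x] by simp
  also have "\<dots> \<le> 1 * norm x" using assms by (intro mult_right_mono) auto
  finally show ?thesis by simp
qed

text \<open>
  Different functionals differ at some vector, and evaluation there is continuous.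
\<close>

lemma Hausdorff_dual_ball: "Hausdorff_space (weak_star_dual_ball :: ('a::real_normed_vector \<Rightarrow>\<^sub>L real) topology)"
  unfolding Hausdorff_space_def
proof (intro allI impI, elim conjE)
  fix \<phi> \<psi> :: "'a \<Rightarrow>\<^sub>L real"
  assume in_top: "\<phi> \<in> topspace weak_star_dual_ball" "\<psi> \<in> topspace weak_star_dual_ball" and "\<phi> \<noteq> \<psi>"
  then obtain x where "blinfun_apply \<phi> x \<noteq> blinfun_apply \<psi> x" by (metis blinfun_eqI)
  then obtain U V where UV: "open U" "open V" "blinfun_apply \<phi> x \<in> U" "blinfun_apply \<psi> x \<in> V" "U \<inter> V = {}"
    by (metis hausdorff)
  let ?pre = "\<lambda>S. {\<xi> \<in> topspace weak_star_dual_ball. blinfun_apply \<xi> x \<in> S}"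
  have "openin weak_star_dual_ball (?pre S)" if "open S" for S
    using that by (intro openin_continuous_map_preimage[OF continuous_map_weak_star_evaluation]) auto
  then show "\<exists>U V. openin weak_star_dual_ball U \<and> openin weak_star_dual_ball V \<and> \<phi> \<in> U \<and> \<psi> \<in> V \<and> disjnt U V"
    using UV in_top by (intro exI[of _ "?pre U"] exI[of _ "?pre V"]) (auto simp: disjnt_def)
qed

lemma compactin_pullback_topology:
  assumes "compactin X (f ` S)" "S \<subseteq> A"
  shows "compactin (pullback_topology A f X) S"
  unfolding compactin_def
proof (intro conjI allI impI)
  show "S \<subseteq> topspace (pullback_topology A f X)"
    using assms compactin_subset_topspace[OF assms(1)] by (auto simp: topspace_pullback_topology)
  fix \<U> assume \<U>: "Ball \<U> (openin (pullback_topology A f X)) \<and> S \<subseteq> \<Union>\<U>"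
  then have "\<forall>U\<in>\<U>. \<exists>V. openin X V \<and> U = f -` V \<inter> A" by (simp add: openin_pullback_topology)
  from bchoice[OF this] obtain V where V: "\<forall>U\<in>\<U>. openin X (V U) \<and> U = f -` V U \<inter> A" by (rule exE)
  then have V1: "\<And>U. U \<in> \<U> \<Longrightarrow> openin X (V U)"
    and V2: "\<And>U s. U \<in> \<U> \<Longrightarrow> s \<in> U \<longleftrightarrow> f s \<in> V U \<and> s \<in> A" by simp_all blast
  have "f ` S \<subseteq> \<Union>(V ` \<U>)"
  proof
    fix y assume "y \<in> f ` S"
    then obtain s where s: "s \<in> S" "y = f s" by blast
    then obtain U where "U \<in> \<U>" "s \<in> U" using \<U> by blast
    then show "y \<in> \<Union>(V ` \<U>)" using V2[of U s] s(2) by blast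
  qed
  then obtain \<F> where F: "finite \<F>" "\<F> \<subseteq> V ` \<U>" "f ` S \<subseteq> \<Union>\<F>"
    using compactinD[OF assms(1), of "V ` \<U>"] V1 by (metis imageE)
  then obtain \<G> where G: "\<G> \<subseteq> \<U>" "finite \<G>" "\<F> = V ` \<G>" by (meson finite_subset_image)
  have "S \<subseteq> \<Union>\<G>"
  proof
    fix s assume s: "s \<in> S"
    then obtain U where U: "U \<in> \<G>" "f s \<in> V U" using F(3) G(3) by blast
    then have "U \<in> \<U>" using G(1) by blast
    then have "s \<in> U" using V2[of U s] U s assms(2) by blast
    then show "s \<in> \<Union>\<G>" using U(1) by blast
  qed
  then show "\<exists>\<F>. finite \<F> \<and> \<F> \<subseteq> \<U> \<and> S \<subseteq> \<Union>\<F>" using G(1,2) by (intro exI[of _ \<G>] conjI)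
qed

text \<open>
  Banach-Alaoglu: the functionals in the dual ball are exactly the linear elements of the compact
  product of the intervals \<open>[-\<parallel>x\<parallel>, \<parallel>x\<parallel>]\<close>, and linearity is a closed condition.
\<close>

theorem compact_dual_ball:
  "compact_space (weak_star_dual_ball :: ('a::real_normed_vector \<Rightarrow>\<^sub>L real) topology)"
proof -
  let ?B = "PiE UNIV (\<lambda>x. cball 0 (norm x)) :: ('a \<Rightarrow> real) set"
  let ?L = "{f :: 'a \<Rightarrow> real. linear f}"
  have "compactin (product_topology (\<lambda>_. euclidean) UNIV) ?B"
    unfolding compactin_PiE by auto
  then have B: "compact ?B" unfolding euclidean_product_topology by simp
  have "closed {f :: 'a \<Rightarrow> real. (\<forall>x y. f (x + y) = f x + f y) \<and> (\<forall>c x. f (c *\<^sub>R x) = c *\<^sub>R f x)}"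
    by (intro closed_Collect_conj closed_Collect_all closed_Collect_eq continuous_intros
        continuous_on_product_coordinates)
  then have "closed ?L" by (simp add: linear_iff)
  then have "compact (?B \<inter> ?L)" by (rule compact_Int_closed[OF B])
  moreover have "blinfun_apply ` (cball 0 1 :: ('a \<Rightarrow>\<^sub>L real) set) = ?B \<inter> ?L"
  proof (intro equalityI subsetI)
    fix f assume "f \<in> ?B \<inter> ?L"
    then have f: "linear f" "\<And>x. \<bar>f x\<bar> \<le> norm x" by (auto simp: PiE_def Pi_def)
    have bl: "bounded_linear f"
      by (rule bounded_linear.intro[OF f(1)]) (use f(2) in \<open>auto intro!: bounded_linear_axioms.intro exI[of _ 1]\<close>)
    have "norm (Blinfun f) \<le> 1"
      by (rule norm_blinfun_bound) (use bl f in \<open>auto simp: bounded_linear_Blinfun_apply\<close>)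
    then show "f \<in> blinfun_apply ` cball 0 1"
      using bounded_linear_Blinfun_apply[OF bl] by (intro image_eqI[of _ _ "Blinfun f"]) auto
  next
    fix f assume "f \<in> blinfun_apply ` (cball 0 1 :: ('a \<Rightarrow>\<^sub>L real) set)"
    then obtain \<phi> :: "'a \<Rightarrow>\<^sub>L real" where \<phi>: "\<phi> \<in> cball 0 1" "f = blinfun_apply \<phi>" by auto
    have "linear f" unfolding \<phi>(2) by (simp add: linear_iff blinfun.add_right blinfun.scaleR_right)
    then show "f \<in> ?B \<inter> ?L" using dual_ball_apply_le[OF \<phi>(1)] \<phi>(2) by auto
  qed
  ultimately have "compactin euclidean (blinfun_apply ` (cball 0 1 :: ('a \<Rightarrow>\<^sub>L real) set))" by simp
  then have "compactin strong_operator_topology (cball 0 1 :: ('a \<Rightarrow>\<^sub>L real) set)"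
    unfolding strong_operator_topology_def by (rule compactin_pullback_topology) simp
  then show ?thesis
    unfolding weak_star_dual_ball_def by (rule compact_space_subtopology)
qed

section \<open>Existence of functionals of norm one\<close>

definition sublinear :: "('a::real_vector \<Rightarrow> real) \<Rightarrow> bool" where
  "sublinear p \<longleftrightarrow> (\<forall>x y. p (x + y) \<le> p x + p y) \<and> (\<forall>c\<ge>0. \<forall>x. p (c *\<^sub>R x) = c * p x)"

lemma sublinear_zero:
  assumes "sublinear p"
  shows "p 0 = 0"
proof -
  have "p (0 *\<^sub>R 0) = 0 * p 0" using assms unfolding sublinear_def by blast
  then show ?thesis by simp
qed

lemma sublinear_minus_le:
  assumes p: "sublinear p"
  shows "- p (- x) \<le> p x"
proof -
  from p have "p (x + - x) \<le> p x + p (- x)" unfolding sublinear_def by blast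
  then show ?thesis using sublinear_zero[OF p] by simp
qed

text \<open>
  The two infima needed for the Hahn-Banach theorem, over a chain of sublinear functionals and over
  the shifts of a single one, are instances of this lemma.
\<close>

lemma sublinear_INF:
  fixes h :: "'i \<Rightarrow> 'a::real_vector \<Rightarrow> real"
  assumes I: "I \<noteq> {}" and bdd: "\<And>x. bdd_below ((\<lambda>i. h i x) ` I)"
    and add: "\<And>i j x y. i \<in> I \<Longrightarrow> j \<in> I \<Longrightarrow> \<exists>l\<in>I. h l (x + y) \<le> h i x + h j y"
    and scale: "\<And>i c x. i \<in> I \<Longrightarrow> c > 0 \<Longrightarrow> \<exists>l\<in>I. h l (c *\<^sub>R x) \<le> c * h i x"
    and zero: "\<And>i. i \<in> I \<Longrightarrow> h i 0 = 0"
  shows "sublinear (\<lambda>x. INF i\<in>I. h i x)"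
  unfolding sublinear_def
proof (intro conjI allI impI)
  let ?u = "\<lambda>x. INF i\<in>I. h i x"
  have le: "?u x \<le> h i x" if "i \<in> I" for i x using bdd that by (rule cINF_lower)
  show "?u (x + y) \<le> ?u x + ?u y" for x y
  proof -
    have 1: "?u (x + y) \<le> h i x + h j y" if "i \<in> I" "j \<in> I" for i j
      using add[OF that] le by (meson order_trans)
    have "?u (x + y) - h i x \<le> ?u y" if "i \<in> I" for i
      using 1[OF that] by (intro cINF_greatest I) (simp add: diff_le_eq add.commute)
    then have "?u (x + y) - ?u y \<le> ?u x"
      by (intro cINF_greatest I) (simp add: algebra_simps)
    then show ?thesis by simp
  qed
  have pos: "?u (c *\<^sub>R x) \<le> c * ?u x" if c: "c > 0" for c x
  proof -
    have "?u (c *\<^sub>R x) / c \<le> ?u x"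
    proof (intro cINF_greatest I)
      fix i assume "i \<in> I"
      then have "?u (c *\<^sub>R x) \<le> c * h i x" using scale[OF _ c] le by (meson order_trans)
      then show "?u (c *\<^sub>R x) / c \<le> h i x" using c by (simp add: field_simps)
    qed
    then show ?thesis using c by (simp add: field_simps)
  qed
  fix c :: real and x assume "c \<ge> 0"
  show "?u (c *\<^sub>R x) = c * ?u x"
  proof (cases "c = 0")
    case True
    then show ?thesis using zero I by simp
  next
    case False
    then have c: "c > 0" using \<open>c \<ge> 0\<close> by simp
    have "?u (inverse c *\<^sub>R (c *\<^sub>R x)) \<le> inverse c * ?u (c *\<^sub>R x)" using c by (intro pos) simp
    then have "c * ?u x \<le> ?u (c *\<^sub>R x)" using c by (simp add: field_simps)
    then show ?thesis using pos[OF c] by (rule antisym[rotated])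
  qed
qed

text \<open>
  The functional \<open>q(x) = inf\<^bsub>t\<ge>0\<^esub> (p(x + t y) - t p(y))\<close> has these properties, the two bounds being
  those for \<open>t = 0\<close> and \<open>t = 1\<close>. If \<open>p\<close> is minimal then \<open>q = p\<close>, and the second bound becomes
  superadditivity of \<open>p\<close>.
\<close>

lemma sublinear_shift:
  assumes p: "sublinear p"
  obtains q where "sublinear q" "\<And>x. q x \<le> p x" "\<And>x. q x \<le> p (x + y) - p y"
proof -
  let ?h = "\<lambda>t x. p (x + t *\<^sub>R y) - t * p y"
  let ?q = "\<lambda>x. INF t\<in>{0..}. ?h t x"
  have padd: "\<And>x y. p (x + y) \<le> p x + p y" and psc: "\<And>c x. c \<ge> 0 \<Longrightarrow> p (c *\<^sub>R x) = c * p x"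
    using p by (auto simp: sublinear_def)
  have lower: "- p (- x) \<le> ?h t x" if "t \<ge> 0" for t x
    using padd[of "x + t *\<^sub>R y" "- x"] psc[OF that, of y] by simp
  have bdd: "bdd_below ((\<lambda>t. ?h t x) ` {0..})" for x
    using lower by (intro bdd_belowI[of _ "- p (- x)"]) auto
  have "sublinear ?q"
  proof (rule sublinear_INF[OF _ bdd])
    fix s t :: real and x1 x2 :: 'a assume st: "s \<in> {0..}" "t \<in> {0..}"
    \<comment> \<open>Subadditivity, applied to \<open>x1 + s y\<close> and \<open>x2 + t y\<close>.\<close>
    have "?h (s + t) (x1 + x2) \<le> ?h s x1 + ?h t x2"
      using padd[of "x1 + s *\<^sub>R y" "x2 + t *\<^sub>R y"] by (simp add: algebra_simps)
    then show "\<exists>l\<in>{0..}. ?h l (x1 + x2) \<le> ?h s x1 + ?h t x2" using st by (intro bexI[of _ "s + t"]) auto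
  next
    fix t c :: real and x :: 'a assume t: "t \<in> {0..}" and c: "c > 0"
    have "?h (c * t) (c *\<^sub>R x) = c * ?h t x"
      using psc[of c "x + t *\<^sub>R y"] c by (simp add: algebra_simps)
    then show "\<exists>l\<in>{0..}. ?h l (c *\<^sub>R x) \<le> c * ?h t x" using t c by (intro bexI[of _ "c * t"]) auto
  qed (use psc in auto)
  moreover have "?q x \<le> ?h t x" if "t \<ge> 0" for t x
    using that by (intro cINF_lower bdd) auto
  from this[of 0] this[of 1] have "?q x \<le> p x" "?q x \<le> p (x + y) - p y" for x by auto
  ultimately show ?thesis using that[of ?q] by blast
qed

text \<open>
  A sublinear functional that is minimal among those below \<open>p\<close> is linear, and Zorn's lemma provides
  a minimal one.
\<close>

theorem linear_below_sublinear:
  fixes p :: "'a::real_vector \<Rightarrow> real"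
  assumes p: "sublinear p"
  obtains f where "linear f" "\<And>x. f x \<le> p x"
proof -
  define A where "A = {q. sublinear q \<and> q \<le> p}"
  let ?R = "relation_of (\<lambda>a b :: 'a \<Rightarrow> real. b \<le> a) A"
  have "\<exists>m\<in>A. \<forall>a\<in>A. a \<le> m \<longrightarrow> a = m"
  proof (rule predicate_Zorn)
    show "partial_order_on A ?R"
      by (rule partial_order_on_relation_ofI) auto
    fix C assume C: "C \<in> Chains ?R"
    have CA: "C \<subseteq> A" using C by (auto simp: Chains_def relation_of_def)
    have tot: "q \<le> r \<or> r \<le> q" if "q \<in> C" "r \<in> C" for q r
      using C that by (auto simp: Chains_def relation_of_def)
    show "\<exists>u\<in>A. \<forall>a\<in>C. u \<le> a"
    proof (cases "C = {}")
      case True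
      then show ?thesis using p by (auto simp: A_def)
    next
      case False
      let ?u = "\<lambda>x. INF q\<in>C. q x"
      have sub: "sublinear q" "q \<le> p" if "q \<in> C" for q using that CA by (auto simp: A_def)
      have bdd: "bdd_below ((\<lambda>q. q x) ` C)" for x
      proof (rule bdd_belowI2)
        fix q assume "q \<in> C"
        then show "- p (- x) \<le> q x"
          using sublinear_minus_le[OF sub(1), of q x] le_funD[OF sub(2), of q "- x"] by linarith
      qed
      have lower: "?u x \<le> q x" if "q \<in> C" for q x using bdd that by (rule cINF_lower)
      have "sublinear ?u"
      proof (rule sublinear_INF[OF False bdd])
        fix q r x y assume qr: "q \<in> C" "r \<in> C"
        \<comment> \<open>In a chain the smaller of two functionals works for both.\<close>
        define l where "l = (if q \<le> r then q else r)"
        have l: "l \<in> C" "l \<le> q" "l \<le> r" using qr tot[OF qr] by (auto simp: l_def)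
        have "l (x + y) \<le> l x + l y" using sub(1)[OF l(1)] by (simp add: sublinear_def)
        also have "\<dots> \<le> q x + r y" using l by (intro add_mono) (auto simp: le_fun_def)
        finally show "\<exists>l\<in>C. l (x + y) \<le> q x + r y" using l by blast
      next
        fix q and c :: real and x assume "q \<in> C" "c > 0"
        then show "\<exists>l\<in>C. l (c *\<^sub>R x) \<le> c * q x"
          using sub(1)[of q] by (intro bexI[of _ q]) (auto simp: sublinear_def)
      qed (use sub sublinear_zero in auto)
      moreover have "?u \<le> p"
      proof (rule le_funI)
        fix x
        obtain q where q: "q \<in> C" using False by blast
        show "?u x \<le> p x" using lower[OF q] le_funD[OF sub(2)[OF q]] by (rule order_trans)
      qed
      ultimately have "?u \<in> A" by (simp add: A_def)
      moreover have "\<forall>a\<in>C. ?u \<le> a" using lower by (auto simp: le_fun_def)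
      ultimately show ?thesis by blast
    qed
  qed
  then obtain m where m: "sublinear m" "m \<le> p" and min: "\<And>a. sublinear a \<Longrightarrow> a \<le> m \<Longrightarrow> a = m"
    unfolding A_def using order_trans by blast
  have add: "m (x + y) = m x + m y" for x y
  proof -
    obtain q where q: "sublinear q" "\<And>x. q x \<le> m x" "\<And>x. q x \<le> m (x + y) - m y"
      using sublinear_shift[OF m(1)] by blast
    then have "q = m" by (intro min) (auto simp: le_fun_def)
    then have "m x \<le> m (x + y) - m y" using q(3) by blast
    moreover have "m (x + y) \<le> m x + m y" using m(1) by (simp add: sublinear_def)
    ultimately show ?thesis by simp
  qed
  have minus: "m (- x) = - m x" for x
    using add[of x "- x"] sublinear_zero[OF m(1)] by simp
  have scale: "m (c *\<^sub>R x) = c * m x" if "c \<ge> 0" for c x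
    using m(1) that unfolding sublinear_def by blast
  have "m (c *\<^sub>R x) = c * m x" for c x
  proof (cases "c \<ge> 0")
    case True
    then show ?thesis by (rule scale)
  next
    case False
    have "m ((- c) *\<^sub>R x) = (- c) * m x" by (rule scale) (use False in simp)
    then show ?thesis using minus[of "c *\<^sub>R x"] by simp
  qed
  then have "linear m" using add by (simp add: linear_iff)
  then show ?thesis using that m(2) by (auto simp: le_fun_def)
qed

text \<open>
  The norm, shifted along \<open>x0\<close>, takes the value \<open>- \<parallel>x0\<parallel>\<close> or less at \<open>- x0\<close>; this prevents a linear
  functional below it from vanishing at \<open>x0\<close>.
\<close>

corollary functional_of_norm_one:
  fixes x0 :: "'a::real_normed_vector"
  assumes "x0 \<noteq> 0"
  obtains \<phi> :: "'a \<Rightarrow>\<^sub>L real" where "norm \<phi> = 1"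
proof -
  have "sublinear (norm :: 'a \<Rightarrow> real)" by (simp add: sublinear_def norm_triangle_ineq)
  then obtain p where p: "sublinear p" "\<And>x :: 'a. p x \<le> norm x" "\<And>x. p x \<le> norm (x + x0) - norm x0"
    using sublinear_shift[of norm x0] by blast
  obtain f where f: "linear f" "\<And>x. f x \<le> p x" using linear_below_sublinear[OF p(1)] by blast
  have "\<bar>f x\<bar> \<le> norm x" for x
    using f(2)[of x] f(2)[of "- x"] p(2)[of x] p(2)[of "- x"] linear_neg[OF f(1), of x] by simp
  then have bl: "bounded_linear f"
    by (intro bounded_linear.intro[OF f(1)]) (auto intro!: bounded_linear_axioms.intro exI[of _ 1])
  have "f (- x0) \<le> - norm x0" using f(2)[of "- x0"] p(3)[of "- x0"] by simp
  then have "f x0 \<noteq> 0" using assms linear_neg[OF f(1), of x0] by auto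
  then have ne: "Blinfun f \<noteq> 0"
    using bounded_linear_Blinfun_apply[OF bl] by (metis zero_blinfun.rep_eq)
  show ?thesis
    by (rule that[of "(1 / norm (Blinfun f)) *\<^sub>R Blinfun f"]) (use ne in simp)
qed

section \<open>Regular signed Borel measures\<close>

lemma regular_borel_imp_bounded:
  "regular_borel_measure_bv T \<mu> \<Longrightarrow> bounded_signed (borel_sigma T) \<mu>"
  by (simp add: regular_borel_measure_bv_def bounded_signed_def space_borel_sigma)

lemma regular_total_var:
  assumes \<mu>: "regular_borel_measure_bv T \<mu>"
  shows "regular_set_function T (total_var (borel_sigma T) \<mu>)"
  unfolding regular_set_function_def
proof (intro ballI allI impI)
  fix A and \<epsilon> :: real assume "A \<in> borel_sets T" "\<epsilon> > 0"
  then obtain K U where KU: "closedin T K" "openin T U" "K \<subseteq> A" "A \<subseteq> U"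
    "variation (borel_sigma T) \<mu> (U - K) < ennreal \<epsilon>"
    using \<mu> unfolding regular_borel_measure_bv_def by blast
  have "U - K \<in> borel_sets T"
    using KU by (intro sets.Diff openin_borel_sigma closedin_borel_sigma)
  then have "ennreal (total_var (borel_sigma T) \<mu> (U - K)) < ennreal \<epsilon>"
    using KU(5) ennreal_total_var[OF regular_borel_imp_bounded[OF \<mu>]] by simp
  then have "total_var (borel_sigma T) \<mu> (U - K) < \<epsilon>" by (simp add: ennreal_less_iff)
  then show "\<exists>K U. closedin T K \<and> openin T U \<and> K \<subseteq> A \<and> A \<subseteq> U \<and>
      total_var (borel_sigma T) \<mu> (U - K) < \<epsilon>" using KU(1-4) by blast
qed

lemma total_var_mono:
  assumes \<mu>: "bounded_signed M \<mu>" and "A \<subseteq> B" "A \<in> sets M" "B \<in> sets M"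
  shows "total_var M \<mu> A \<le> total_var M \<mu> B"
  using variation_mono[of \<mu> A B M] bounded_signed_empty[OF \<mu>] variation_finite[OF \<mu>] assms
  by (intro enn2real_mono) auto

lemma total_var_linear_le:
  assumes "bounded_signed M \<mu>" "bounded_signed M \<nu>" "A \<in> sets M"
  shows "total_var M (\<lambda>A. a * \<mu> A + b * \<nu> A) A
    \<le> \<bar>a\<bar> * total_var M \<mu> A + \<bar>b\<bar> * total_var M \<nu> A"
  using variation_linear_le[OF assms] by (intro enn2real_leI) auto

lemma total_var_diff_le:
  assumes N1: "finite_measure N1" "sets N1 = sets M" and N2: "finite_measure N2" "sets N2 = sets M"
    and \<mu>: "\<And>A. A \<in> sets M \<Longrightarrow> \<mu> A = measure N1 A - measure N2 A" and A: "A \<in> sets M"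
  shows "total_var M \<mu> A \<le> measure N1 A + measure N2 A"
  using variation_diff_le[OF N1 N2 \<mu> A] by (intro enn2real_leI) auto

text \<open>
  Two majorants are allowed, one for each of the measures from which a linear combination or a
  difference is formed.
\<close>

lemma regular_borelI:
  assumes T: "compact_space T" and bm: "bounded_signed (borel_sigma T) \<mu>"
    and f: "regular_set_function T f" and g: "regular_set_function T g"
    and mono: "\<And>h A B. h = f \<or> h = g \<Longrightarrow> A \<subseteq> B \<Longrightarrow> A \<in> borel_sets T \<Longrightarrow> B \<in> borel_sets T \<Longrightarrow> h A \<le> h B"
    and le: "\<And>A. A \<in> borel_sets T \<Longrightarrow> total_var (borel_sigma T) \<mu> A \<le> \<bar>a\<bar> * f A + \<bar>b\<bar> * g A"
  shows "regular_borel_measure_bv T \<mu>"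
  unfolding regular_borel_measure_bv_def
proof (intro conjI ballI allI impI)
  show "signed_measure (borel_sigma T) \<mu>" "variation (borel_sigma T) \<mu> (topspace T) < \<infinity>"
    using bm by (simp_all add: bounded_signed_def space_borel_sigma)
  fix A and \<epsilon> :: real assume A: "A \<in> borel_sets T" and \<epsilon>: "\<epsilon> > 0"
  define \<delta> where "\<delta> = \<epsilon> / (\<bar>a\<bar> + \<bar>b\<bar> + 1)"
  have \<delta>: "\<delta> > 0" using \<epsilon> by (simp add: \<delta>_def add_nonneg_pos)
  obtain K1 U1 where 1: "closedin T K1" "openin T U1" "K1 \<subseteq> A" "A \<subseteq> U1" "f (U1 - K1) < \<delta>"
    using regular_set_functionE[OF f A \<delta>] .
  obtain K2 U2 where 2: "closedin T K2" "openin T U2" "K2 \<subseteq> A" "A \<subseteq> U2" "g (U2 - K2) < \<delta>"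
    using regular_set_functionE[OF g A \<delta>] .
  let ?K = "K1 \<union> K2" and ?U = "U1 \<inter> U2"
  have meas: "?U - ?K \<in> borel_sets T" "U1 - K1 \<in> borel_sets T" "U2 - K2 \<in> borel_sets T"
    using closedin_borel_sigma[OF 1(1)] openin_borel_sigma[OF 1(2)]
      closedin_borel_sigma[OF 2(1)] openin_borel_sigma[OF 2(2)] by auto
  have "f (?U - ?K) \<le> f (U1 - K1)" "g (?U - ?K) \<le> g (U2 - K2)"
    using meas by (intro mono; auto)+
  then have "\<bar>a\<bar> * f (?U - ?K) + \<bar>b\<bar> * g (?U - ?K) \<le> \<bar>a\<bar> * \<delta> + \<bar>b\<bar> * \<delta>"
    using 1(5) 2(5) by (intro add_mono mult_left_mono) auto
  also have "\<dots> < (\<bar>a\<bar> + \<bar>b\<bar> + 1) * \<delta>" using \<delta> by (simp add: algebra_simps)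
  also have "\<dots> = \<epsilon>" unfolding \<delta>_def by (simp add: add_nonneg_pos less_imp_neq[symmetric])
  finally have "ennreal (total_var (borel_sigma T) \<mu> (?U - ?K)) < ennreal \<epsilon>"
    using le[OF meas(1)] \<epsilon> by (intro ennreal_lessI) auto
  then have "variation (borel_sigma T) \<mu> (?U - ?K) < ennreal \<epsilon>"
    using ennreal_total_var[OF bm meas(1)] by simp
  moreover have "closedin T ?K" using 1 2 by auto
  moreover from this have "compactin T ?K" using T closedin_compact_space by blast
  ultimately show "\<exists>K U. compactin T K \<and> closedin T K \<and> openin T U \<and> K \<subseteq> A \<and> A \<subseteq> U \<and>
      variation (borel_sigma T) \<mu> (U - K) < ennreal \<epsilon>"
    using 1 2 by (intro exI[of _ ?K] exI[of _ ?U]) auto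
qed

lemma regular_borel_linear:
  assumes T: "compact_space T" and \<mu>: "regular_borel_measure_bv T \<mu>" and \<nu>: "regular_borel_measure_bv T \<nu>"
  shows "regular_borel_measure_bv T (\<lambda>A. a * \<mu> A + b * \<nu> A)"
proof -
  note bm = regular_borel_imp_bounded[OF \<mu>] regular_borel_imp_bounded[OF \<nu>]
  show ?thesis
    by (rule regular_borelI[OF T bounded_signed_linear[OF bm]
        regular_total_var[OF \<mu>] regular_total_var[OF \<nu>] _ total_var_linear_le[OF bm]])
      (auto intro: total_var_mono bm)
qed

lemma regular_borel_restrict:
  assumes T: "compact_space T" and \<mu>: "regular_borel_measure_bv T \<mu>" and A: "A \<in> borel_sets T"
  shows "regular_borel_measure_bv T (\<lambda>B. \<mu> (A \<inter> B))"
proof (rule regular_borelI[OF T _ regular_total_var[OF \<mu>] regular_total_var[OF \<mu>], of _ 1 0])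
  let ?M = "borel_sigma T"
  note bm = regular_borel_imp_bounded[OF \<mu>]
  show "bounded_signed ?M (\<lambda>B. \<mu> (A \<inter> B))" by (rule bounded_signed_restrict[OF bm A])
  show "h B \<le> h C" if "h = total_var ?M \<mu> \<or> h = total_var ?M \<mu>" "B \<subseteq> C" "B \<in> sets ?M" "C \<in> sets ?M" for h B C
    using that total_var_mono[OF bm] by auto
  fix B assume B: "B \<in> sets ?M"
  have "variation ?M (\<lambda>B. \<mu> (A \<inter> B)) B \<le> variation ?M \<mu> (A \<inter> B)"
    by (rule variation_restrict_le[OF bm A B])
  also have "\<dots> \<le> variation ?M \<mu> B"
    using A B bounded_signed_empty[OF bm] by (intro variation_mono) auto
  finally show "total_var ?M (\<lambda>B. \<mu> (A \<inter> B)) B \<le> \<bar>1\<bar> * total_var ?M \<mu> B + \<bar>0\<bar> * total_var ?M \<mu> B"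
    using variation_finite[OF bm B] by (simp add: enn2real_mono)
qed

lemma regular_borel_diff_measures:
  assumes T: "compact_space T" and N1: "regular_measure T N1" and N2: "regular_measure T N2"
    and \<mu>: "\<And>A. A \<in> borel_sets T \<Longrightarrow> \<mu> A = measure N1 A - measure N2 A"
  shows "regular_borel_measure_bv T \<mu>"
proof (rule regular_borelI[OF T, of _ "measure N1" "measure N2" 1 1])
  have N1': "finite_measure N1" "sets N1 = borel_sets T" and N2': "finite_measure N2" "sets N2 = borel_sets T"
    and "regular_set_function T (measure N1)" "regular_set_function T (measure N2)"
    using N1 N2 by (auto simp: regular_measure_def)
  then show "regular_set_function T (measure N1)" "regular_set_function T (measure N2)" by auto
  show "bounded_signed (borel_sigma T) \<mu>" by (rule bounded_signed_diff[OF N1' N2' \<mu>])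
  show "h A \<le> h B" if "h = measure N1 \<or> h = measure N2" "A \<subseteq> B" "B \<in> borel_sets T" for h A B
    using that N1' N2' by (auto intro: finite_measure.finite_measure_mono)
  show "total_var (borel_sigma T) \<mu> A \<le> \<bar>1\<bar> * measure N1 A + \<bar>1\<bar> * measure N2 A" if "A \<in> borel_sets T" for A
    using total_var_diff_le[OF N1' N2' \<mu> that] by simp
qed

section \<open>Integral polynomials and their representing measures\<close>

abbreviation ball_borel :: "('a::real_normed_vector \<Rightarrow>\<^sub>L real) measure" where
  "ball_borel \<equiv> borel_sigma weak_star_dual_ball"

lemma space_ball_borel: "space ball_borel = cball 0 1"
  by (simp add: space_borel_sigma topspace_dual_ball)

lemma cball_ball_borel: "cball 0 1 \<in> sets ball_borel"
  using sets.top[of ball_borel] by (simp add: space_ball_borel)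

abbreviation mass :: "(('a::real_normed_vector \<Rightarrow>\<^sub>L real) set \<Rightarrow> real) \<Rightarrow> real" where
  "mass \<mu> \<equiv> total_var ball_borel \<mu> (cball 0 1)"

lemma bdd_measurable_eval: "bdd_measurable ball_borel (\<lambda>\<phi>. blinfun_apply \<phi> x)"
  using dual_ball_apply_le
  by (intro bdd_measurableI[of _ _ "norm x"] continuous_map_borel_sigma continuous_map_weak_star_evaluation)
     (simp add: space_ball_borel)

lemma bdd_measurable_prod:
  "finite I \<Longrightarrow> (\<And>i. i \<in> I \<Longrightarrow> bdd_measurable M (f i)) \<Longrightarrow> bdd_measurable M (\<lambda>x. \<Prod>i\<in>I. f i x)"
  by (induction I rule: finite_induct) (auto intro: bdd_measurable_const bdd_measurable_mult)

lemma bdd_measurable_power: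
  "bdd_measurable M f \<Longrightarrow> bdd_measurable M (\<lambda>x. f x ^ n)"
  by (induction n) (auto intro: bdd_measurable_const bdd_measurable_mult)

lemma bdd_measurable_eval_power:
  "bdd_measurable ball_borel (\<lambda>\<phi>. blinfun_apply \<phi> x ^ k)"
  by (intro bdd_measurable_power bdd_measurable_eval)

lemma bdd_measurable_eval_prod:
  "finite I \<Longrightarrow> bdd_measurable ball_borel (\<lambda>\<phi>. \<Prod>i\<in>I. blinfun_apply \<phi> (x i))"
  by (intro bdd_measurable_prod bdd_measurable_eval)

lemma abs_prod_diff_le:
  fixes a b :: "nat \<Rightarrow> real"
  assumes R: "R \<ge> 1" and "\<And>i. i < k \<Longrightarrow> \<bar>a i\<bar> \<le> R" "\<And>i. i < k \<Longrightarrow> \<bar>b i\<bar> \<le> R"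
  shows "\<bar>(\<Prod>i<k. a i) - (\<Prod>i<k. b i)\<bar> \<le> R ^ k * (\<Sum>i<k. \<bar>a i - b i\<bar>)"
proof -
  have R0: "R > 0" using R by simp
  have "norm ((\<Prod>i<k. a i / R) - (\<Prod>i<k. b i / R)) \<le> (\<Sum>i<k. norm (a i / R - b i / R))"
    using assms R0 by (intro norm_prod_diff) (auto simp: field_simps)
  also have "\<dots> \<le> (\<Sum>i<k. \<bar>a i - b i\<bar>)"
  proof (rule sum_mono)
    fix i
    have "\<bar>a i - b i\<bar> / R \<le> \<bar>a i - b i\<bar> / 1" using R by (intro divide_left_mono) auto
    then show "norm (a i / R - b i / R) \<le> \<bar>a i - b i\<bar>"
      using R0 by (simp flip: diff_divide_distrib)
  qed
  also have "norm ((\<Prod>i<k. a i / R) - (\<Prod>i<k. b i / R)) = \<bar>(\<Prod>i<k. a i) - (\<Prod>i<k. b i)\<bar> / R ^ k"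
    using R0 by (simp add: prod_dividef abs_divide flip: diff_divide_distrib)
  finally show ?thesis using R0 by (simp add: field_simps)
qed

text \<open>
  The symmetric multilinear form is \<open>(x\<^sub>0, \<dots>, x\<^bsub>k-1\<^esub>) \<mapsto> \<integral> \<phi>(x\<^sub>0) \<cdots> \<phi>(x\<^bsub>k-1\<^esub>) d\<mu>(\<phi>)\<close>. Its continuity
  follows from the fact that the products vary uniformly little over the dual ball.
\<close>

lemma homogeneous_polynomial_moment:
  assumes \<mu>: "bounded_signed ball_borel \<mu>"
  shows "homogeneous_polynomial k (\<lambda>x :: 'a::real_normed_vector.
    signed_integral ball_borel \<mu> (\<lambda>\<phi>. blinfun_apply \<phi> x ^ k))"
proof -
  let ?I = "signed_integral ball_borel \<mu>"
  let ?f = "\<lambda>(x :: nat \<Rightarrow> 'a) (\<phi> :: 'a \<Rightarrow>\<^sub>L real). \<Prod>i<k. blinfun_apply \<phi> (x i)"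
  let ?A = "\<lambda>x :: nat \<Rightarrow> 'a. ?I (?f x)"
  have bf: "bdd_measurable ball_borel (?f x)" for x
    by (intro bdd_measurable_eval_prod) simp
  have dep: "?A x = ?A y" if "\<forall>i<k. x i = y i" for x y :: "nat \<Rightarrow> 'a"
  proof -
    have "?f x = ?f y" using that by (intro ext prod.cong) auto
    then show ?thesis by simp
  qed
  have lin: "linear (\<lambda>v. ?A (x(i := v)))" if i: "i < k" for x :: "nat \<Rightarrow> 'a" and i
  proof -
    let ?g = "\<lambda>\<phi> :: 'a \<Rightarrow>\<^sub>L real. \<Prod>j\<in>{..<k} - {i}. blinfun_apply \<phi> (x j)"
    have f: "?f (x(i := v)) = (\<lambda>\<phi>. blinfun_apply \<phi> v * ?g \<phi>)" for v
      using i by (auto simp: fun_eq_iff prod.remove[of "{..<k}" i] intro!: prod.cong)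
    have b: "bdd_measurable ball_borel (\<lambda>\<phi>. blinfun_apply \<phi> v * ?g \<phi>)" for v
      using bf[of "x(i := v)"] unfolding f .
    show ?thesis
      unfolding linear_iff f
    proof (intro conjI allI)
      fix v w
      have "?I (\<lambda>\<phi>. 1 * (blinfun_apply \<phi> v * ?g \<phi>) + 1 * (blinfun_apply \<phi> w * ?g \<phi>)) =
        1 * ?I (\<lambda>\<phi>. blinfun_apply \<phi> v * ?g \<phi>) + 1 * ?I (\<lambda>\<phi>. blinfun_apply \<phi> w * ?g \<phi>)"
        by (rule signed_integral_linear[OF \<mu> b b])
      then show "?I (\<lambda>\<phi>. blinfun_apply \<phi> (v + w) * ?g \<phi>) =
        ?I (\<lambda>\<phi>. blinfun_apply \<phi> v * ?g \<phi>) + ?I (\<lambda>\<phi>. blinfun_apply \<phi> w * ?g \<phi>)"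
        by (simp add: blinfun.add_right distrib_right)
    next
      fix c v
      have "?I (\<lambda>\<phi>. c * (blinfun_apply \<phi> v * ?g \<phi>) + 0 * (blinfun_apply \<phi> v * ?g \<phi>)) =
        c * ?I (\<lambda>\<phi>. blinfun_apply \<phi> v * ?g \<phi>) + 0 * ?I (\<lambda>\<phi>. blinfun_apply \<phi> v * ?g \<phi>)"
        by (rule signed_integral_linear[OF \<mu> b b])
      then show "?I (\<lambda>\<phi>. blinfun_apply \<phi> (c *\<^sub>R v) * ?g \<phi>) = c *\<^sub>R ?I (\<lambda>\<phi>. blinfun_apply \<phi> v * ?g \<phi>)"
        by (simp add: blinfun.scaleR_right mult.assoc)
    qed
  qed
  have sym: "?A (x \<circ> \<pi>) = ?A x" if "\<pi> permutes {..<k}" for x :: "nat \<Rightarrow> 'a" and \<pi>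
  proof -
    have "?f (x \<circ> \<pi>) \<phi> = ?f x \<phi>" for \<phi>
      using prod.permute[OF that, of "\<lambda>i. blinfun_apply \<phi> (x i)"] by (simp add: comp_def)
    then show ?thesis by presburger
  qed
  have cont: "continuous_on UNIV ?A"
    unfolding continuous_on_def
  proof
    fix x :: "nat \<Rightarrow> 'a"
    define R where "R = 1 + (\<Sum>i<k. norm (x i))"
    define C where "C = R ^ k * mass \<mu>"
    let ?h = "\<lambda>y. \<Sum>i<k. norm (y i - x i)"
    have xR: "norm (x i) \<le> R - 1" if "i < k" for i
      unfolding R_def using member_le_sum[of i "{..<k}" "\<lambda>i. norm (x i)"] that by simp
    have R: "R \<ge> 1" unfolding R_def by (simp add: sum_nonneg)
    have h0: "(?h \<longlongrightarrow> 0) (at x)"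
    proof -
      have "((\<lambda>y. y i) \<longlongrightarrow> x i) (at x)" for i
        using continuous_on_product_coordinates[of i] unfolding continuous_on_def by blast
      then have "(?h \<longlongrightarrow> (\<Sum>i<k. norm (x i - x i))) (at x)" by (intro tendsto_intros)
      then show ?thesis by simp
    qed
    have bound: "\<bar>?A y - ?A x\<bar> \<le> C * ?h y" if y: "?h y < 1" for y
    proof -
      have yR: "norm (y i) \<le> R" if "i < k" for i
      proof -
        have "norm (y i - x i) \<le> ?h y" using member_le_sum[of i "{..<k}" "\<lambda>i. norm (y i - x i)"] that by simp
        then show ?thesis using norm_triangle_ineq[of "y i - x i" "x i"] xR[OF that] y by simp
      qed
      have "\<bar>1 * ?f y \<phi> + (-1) * ?f x \<phi>\<bar> \<le> R ^ k * ?h y" if "\<phi> \<in> space ball_borel" for \<phi>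
      proof -
        have \<phi>: "\<phi> \<in> cball 0 1" using that by (simp add: space_ball_borel)
        have "\<bar>?f y \<phi> - ?f x \<phi>\<bar> \<le> R ^ k * (\<Sum>i<k. \<bar>blinfun_apply \<phi> (y i) - blinfun_apply \<phi> (x i)\<bar>)"
        proof (rule abs_prod_diff_le[OF R])
          show "\<bar>blinfun_apply \<phi> (y i)\<bar> \<le> R" if "i < k" for i
            using dual_ball_apply_le[OF \<phi>, of "y i"] yR[OF that] by simp
          show "\<bar>blinfun_apply \<phi> (x i)\<bar> \<le> R" if "i < k" for i
            using dual_ball_apply_le[OF \<phi>, of "x i"] xR[OF that] by simp
        qed
        also have "\<dots> \<le> R ^ k * ?h y"
          using R dual_ball_apply_le[OF \<phi>] by (intro mult_left_mono sum_mono) (simp_all flip: blinfun.diff_right)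
        finally show ?thesis by simp
      qed
      then have "\<bar>?I (\<lambda>\<phi>. 1 * ?f y \<phi> + (-1) * ?f x \<phi>)\<bar>
          \<le> (R ^ k * ?h y) * total_var ball_borel \<mu> (space ball_borel)"
        by (intro abs_signed_integral_le \<mu> bdd_measurable_add
          bdd_measurable_mult[OF bdd_measurable_const] bf)
      then show ?thesis
        unfolding signed_integral_linear[OF \<mu> bf bf] C_def by (simp add: space_ball_borel mult_ac)
    qed
    have "\<forall>\<^sub>F y in at x. ?h y < 1" using h0 by (rule order_tendstoD) simp
    then have "\<forall>\<^sub>F y in at x. norm (?A y - ?A x) \<le> C * ?h y"
      by eventually_elim (use bound in simp)
    moreover have "((\<lambda>y. C * ?h y) \<longlongrightarrow> 0) (at x)" using tendsto_mult_left[OF h0, of C] by simp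
    ultimately have "((\<lambda>y. ?A y - ?A x) \<longlongrightarrow> 0) (at x)" by (rule Lim_null_comparison)
    then show "(?A \<longlongrightarrow> ?A x) (at x)" by (rule LIM_zero_cancel)
  qed
  have "continuous_symmetric_multilinear_form k ?A"
    unfolding continuous_symmetric_multilinear_form_def using dep lin sym cont by blast
  then show ?thesis unfolding homogeneous_polynomial_def by (intro exI[of _ ?A]) simp
qed

lemma represents_integral_polynomial:
  assumes "represents k \<mu> P"
  shows "P \<in> integral_polynomials k"
proof -
  have "P = (\<lambda>x. signed_integral ball_borel \<mu> (\<lambda>\<phi>. blinfun_apply \<phi> x ^ k))"
    using assms unfolding represents_def by auto
  then have "homogeneous_polynomial k P"
    using homogeneous_polynomial_moment regular_borel_imp_bounded assms unfolding represents_def by metis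
  then show ?thesis using assms unfolding integral_polynomials_def by auto
qed

lemma integral_norm_le:
  assumes "represents k \<mu> P"
  shows "integral_norm k P \<le> mass \<mu>"
  unfolding integral_norm_def
  by (rule cInf_lower) (use assms in \<open>auto intro!: bdd_belowI[of _ 0]\<close>)

abbreviation integral_unit_ball :: "nat \<Rightarrow> ('a::real_normed_vector \<Rightarrow> real) set" where
  "integral_unit_ball k \<equiv> unit_ball (integral_polynomials k) (integral_norm k)"

lemma represents_unit_ball:
  assumes "represents k \<mu> P" "mass \<mu> \<le> 1"
  shows "P \<in> integral_unit_ball k"
  using represents_integral_polynomial[OF assms(1)] integral_norm_le[OF assms(1)] assms(2)
  unfolding unit_ball_def by simp

lemma represents_linear:
  assumes \<mu>: "represents k \<mu> P" and \<nu>: "represents k \<nu> Q"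
  shows "represents k (\<lambda>A. a * \<mu> A + b * \<nu> A) (\<lambda>x. a * P x + b * Q x)"
proof -
  have r: "regular_borel_measure_bv weak_star_dual_ball \<mu>" "regular_borel_measure_bv weak_star_dual_ball \<nu>"
    using assms by (auto simp: represents_def)
  show ?thesis
    unfolding represents_def
    using regular_borel_linear[OF compact_dual_ball r] assms
    by (simp add: represents_def bdd_measurable_eval_power
      signed_integral_linear_measure[OF regular_borel_imp_bounded[OF r(1)] regular_borel_imp_bounded[OF r(2)]])
qed

text \<open>
  The representing measure is the point mass at \<open>\<phi>\<close>.
\<close>

lemma represents_evaluation_power:
  fixes \<phi> :: "'a::real_normed_vector \<Rightarrow>\<^sub>L real"
  assumes \<phi>: "\<phi> \<in> cball 0 1"
  obtains \<mu> where "represents k \<mu> (\<lambda>x. blinfun_apply \<phi> x ^ k)"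
    "mass \<mu> \<le> 1"
proof -
  let ?K = "weak_star_dual_ball :: ('a \<Rightarrow>\<^sub>L real) topology"
  let ?N = "distr (count_space {()}) ball_borel (\<lambda>_. \<phi>)" and ?Z = "null_measure ball_borel :: ('a \<Rightarrow>\<^sub>L real) measure"
  have fm: "finite_measure (count_space {()})" by (rule finite_measure_count_space) simp
  have meas: "(\<lambda>_. \<phi>) \<in> measurable (count_space {()}) ball_borel"
    using \<phi> by (simp add: space_ball_borel)
  have N: "finite_measure ?N" "sets ?N = sets ball_borel"
    using finite_measure.finite_measure_distr[OF fm meas] by auto
  have Z: "finite_measure ?Z" "sets ?Z = sets ball_borel" by (auto intro: finite_measureI)
  have mN: "measure ?N A = indicator A \<phi>" if "A \<in> sets ball_borel" for A
    using that by (simp add: measure_distr[OF meas] indicator_def)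
  have rN: "regular_measure ?K ?N"
    unfolding regular_measure_def regular_set_function_def
  proof (intro conjI N ballI allI impI)
    fix A :: "('a \<Rightarrow>\<^sub>L real) set" and \<epsilon> :: real assume A: "A \<in> sets ball_borel" and \<epsilon>: "\<epsilon> > 0"
    then have AT: "A \<subseteq> topspace ?K" using sets.sets_into_space by (metis space_borel_sigma)
    have c: "closedin ?K {\<phi>}"
      unfolding closedin_Hausdorff_sing_eq[OF Hausdorff_dual_ball]
      using \<phi> by (simp add: topspace_dual_ball)
    show "\<exists>K U. closedin ?K K \<and> openin ?K U \<and> K \<subseteq> A \<and> A \<subseteq> U \<and> measure ?N (U - K) < \<epsilon>"
    proof (cases "\<phi> \<in> A")
      case True
      let ?U = "topspace ?K"
      have "measure ?N (?U - {\<phi>}) = 0"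
        using c by (subst mN) (auto intro: closedin_borel_sigma openin_borel_sigma)
      then show ?thesis using True \<epsilon> c AT by (intro exI[of _ "{\<phi>}"] exI[of _ ?U]) auto
    next
      case False
      let ?U = "topspace ?K - {\<phi>}"
      have "measure ?N (?U - {}) = 0"
        using c by (subst mN) (auto intro: closedin_borel_sigma openin_borel_sigma)
      then show ?thesis using False \<epsilon> c AT by (intro exI[of _ "{}"] exI[of _ ?U]) auto
    qed
  qed
  have rZ: "regular_measure ?K ?Z"
    unfolding regular_measure_def regular_set_function_def
  proof (intro conjI Z ballI allI impI)
    fix A :: "('a \<Rightarrow>\<^sub>L real) set" and \<epsilon> :: real assume "A \<in> sets ball_borel" and \<epsilon>: "\<epsilon> > 0"
    then have "A \<subseteq> topspace ?K" using sets.sets_into_space by (metis space_borel_sigma)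
    then show "\<exists>K U. closedin ?K K \<and> openin ?K U \<and> K \<subseteq> A \<and> A \<subseteq> U \<and> measure ?Z (U - K) < \<epsilon>"
      using \<epsilon> by (intro exI[of _ "{}"] exI[of _ "topspace ?K"]) (auto simp: measure_def)
  qed
  let ?\<mu> = "\<lambda>A. measure ?N A - measure ?Z A"
  have int: "signed_integral ball_borel ?\<mu> f = f \<phi>" if f: "bdd_measurable ball_borel f" for f
  proof -
    have "integral\<^sup>L ?N f = f \<phi>"
      using f by (subst integral_distr[OF meas])
        (auto simp: bdd_measurable_def lebesgue_integral_count_space_finite)
    moreover have "integral\<^sup>L ?Z f = 0" by (simp add: integral_null_measure)
    ultimately show ?thesis using signed_integral_diff_measures[OF N Z refl f] by simp
  qed
  have "represents k ?\<mu> (\<lambda>x. blinfun_apply \<phi> x ^ k)"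
    unfolding represents_def
    using regular_borel_diff_measures[OF compact_dual_ball rN rZ refl]
      int[OF bdd_measurable_eval_power] by simp
  moreover have "mass ?\<mu> \<le> 1"
    using total_var_diff_le[OF N Z refl cball_ball_borel] mN[OF cball_ball_borel] \<phi>
    by (simp add: measure_def[of ?Z])
  ultimately show ?thesis by (rule that)
qed

text \<open>
  Jordan parts of representing measures with total variation tending to the infimum have weak
  limits \<open>p\<close> and \<open>q\<close>. Evaluations are weak-star continuous, so that \<open>p - q\<close> still represents \<open>P\<close>, and
  its variation is at most \<open>p + q\<close>, whose mass is the limit of the total variations.
\<close>

theorem integral_norm_attained:
  fixes P :: "'a::real_normed_vector \<Rightarrow> real"
  assumes P: "P \<in> integral_polynomials k"
  obtains \<mu> where "represents k \<mu> P" "mass \<mu> \<le> integral_norm k P"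
proof -
  let ?K = "weak_star_dual_ball :: ('a \<Rightarrow>\<^sub>L real) topology"
  let ?M = "ball_borel :: ('a \<Rightarrow>\<^sub>L real) measure"
  define c where "c = integral_norm k P"
  have "\<exists>\<mu>. represents k \<mu> P \<and> mass \<mu> < c + 1 / real (Suc n)" for n
  proof -
    let ?V = "{mass \<mu> |\<mu>. represents k \<mu> P}"
    have ne: "?V \<noteq> {}" using P unfolding integral_polynomials_def by auto
    have "Inf ?V < c + 1 / real (Suc n)" unfolding c_def integral_norm_def by simp
    from cInf_lessD[OF ne this] obtain v where "v \<in> ?V" "v < c + 1 / real (Suc n)" by (elim bexE)
    then show ?thesis by blast
  qed
  then obtain \<mu> where \<mu>: "\<And>n. represents k (\<mu> n) P"
    "\<And>n. mass (\<mu> n) < c + 1 / real (Suc n)" by metis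
  have bm: "bounded_signed ?M (\<mu> n)" for n
    using \<mu>(1) regular_borel_imp_bounded unfolding represents_def by blast
  let ?p = "\<lambda>n. pos_variation ?M (\<mu> n)" and ?q = "\<lambda>n. neg_variation ?M (\<mu> n)"
  have tv: "measure (?p n) (cball 0 1) + measure (?q n) (cball 0 1) = mass (\<mu> n)" for n
    unfolding measure_pos_variation[OF bm cball_ball_borel] measure_neg_variation[OF bm cball_ball_borel]
    by (simp add: field_simps)
  have c1: "mass (\<mu> n) \<le> c + 1" for n
  proof -
    have "1 / real (Suc n) \<le> 1" by simp
    then show ?thesis using \<mu>(2)[of n] by linarith
  qed
  have bp: "measure (?p n) (topspace ?K) \<le> c + 1" and bq: "measure (?q n) (topspace ?K) \<le> c + 1" for n
    using tv[of n] c1[of n] measure_nonneg[of "?p n" "cball 0 1"] measure_nonneg[of "?q n" "cball 0 1"]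
    unfolding topspace_dual_ball by linarith+
  obtain G :: "nat filter" where G: "G \<noteq> bot" "G \<le> sequentially"
    "\<forall>s :: nat \<Rightarrow> real. Bseq s \<longrightarrow> (\<exists>l. (s \<longlongrightarrow> l) G)" using limit_filter_exists by blast
  obtain p where p: "regular_measure ?K p"
    "((\<lambda>n. measure (?p n) (topspace ?K)) \<longlongrightarrow> measure p (topspace ?K)) G"
    "\<forall>f. continuous_map ?K euclideanreal f \<longrightarrow> ((\<lambda>n. integral\<^sup>L (?p n) f) \<longlongrightarrow> integral\<^sup>L p f) G"
    by (rule weak_limit_of_measures[OF compact_dual_ball Hausdorff_dual_ball
        finite_measure_pos_variation[OF bm] sets_pos_variation[OF bm] bp G(1,3)]) (rule that)
  obtain q where q: "regular_measure ?K q"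
    "((\<lambda>n. measure (?q n) (topspace ?K)) \<longlongrightarrow> measure q (topspace ?K)) G"
    "\<forall>f. continuous_map ?K euclideanreal f \<longrightarrow> ((\<lambda>n. integral\<^sup>L (?q n) f) \<longlongrightarrow> integral\<^sup>L q f) G"
    by (rule weak_limit_of_measures[OF compact_dual_ball Hausdorff_dual_ball
        finite_measure_neg_variation[OF bm] sets_neg_variation[OF bm] bq G(1,3)]) (rule that)
  have p': "finite_measure p" "sets p = sets ?M" and q': "finite_measure q" "sets q = sets ?M"
    using p(1) q(1) by (auto simp: regular_measure_def)
  let ?\<mu> = "\<lambda>A. measure p A - measure q A"
  have "P x = signed_integral ?M ?\<mu> (\<lambda>\<phi>. blinfun_apply \<phi> x ^ k)" for x
  proof -
    let ?f = "\<lambda>\<phi> :: 'a \<Rightarrow>\<^sub>L real. blinfun_apply \<phi> x ^ k"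
    have f: "continuous_map ?K euclideanreal ?f"
      by (intro continuous_map_real_pow continuous_map_weak_star_evaluation)
    have "((\<lambda>n. integral\<^sup>L (?p n) ?f - integral\<^sup>L (?q n) ?f) \<longlongrightarrow> integral\<^sup>L p ?f - integral\<^sup>L q ?f) G"
      by (intro tendsto_diff p(3)[rule_format, OF f] q(3)[rule_format, OF f])
    moreover have "integral\<^sup>L (?p n) ?f - integral\<^sup>L (?q n) ?f = P x" for n
      using \<mu>(1)[of n] unfolding represents_def signed_integral_def by simp
    ultimately have "((\<lambda>n. P x) \<longlongrightarrow> integral\<^sup>L p ?f - integral\<^sup>L q ?f) G" by simp
    then have "P x = integral\<^sup>L p ?f - integral\<^sup>L q ?f"
      by (rule tendsto_unique[OF G(1) tendsto_const])
    also have "\<dots> = signed_integral ?M ?\<mu> ?f"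
      by (rule signed_integral_diff_measures[OF p' q' _ bdd_measurable_eval_power, symmetric]) simp
    finally show ?thesis .
  qed
  then have "represents k ?\<mu> P"
    unfolding represents_def
    using regular_borel_diff_measures[OF compact_dual_ball p(1) q(1) refl] by blast
  moreover have "measure p (cball 0 1) + measure q (cball 0 1) \<le> c"
  proof (rule tendsto_le[OF G(1)])
    show "((\<lambda>n. measure (?p n) (cball 0 1) + measure (?q n) (cball 0 1)) \<longlongrightarrow>
        measure p (cball 0 1) + measure q (cball 0 1)) G"
      using p(2) q(2) unfolding topspace_dual_ball by (rule tendsto_add)
    have "(\<lambda>n. c + 1 / real (Suc n)) \<longlonglongrightarrow> c + 0"
      by (intro tendsto_add tendsto_const lim_inverse_n'[THEN LIMSEQ_Suc])
    then show "((\<lambda>n. c + 1 / real (Suc n)) \<longlongrightarrow> c) G"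
      using tendsto_mono[OF G(2)] by simp
    show "\<forall>\<^sub>F n in G. measure (?p n) (cball 0 1) + measure (?q n) (cball 0 1) \<le> c + 1 / real (Suc n)"
      unfolding tv using \<mu>(2) by (simp add: less_imp_le)
  qed
  then have "mass ?\<mu> \<le> c"
    using total_var_diff_le[OF p' q' refl cball_ball_borel] by linarith
  ultimately show ?thesis using that unfolding c_def by blast
qed

lemma represents_bounded: "represents k \<mu> P \<Longrightarrow> bounded_signed ball_borel \<mu>"
  by (simp add: represents_def regular_borel_imp_bounded)

lemma unit_ballE:
  assumes "P \<in> integral_unit_ball k"
  obtains \<mu> where "represents k \<mu> P" "mass \<mu> \<le> 1"
proof -
  have P: "P \<in> integral_polynomials k" "integral_norm k P \<le> 1"
    using assms unfolding unit_ball_def by auto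
  obtain \<mu> where "represents k \<mu> P" "mass \<mu> \<le> integral_norm k P"
    by (rule integral_norm_attained[OF P(1)])
  then show ?thesis using that P(2) by simp
qed

lemma unit_ball_scale:
  assumes P: "P \<in> integral_unit_ball k" and c: "\<bar>c\<bar> \<le> 1"
  shows "(\<lambda>x. c * P x) \<in> integral_unit_ball k"
proof -
  obtain \<mu> where \<mu>: "represents k \<mu> P" "mass \<mu> \<le> 1"
    by (rule unit_ballE[OF P])
  note bm = represents_bounded[OF \<mu>(1)]
  have "represents k (\<lambda>A. c * \<mu> A + 0 * \<mu> A) (\<lambda>x. c * P x + 0 * P x)"
    by (rule represents_linear[OF \<mu>(1) \<mu>(1)])
  moreover have "mass (\<lambda>A. c * \<mu> A + 0 * \<mu> A) \<le> 1"
  proof -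
    have "mass (\<lambda>A. c * \<mu> A + 0 * \<mu> A)
        \<le> \<bar>c\<bar> * mass \<mu>"
      using total_var_linear_le[OF bm bm cball_ball_borel, of c 0] by simp
    also have "\<dots> \<le> 1 * 1" using c \<mu>(2) by (intro mult_mono) auto
    finally show ?thesis by simp
  qed
  ultimately have "(\<lambda>x. c * P x + 0 * P x) \<in> integral_unit_ball k"
    by (rule represents_unit_ball)
  then show ?thesis by simp
qed

lemma multiple_of_power_unit_ball:
  assumes \<phi>: "\<phi> \<in> cball 0 1" and c: "\<bar>c\<bar> \<le> 1"
  shows "(\<lambda>x. c * blinfun_apply \<phi> x ^ k) \<in> integral_unit_ball k"
proof -
  obtain \<mu> where "represents k \<mu> (\<lambda>x. blinfun_apply \<phi> x ^ k)"
    "mass \<mu> \<le> 1"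
    by (rule represents_evaluation_power[OF \<phi>])
  then show ?thesis by (intro unit_ball_scale c represents_unit_ball)
qed

section \<open>Extreme points are powers of functionals\<close>

text \<open>
  The number \<open>s\<close> is \<open>\<bar>\<mu>\<bar>(A) + \<bar>\<mu>\<bar>(B)\<close> for the complement \<open>B\<close> of \<open>A\<close>. The perturbation
  \<open>Q = \<bar>\<mu>\<bar>(B) P\<^sub>A - \<bar>\<mu>\<bar>(A) P\<^sub>B\<close> is chosen such that what \<open>P + \<zeta>Q\<close> gains in variation over \<open>A\<close> it loses
  over \<open>B\<close>.
\<close>

lemma extreme_point_proportional:
  fixes P :: "'a::real_normed_vector \<Rightarrow> real"
  assumes extr: "P \<in> real_extreme_points (integral_polynomials k) (integral_norm k)"
    and \<mu>: "represents k \<mu> P" "mass \<mu> \<le> 1"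
    and A: "A \<in> sets ball_borel"
  obtains s where "0 \<le> s" "s \<le> 1"
    "\<And>x. s * signed_integral ball_borel \<mu> (\<lambda>\<phi>. indicator A \<phi> * blinfun_apply \<phi> x ^ k) =
      total_var ball_borel \<mu> A * P x"
proof -
  let ?M = "ball_borel :: ('a \<Rightarrow>\<^sub>L real) measure"
  define B where "B = space ?M - A"
  have B: "B \<in> sets ?M" using A unfolding B_def by auto
  have rb: "regular_borel_measure_bv weak_star_dual_ball \<mu>" using \<mu>(1) by (simp add: represents_def)
  have bm: "bounded_signed ?M \<mu>" by (rule regular_borel_imp_bounded[OF rb])
  define a where "a = total_var ?M \<mu> A"
  define b where "b = total_var ?M \<mu> B"
  have ab0: "0 \<le> a" "0 \<le> b" by (simp_all add: a_def b_def)
  have AB: "A \<union> B = space ?M" using sets.sets_into_space[OF A] by (auto simp: B_def)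
  have "ennreal (a + b) = variation ?M \<mu> A + variation ?M \<mu> B"
    unfolding a_def b_def using ennreal_total_var[OF bm A] ennreal_total_var[OF bm B] by simp
  also have "\<dots> \<le> variation ?M \<mu> (A \<union> B)"
    using A B bounded_signed_empty[OF bm] by (intro variation_superadditive) (auto simp: B_def)
  also have "\<dots> = ennreal (mass \<mu>)"
    using ennreal_total_var[OF bm cball_ball_borel] unfolding AB space_ball_borel by simp
  finally have "a + b \<le> mass \<mu>" by (simp add: ennreal_le_iff)
  then have ab1: "a + b \<le> 1" using \<mu>(2) by simp
  let ?f = "\<lambda>x \<phi>. blinfun_apply \<phi> x ^ k :: real"
  let ?I = "signed_integral ?M \<mu>"
  define PA where "PA = (\<lambda>x. ?I (\<lambda>\<phi>. indicator A \<phi> * ?f x \<phi>))"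
  define PB where "PB = (\<lambda>x. ?I (\<lambda>\<phi>. indicator B \<phi> * ?f x \<phi>))"
  have rep: "represents k (\<lambda>C. \<mu> (S \<inter> C)) (\<lambda>x. ?I (\<lambda>\<phi>. indicator S \<phi> * ?f x \<phi>))"
    and tv: "mass (\<lambda>C. \<mu> (S \<inter> C)) \<le> total_var ?M \<mu> S"
    and bmS: "bounded_signed ?M (\<lambda>C. \<mu> (S \<inter> C))" if S: "S \<in> sets ?M" for S
  proof -
    show "represents k (\<lambda>C. \<mu> (S \<inter> C)) (\<lambda>x. ?I (\<lambda>\<phi>. indicator S \<phi> * ?f x \<phi>))"
      unfolding represents_def
      using regular_borel_restrict[OF compact_dual_ball rb S] signed_integral_restrict[OF bm S bdd_measurable_eval_power] by simp
    have "S \<inter> cball 0 1 = S" using sets.sets_into_space[OF S] unfolding space_ball_borel by auto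
    then have "variation ?M (\<lambda>C. \<mu> (S \<inter> C)) (cball 0 1) \<le> variation ?M \<mu> S"
      using variation_restrict_le[OF bm S cball_ball_borel] by simp
    then show "mass (\<lambda>C. \<mu> (S \<inter> C)) \<le> total_var ?M \<mu> S"
      using variation_finite[OF bm S] by (intro enn2real_mono) auto
    show "bounded_signed ?M (\<lambda>C. \<mu> (S \<inter> C))" by (rule bounded_signed_restrict[OF bm S])
  qed
  have P: "P x = PA x + PB x" for x
  proof -
    have "PA x + PB x = ?I (\<lambda>\<phi>. 1 * (indicator A \<phi> * ?f x \<phi>) + 1 * (indicator B \<phi> * ?f x \<phi>))"
      unfolding PA_def PB_def
      by (subst signed_integral_linear[OF bm])
         (simp_all add: bdd_measurable_mult bdd_measurable_indicator A B bdd_measurable_eval_power)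
    also have "\<dots> = ?I (?f x)"
      using AB by (intro signed_integral_cong[OF bm]) (auto simp: indicator_def B_def)
    also have "\<dots> = P x" using \<mu>(1) by (simp add: represents_def)
    finally show ?thesis ..
  qed
  define Q where "Q = (\<lambda>x. b * PA x + (- a) * PB x)"
  have QZ: "Q \<in> integral_polynomials k"
    using represents_integral_polynomial[OF represents_linear[OF rep[OF A] rep[OF B], of b "- a"]]
    by (simp add: Q_def PA_def PB_def)
  have "{(\<lambda>x. P x + \<zeta> * Q x) |\<zeta>. \<bar>\<zeta>\<bar> \<le> 1} \<subseteq> integral_unit_ball k"
  proof clarify
    fix \<zeta> :: real assume \<zeta>: "\<bar>\<zeta>\<bar> \<le> 1"
    let ?c = "1 + \<zeta> * b" and ?d = "1 - \<zeta> * a"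
    have "\<bar>\<zeta> * b\<bar> \<le> 1 * 1" "\<bar>\<zeta> * a\<bar> \<le> 1 * 1"
      unfolding abs_mult using \<zeta> ab0 ab1 by (intro mult_mono; simp)+
    then have cd: "0 \<le> ?c" "0 \<le> ?d" by (simp_all add: abs_le_iff)
    let ?\<nu> = "\<lambda>C. ?c * \<mu> (A \<inter> C) + ?d * \<mu> (B \<inter> C)"
    have eq: "(\<lambda>x. P x + \<zeta> * Q x) = (\<lambda>x. ?c * PA x + ?d * PB x)"
      by (rule ext) (simp add: P Q_def algebra_simps)
    have "represents k ?\<nu> (\<lambda>x. ?c * PA x + ?d * PB x)"
      unfolding PA_def PB_def by (rule represents_linear[OF rep[OF A] rep[OF B]])
    moreover have "mass ?\<nu> \<le> 1"
    proof -
      have "mass ?\<nu> \<le> ?c * mass (\<lambda>C. \<mu> (A \<inter> C))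
          + ?d * mass (\<lambda>C. \<mu> (B \<inter> C))"
        using total_var_linear_le[OF bmS[OF A] bmS[OF B] cball_ball_borel, of ?c ?d] cd by simp
      also have "\<dots> \<le> ?c * a + ?d * b"
        unfolding a_def b_def
        using tv[OF A] tv[OF B] cd unfolding a_def b_def by (intro add_mono mult_left_mono) auto
      also have "\<dots> = a + b" by (simp add: algebra_simps)
      finally show ?thesis using ab1 by simp
    qed
    ultimately show "(\<lambda>x. P x + \<zeta> * Q x) \<in> integral_unit_ball k"
      unfolding eq by (rule represents_unit_ball)
  qed
  then have "Q = (\<lambda>_. 0)" using extr QZ unfolding real_extreme_points_def by blast
  then have "b * PA x = a * PB x" for x unfolding Q_def by (auto dest: fun_cong[of _ _ x])
  then have "(a + b) * PA x = a * P x" for x by (simp add: P algebra_simps)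
  then show ?thesis using that[of "a + b"] ab0 ab1 unfolding a_def PA_def by simp
qed

text \<open>
  If every point had an open neighbourhood of variation zero, finitely many of these would cover the
  space.
\<close>

lemma exists_support_point:
  assumes T: "compact_space T" and \<mu>: "bounded_signed (borel_sigma T) \<mu>"
    and pos: "total_var (borel_sigma T) \<mu> (topspace T) > 0"
  shows "\<exists>x\<in>topspace T. \<forall>U. openin T U \<and> x \<in> U \<longrightarrow> total_var (borel_sigma T) \<mu> U > 0"
proof (rule ccontr)
  let ?M = "borel_sigma T"
  let ?\<U> = "{U. openin T U \<and> total_var ?M \<mu> U = 0}"
  assume neg: "\<not> ?thesis"
  have cover: "topspace T \<subseteq> \<Union>?\<U>"
  proof
    fix x assume "x \<in> topspace T"
    then obtain U where U: "openin T U" "x \<in> U" "\<not> total_var ?M \<mu> U > 0" using neg by blast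
    from U(3) have "total_var ?M \<mu> U = 0" by (simp add: not_less order_antisym)
    then show "x \<in> \<Union>?\<U>" using U(1,2) by blast
  qed
  have "compactin T (topspace T)" using T by (simp add: compact_space_def)
  then obtain \<F> where F: "finite \<F>" "\<F> \<subseteq> ?\<U>" "topspace T \<subseteq> \<Union>\<F>"
    using compactinD[of T "topspace T" ?\<U>, OF _ _ cover] by auto
  let ?p = "pos_variation ?M \<mu>" and ?q = "neg_variation ?M \<mu>"
  have tv: "total_var ?M \<mu> A = measure ?p A + measure ?q A" if "A \<in> sets ?M" for A
    by (simp add: measure_pos_variation[OF \<mu> that] measure_neg_variation[OF \<mu> that] field_simps)
  have FM: "U \<in> sets ?M" if "U \<in> \<F>" for U using F that openin_borel_sigma by blast
  have null: "measure ?p U = 0 \<and> measure ?q U = 0" if "U \<in> \<F>" for U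
  proof -
    have "measure ?p U + measure ?q U = 0" using F that tv[OF FM[OF that]] by auto
    then show ?thesis using measure_nonneg[of ?p U] measure_nonneg[of ?q U] by linarith
  qed
  have "measure ?p (\<Union>U\<in>\<F>. U) \<le> (\<Sum>U\<in>\<F>. measure ?p U)"
    using FM by (intro finite_measure.finite_measure_subadditive_finite[OF finite_measure_pos_variation[OF \<mu>] F(1)])
      (auto simp: sets_pos_variation[OF \<mu>])
  moreover have "measure ?q (\<Union>U\<in>\<F>. U) \<le> (\<Sum>U\<in>\<F>. measure ?q U)"
    using FM by (intro finite_measure.finite_measure_subadditive_finite[OF finite_measure_neg_variation[OF \<mu>] F(1)])
      (auto simp: sets_neg_variation[OF \<mu>])
  moreover have "(\<Sum>U\<in>\<F>. measure ?p U) = 0" "(\<Sum>U\<in>\<F>. measure ?q U) = 0"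
    using null by (auto intro: sum.neutral)
  moreover have "(\<Union>U\<in>\<F>. U) = topspace T"
  proof -
    have "U \<subseteq> topspace T" if "U \<in> \<F>" for U using F(2) that openin_subset by auto
    then show ?thesis using F(3) by auto
  qed
  ultimately have "total_var ?M \<mu> (topspace T) \<le> 0"
    using tv[OF openin_borel_sigma[OF openin_topspace]] by simp
  then show False using pos by simp
qed

text \<open>
  The factor \<open>r\<close> may depend on \<open>x\<close>, \<open>y\<close> and \<open>\<epsilon>\<close>, but one factor serves two points at a time. This
  is enough to compare the quotients \<open>P/f\<close> at any two points.
\<close>

lemma approximate_multiple:
  fixes P f :: "'a \<Rightarrow> real"
  assumes approx: "\<And>x y \<epsilon>. \<epsilon> > 0 \<Longrightarrow> \<exists>r. \<bar>r\<bar> \<le> 1 \<and> \<bar>P x - r * f x\<bar> \<le> \<epsilon> \<and> \<bar>P y - r * f y\<bar> \<le> \<epsilon>"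
  obtains c where "\<bar>c\<bar> \<le> 1" "\<And>x. P x = c * f x"
proof (cases "\<exists>x. f x \<noteq> 0")
  case False
  have "P x = 0" for x
  proof -
    have "\<bar>P x\<bar> \<le> 0 + \<epsilon>" if "\<epsilon> > 0" for \<epsilon> using approx[OF that, of x x] False by auto
    then have "\<bar>P x\<bar> \<le> 0" by (rule field_le_epsilon)
    then show ?thesis by simp
  qed
  then show ?thesis using False by (intro that[of 0]) auto
next
  case True
  then obtain x where x: "f x \<noteq> 0" by blast
  have le: "\<bar>P x\<bar> \<le> \<bar>f x\<bar>"
  proof (rule field_le_epsilon)
    fix \<epsilon> :: real assume "\<epsilon> > 0"
    then obtain r where r: "\<bar>r\<bar> \<le> 1" "\<bar>P x - r * f x\<bar> \<le> \<epsilon>" using approx by blast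
    have "\<bar>r * f x\<bar> \<le> 1 * \<bar>f x\<bar>" unfolding abs_mult using r(1) by (intro mult_right_mono) auto
    then show "\<bar>P x\<bar> \<le> \<bar>f x\<bar> + \<epsilon>" using r(2) by linarith
  qed
  have eq: "P y * f x = P x * f y" for y
  proof -
    have "\<bar>P y * f x - P x * f y\<bar> \<le> 0 + \<epsilon>" if \<epsilon>: "\<epsilon> > 0" for \<epsilon>
    proof -
      define \<delta> where "\<delta> = \<epsilon> / (\<bar>f x\<bar> + \<bar>f y\<bar> + 1)"
      have \<delta>: "\<delta> > 0" using \<epsilon> by (simp add: \<delta>_def add_nonneg_pos)
      obtain r where r: "\<bar>P x - r * f x\<bar> \<le> \<delta>" "\<bar>P y - r * f y\<bar> \<le> \<delta>" using approx[OF \<delta>] by blast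
      have "P y * f x - P x * f y = (P y - r * f y) * f x - (P x - r * f x) * f y" by (simp add: algebra_simps)
      also have "\<bar>\<dots>\<bar> \<le> \<bar>P y - r * f y\<bar> * \<bar>f x\<bar> + \<bar>P x - r * f x\<bar> * \<bar>f y\<bar>"
        using abs_triangle_ineq4[of "(P y - r * f y) * f x" "(P x - r * f x) * f y"] by (simp add: abs_mult)
      also have "\<dots> \<le> \<delta> * \<bar>f x\<bar> + \<delta> * \<bar>f y\<bar>" using r by (intro add_mono mult_right_mono) auto
      also have "\<dots> \<le> \<delta> * (\<bar>f x\<bar> + \<bar>f y\<bar> + 1)" using \<delta> by (simp add: algebra_simps)
      also have "\<dots> = \<epsilon>" unfolding \<delta>_def by (simp add: add_nonneg_pos less_imp_neq[symmetric])
      finally show ?thesis by simp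
    qed
    then have "\<bar>P y * f x - P x * f y\<bar> \<le> 0" by (rule field_le_epsilon)
    then show ?thesis by simp
  qed
  show ?thesis
  proof (rule that[of "P x / f x"])
    show "\<bar>P x / f x\<bar> \<le> 1" using le x by (simp add: abs_divide)
    show "P y = P x / f x * f y" for y using eq[of y] x by (simp add: field_simps)
  qed
qed

text \<open>
  For a small neighbourhood \<open>U\<close> of a support point \<open>\<phi>\<close>, the integral of \<open>\<psi>(x)\<^sup>k\<close> over \<open>U\<close> is close to
  \<open>\<phi>(x)\<^sup>k \<mu>(U)\<close> and also proportional to \<open>P(x)\<close>, with a factor independent of \<open>x\<close>. Since \<open>U\<close> depends
  on \<open>x\<close>, two vectors are handled at once and \<open>approximate_multiple\<close> concludes.
\<close>

lemma extreme_point_multiple_of_power: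
  fixes P :: "'a::real_normed_vector \<Rightarrow> real"
  assumes extr: "P \<in> real_extreme_points (integral_polynomials k) (integral_norm k)"
    and nz: "P \<noteq> (\<lambda>_. 0)"
  obtains c and \<phi> :: "'a \<Rightarrow>\<^sub>L real" where "\<bar>c\<bar> \<le> 1" "\<phi> \<in> cball 0 1" "\<And>x. P x = c * \<phi> x ^ k"
proof -
  let ?K = "weak_star_dual_ball :: ('a \<Rightarrow>\<^sub>L real) topology"
  let ?M = "ball_borel :: ('a \<Rightarrow>\<^sub>L real) measure"
  let ?f = "\<lambda>x (\<phi> :: 'a \<Rightarrow>\<^sub>L real). blinfun_apply \<phi> x ^ k"
  have "P \<in> integral_unit_ball k"
    using extr unfolding real_extreme_points_def by simp
  then obtain \<mu> where \<mu>: "represents k \<mu> P" and \<mu>1: "mass \<mu> \<le> 1"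
    by (rule unit_ballE)
  let ?I = "signed_integral ?M \<mu>"
  have bm: "bounded_signed ?M \<mu>"
    by (rule represents_bounded[OF \<mu>])
  obtain x0 where x0: "P x0 \<noteq> 0" using nz by auto
  have pos: "total_var ?M \<mu> (topspace ?K) > 0"
  proof (rule ccontr)
    assume "\<not> ?thesis"
    then have 0: "total_var ?M \<mu> (space ?M) = 0"
      by (simp add: space_borel_sigma not_less enn2real_nonneg order_antisym)
    obtain C where "\<forall>\<phi>\<in>space ?M. \<bar>?f x0 \<phi>\<bar> \<le> C"
      using bdd_measurable_eval_power[of x0 k] unfolding bdd_measurable_def by blast
    then have "\<bar>?I (?f x0)\<bar> \<le> C * total_var ?M \<mu> (space ?M)"
      by (intro abs_signed_integral_le[OF bm bdd_measurable_eval_power]) auto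
    then show False using 0 x0 \<mu> by (simp add: represents_def)
  qed
  obtain \<phi> where \<phi>: "\<phi> \<in> topspace ?K"
    "\<forall>U. openin ?K U \<and> \<phi> \<in> U \<longrightarrow> total_var ?M \<mu> U > 0"
    using exists_support_point[OF compact_dual_ball bm pos] by blast
  have "\<exists>r. \<bar>r\<bar> \<le> 1 \<and> \<bar>P x - r * ?f x \<phi>\<bar> \<le> \<epsilon> \<and> \<bar>P y - r * ?f y \<phi>\<bar> \<le> \<epsilon>" if \<epsilon>: "\<epsilon> > 0" for x y \<epsilon>
  proof -
    let ?N = "\<lambda>z. {\<psi> \<in> topspace ?K. ?f z \<psi> \<in> ball (?f z \<phi>) \<epsilon>}"
    define U where "U = ?N x \<inter> ?N y"
    have "openin ?K (?N z)" for z
      by (rule openin_continuous_map_preimage[of _ euclideanreal])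
         (auto intro: continuous_map_real_pow continuous_map_weak_star_evaluation)
    then have Uo: "openin ?K U" unfolding U_def by blast
    have \<phi>U: "\<phi> \<in> U" using \<phi>(1) \<epsilon> unfolding U_def by simp
    have U: "U \<in> sets ?M" by (rule openin_borel_sigma[OF Uo])
    define a where "a = total_var ?M \<mu> U"
    have a: "a > 0" unfolding a_def using \<phi>(2) Uo \<phi>U by simp
    obtain s where s: "0 \<le> s" "s \<le> 1" "\<And>z. s * ?I (\<lambda>\<psi>. indicator U \<psi> * ?f z \<psi>) = a * P z"
      using extreme_point_proportional[OF extr \<mu> \<mu>1 U] unfolding a_def by blast
    have osc: "\<bar>?I (\<lambda>\<psi>. indicator U \<psi> * ?f z \<psi>) - ?f z \<phi> * \<mu> U\<bar> \<le> \<epsilon> * a"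
      if z: "\<And>\<psi>. \<psi> \<in> U \<Longrightarrow> \<bar>?f z \<psi> - ?f z \<phi>\<bar> \<le> \<epsilon>" for z
    proof -
      note bmU = bounded_signed_restrict[OF bm U]
      let ?IU = "signed_integral ?M (\<lambda>B. \<mu> (U \<inter> B))"
      let ?g = "\<lambda>\<psi>. 1 * ?f z \<psi> + (- ?f z \<phi>) * 1"
      have bg: "bdd_measurable ?M ?g"
        by (intro bdd_measurable_add bdd_measurable_mult bdd_measurable_const bdd_measurable_eval_power)
      have UM: "U \<inter> space ?M = U" using sets.sets_into_space[OF U] by auto
      have "?IU (\<lambda>\<psi>. indicator U \<psi> * ?g \<psi>) = ?I (\<lambda>\<psi>. indicator U \<psi> * (indicator U \<psi> * ?g \<psi>))"
        by (intro signed_integral_restrict[OF bm U] bdd_measurable_mult bdd_measurable_indicator U bg)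
      also have "\<dots> = ?I (\<lambda>\<psi>. indicator U \<psi> * ?g \<psi>)"
        by (rule arg_cong[where f = ?I]) (auto simp: fun_eq_iff indicator_def)
      also have "\<dots> = ?IU ?g" by (rule signed_integral_restrict[OF bm U bg, symmetric])
      also have "\<dots> = 1 * ?IU (?f z) + (- ?f z \<phi>) * ?IU (\<lambda>_. 1)"
        by (rule signed_integral_linear[OF bmU bdd_measurable_eval_power bdd_measurable_const])
      also have "\<dots> = ?I (\<lambda>\<psi>. indicator U \<psi> * ?f z \<psi>) - ?f z \<phi> * \<mu> U"
        using signed_integral_restrict[OF bm U bdd_measurable_eval_power, of z k]
          signed_integral_const[OF bmU, of 1] UM by simp
      finally have eq: "?IU (\<lambda>\<psi>. indicator U \<psi> * ?g \<psi>) = ?I (\<lambda>\<psi>. indicator U \<psi> * ?f z \<psi>) - ?f z \<phi> * \<mu> U" .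
      \<comment> \<open>The integrand is small only on \<open>U\<close>; inserting the indicator makes the bound global.\<close>
      have "\<bar>?IU (\<lambda>\<psi>. indicator U \<psi> * ?g \<psi>)\<bar> \<le> \<epsilon> * total_var ?M (\<lambda>B. \<mu> (U \<inter> B)) (space ?M)"
        by (intro abs_signed_integral_le[OF bmU] bdd_measurable_mult bdd_measurable_indicator U bg)
           (use z \<epsilon> in \<open>auto simp: indicator_def\<close>)
      also have "total_var ?M (\<lambda>B. \<mu> (U \<inter> B)) (space ?M) \<le> a"
        unfolding a_def using variation_restrict_le[OF bm U sets.top] variation_finite[OF bm U]
        by (intro enn2real_mono) (auto simp: UM)
      finally show ?thesis using \<epsilon> unfolding eq by (simp add: mult_left_mono)
    qed
    define r where "r = s * \<mu> U / a"
    have "\<bar>s * \<mu> U\<bar> \<le> 1 * a"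
      unfolding abs_mult a_def using s abs_le_total_var[OF bm U] by (intro mult_mono) auto
    then have r1: "\<bar>r\<bar> \<le> 1" unfolding r_def using a by (simp add: abs_divide)
    have *: "\<bar>P z - r * ?f z \<phi>\<bar> \<le> \<epsilon>" if z: "\<And>\<psi>. \<psi> \<in> U \<Longrightarrow> \<bar>?f z \<psi> - ?f z \<phi>\<bar> \<le> \<epsilon>" for z
    proof -
      have "a * (P z - r * ?f z \<phi>) = s * (?I (\<lambda>\<psi>. indicator U \<psi> * ?f z \<psi>) - ?f z \<phi> * \<mu> U)"
        using a unfolding r_def by (simp add: algebra_simps s(3))
      also have "\<bar>\<dots>\<bar> \<le> 1 * (\<epsilon> * a)"
        unfolding abs_mult using s osc[OF z] by (intro mult_mono) auto
      finally show ?thesis using a by (simp add: abs_mult mult.commute)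
    qed
    have "\<bar>?f x \<psi> - ?f x \<phi>\<bar> \<le> \<epsilon>" "\<bar>?f y \<psi> - ?f y \<phi>\<bar> \<le> \<epsilon>" if "\<psi> \<in> U" for \<psi>
      using that unfolding U_def by (auto simp: dist_real_def)
    then show ?thesis using r1 *[of x] *[of y] by blast
  qed
  then obtain c where "\<bar>c\<bar> \<le> 1" "\<And>x. P x = c * ?f x \<phi>"
    using approximate_multiple[of P "\<lambda>x. ?f x \<phi>"] by blast
  then show ?thesis using that \<phi>(1) by (simp add: topspace_dual_ball)
qed

lemma power_nonzero:
  fixes \<phi> :: "'a::real_normed_vector \<Rightarrow>\<^sub>L real"
  assumes "\<phi> \<noteq> 0"
  obtains x where "\<phi> x ^ k \<noteq> 0"
proof -
  have "\<exists>x. \<phi> x \<noteq> 0"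
  proof (rule ccontr)
    assume "\<nexists>x. \<phi> x \<noteq> 0"
    then have "\<phi> = 0" by (intro blinfun_eqI) simp
    then show False using assms by simp
  qed
  then show ?thesis using that by auto
qed

text \<open>
  Once \<open>P\<close> is a multiple \<open>d \<phi>\<^sup>k\<close> with \<open>\<parallel>\<phi>\<parallel> = 1\<close> and \<open>\<bar>d\<bar> \<le> 1\<close>, a factor of modulus below 1 leaves
  room for the perturbation \<open>(1 - \<bar>d\<bar>) \<phi>\<^sup>k\<close>.
\<close>

theorem extreme_point_imp_power:
  fixes P :: "'a::real_normed_vector \<Rightarrow> real"
  assumes X: "\<exists>x :: 'a. x \<noteq> 0" and k: "k > 0"
    and extr: "P \<in> real_extreme_points (integral_polynomials k) (integral_norm k)"
  obtains \<phi> :: "'a \<Rightarrow>\<^sub>L real" where "norm \<phi> = 1"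
    "P = (\<lambda>x. blinfun_apply \<phi> x ^ k) \<or> P = (\<lambda>x. - (blinfun_apply \<phi> x ^ k))"
proof -
  let ?Z = "integral_polynomials k :: ('a \<Rightarrow> real) set" and ?B = "integral_unit_ball k"
  have zero: "Q = (\<lambda>_. 0)" if "Q \<in> ?Z" "\<And>\<zeta>. \<bar>\<zeta>\<bar> \<le> 1 \<Longrightarrow> (\<lambda>x. P x + \<zeta> * Q x) \<in> ?B" for Q
    using extr that unfolding real_extreme_points_def by blast
  have sub: "?B \<subseteq> ?Z" by (auto simp: unit_ball_def)
  have nz: "P \<noteq> (\<lambda>_. 0)"
  proof
    assume P0: "P = (\<lambda>_. 0)"
    obtain \<psi> :: "'a \<Rightarrow>\<^sub>L real" where \<psi>: "norm \<psi> = 1" using X functional_of_norm_one by blast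
    then have \<psi>1: "\<psi> \<in> cball 0 1" by simp
    have "(\<lambda>x. 1 * blinfun_apply \<psi> x ^ k) = (\<lambda>_. 0)"
    proof (rule zero)
      show "(\<lambda>x. 1 * blinfun_apply \<psi> x ^ k) \<in> ?Z"
        using multiple_of_power_unit_ball[OF \<psi>1, of 1 k] sub by auto
      fix \<zeta> :: real assume "\<bar>\<zeta>\<bar> \<le> 1"
      from multiple_of_power_unit_ball[OF \<psi>1 this, of k]
      show "(\<lambda>x. P x + \<zeta> * (1 * blinfun_apply \<psi> x ^ k)) \<in> ?B" by (simp add: P0)
    qed
    moreover obtain x where "\<psi> x ^ k \<noteq> 0" using power_nonzero[of \<psi> k] \<psi> by fastforce
    ultimately show False by (auto dest: fun_cong[of _ _ x])
  qed
  obtain c \<phi>0 where c: "\<bar>c\<bar> \<le> 1" and \<phi>0: "\<phi>0 \<in> cball 0 1" and P: "\<And>x. P x = c * blinfun_apply \<phi>0 x ^ k"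
    using extreme_point_multiple_of_power[OF extr nz] by blast
  have \<phi>0_nz: "\<phi>0 \<noteq> 0" using nz P k by (auto simp: fun_eq_iff)
  define \<phi> where "\<phi> = (1 / norm \<phi>0) *\<^sub>R \<phi>0"
  define d where "d = c * norm \<phi>0 ^ k"
  have \<phi>: "norm \<phi> = 1" using \<phi>0_nz by (simp add: \<phi>_def)
  have "\<bar>c\<bar> * norm \<phi>0 ^ k \<le> 1 * 1" using c \<phi>0 by (intro mult_mono power_le_one) auto
  then have d: "\<bar>d\<bar> \<le> 1" by (simp add: d_def abs_mult)
  have P: "P x = d * \<phi> x ^ k" for x
    using \<phi>0_nz P by (simp add: \<phi>_def d_def blinfun.scaleR_left power_mult_distrib power_divide)
  have \<phi>1: "\<phi> \<in> cball 0 1" using \<phi> by simp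
  have "\<bar>d\<bar> = 1"
  proof (rule ccontr)
    assume "\<bar>d\<bar> \<noteq> 1"
    define e where "e = 1 - \<bar>d\<bar>"
    have e: "e > 0" "e \<le> 1" using d \<open>\<bar>d\<bar> \<noteq> 1\<close> unfolding e_def by auto
    have "(\<lambda>x. e * blinfun_apply \<phi> x ^ k) = (\<lambda>_. 0)"
    proof (rule zero)
      show "(\<lambda>x. e * blinfun_apply \<phi> x ^ k) \<in> ?Z"
        using multiple_of_power_unit_ball[OF \<phi>1, of e] e sub by auto
      fix \<zeta> :: real assume \<zeta>: "\<bar>\<zeta>\<bar> \<le> 1"
      have "\<bar>\<zeta> * e\<bar> \<le> 1 * e" unfolding abs_mult using \<zeta> e by (intro mult_mono) auto
      then have "\<bar>d + \<zeta> * e\<bar> \<le> 1"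
        using abs_triangle_ineq[of d "\<zeta> * e"] e_def by linarith
      from multiple_of_power_unit_ball[OF \<phi>1 this, of k]
      show "(\<lambda>x. P x + \<zeta> * (e * blinfun_apply \<phi> x ^ k)) \<in> ?B"
        by (simp add: P algebra_simps)
    qed
    moreover obtain x where "\<phi> x ^ k \<noteq> 0" using power_nonzero[of \<phi> k] \<phi> by fastforce
    ultimately show False using e by (auto dest: fun_cong[of _ _ x])
  qed
  then have "d = 1 \<or> d = -1" by auto
  then have "P = (\<lambda>x. blinfun_apply \<phi> x ^ k) \<or> P = (\<lambda>x. - (blinfun_apply \<phi> x ^ k))"
    using P by auto
  then show ?thesis using that \<phi> by blast
qed

section \<open>Powers of norm-one functionals are extreme points\<close>

text \<open>
  In the application, \<open>q = u\<^sup>2\<close> and \<open>w = \<plusminus> u\<^bsup>k-2\<^esup>\<close> for \<open>u = \<psi>(x)\<close>, so that \<open>q w = \<plusminus> u\<^sup>k\<close>. The core is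
  \<open>1 - w \<le> 2 (1 - q w)\<close>: if \<open>w\<close> is far from 1 then so is \<open>q w\<close>.
\<close>

lemma second_moment_pointwise:
  fixes v w B q :: real
  assumes v: "\<bar>v\<bar> \<le> B" and w: "\<bar>w\<bar> \<le> 1" and q: "0 \<le> q" "q \<le> 1"
  shows "v\<^sup>2 \<le> w * v\<^sup>2 + 2 * B\<^sup>2 * (1 - q * w)"
proof -
  have vB: "v\<^sup>2 \<le> B\<^sup>2" using v by (metis abs_le_square_iff abs_of_nonneg abs_ge_zero order_trans)
  have "q * w \<le> max 0 w"
  proof (cases "w \<ge> 0")
    case True
    then show ?thesis using q mult_right_mono[of q 1 w] by simp
  next
    case False
    then show ?thesis using q by (simp add: mult_nonneg_nonpos)
  qed
  then have "1 - w \<le> 2 * (1 - q * w)" using w by (auto simp: max_def split: if_splits)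
  then have "v\<^sup>2 * (1 - w) \<le> B\<^sup>2 * (2 * (1 - q * w))"
    using vB w by (intro mult_mono) auto
  then show ?thesis by (simp add: algebra_simps)
qed

text \<open>
  If \<open>\<integral> u\<^sup>k d\<mu>\<close> is close to the total variation, then \<open>u\<^bsup>k-2\<^esup>\<close> is close to the sign of \<open>\<mu>\<close> on most of
  the space, and replacing \<open>d\<bar>\<mu>\<bar>\<close> by \<open>u\<^bsup>k-2\<^esup> d\<mu>\<close> costs little. The pointwise estimate is integrated
  with \<open>w = u\<^bsup>k-2\<^esup>\<close> against the positive part of \<open>\<mu>\<close> and with \<open>w = - u\<^bsup>k-2\<^esup>\<close> against the negative part.
\<close>

lemma second_moment_le:
  fixes u v :: "'b \<Rightarrow> real"
  assumes \<mu>: "bounded_signed M \<mu>" and u: "bdd_measurable M u" and v: "bdd_measurable M v"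
    and u1: "\<And>x. x \<in> space M \<Longrightarrow> \<bar>u x\<bar> \<le> 1" and vB: "\<And>x. x \<in> space M \<Longrightarrow> \<bar>v x\<bar> \<le> B"
    and k: "k \<ge> 2"
  shows "variation_integral M \<mu> (\<lambda>x. v x ^ 2) \<le> signed_integral M \<mu> (\<lambda>x. u x ^ (k - 2) * v x ^ 2)
    + 2 * B\<^sup>2 * (total_var M \<mu> (space M) - signed_integral M \<mu> (\<lambda>x. u x ^ k))"
proof -
  let ?p = "pos_variation M \<mu>" and ?q = "neg_variation M \<mu>"
  have uk: "u x ^ k = (u x)\<^sup>2 * u x ^ (k - 2)" for x
    using k by (metis le_add_diff_inverse power_add)
  have bv: "bdd_measurable M (\<lambda>x. v x ^ 2)" "bdd_measurable M (\<lambda>x. u x ^ k)"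
    "bdd_measurable M (\<lambda>x. u x ^ (k - 2) * v x ^ 2)"
    by (intro bdd_measurable_mult bdd_measurable_power u v)+
  note ip = bv[THEN integrable_pos_variation[OF \<mu>]] and iq = bv[THEN integrable_neg_variation[OF \<mu>]]
  have q: "0 \<le> (u x)\<^sup>2" "(u x)\<^sup>2 \<le> 1" if "x \<in> space M" for x
    using u1[OF that] by (auto simp: abs_square_le_1)
  have w: "\<bar>u x ^ (k - 2)\<bar> \<le> 1" if "x \<in> space M" for x
    unfolding power_abs using u1[OF that] by (intro power_le_one) auto
  interpret p: finite_measure ?p by (rule finite_measure_pos_variation[OF \<mu>])
  interpret q: finite_measure ?q by (rule finite_measure_neg_variation[OF \<mu>])
  have "integral\<^sup>L ?p (\<lambda>x. v x ^ 2) \<le> integral\<^sup>L ?p (\<lambda>x. u x ^ (k - 2) * v x ^ 2 + 2 * B\<^sup>2 * (1 - u x ^ k))"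
  proof (rule integral_mono)
    fix x assume "x \<in> space ?p"
    then have x: "x \<in> space M" by (simp add: space_variations[OF \<mu>])
    show "v x ^ 2 \<le> u x ^ (k - 2) * v x ^ 2 + 2 * B\<^sup>2 * (1 - u x ^ k)"
      unfolding uk by (rule second_moment_pointwise[OF vB[OF x] w[OF x] q[OF x]])
  qed (use ip in auto)
  also have "\<dots> = integral\<^sup>L ?p (\<lambda>x. u x ^ (k - 2) * v x ^ 2)
      + 2 * B\<^sup>2 * (measure ?p (space M) - integral\<^sup>L ?p (\<lambda>x. u x ^ k))"
    using ip by (simp add: space_variations[OF \<mu>])
  finally have P: "integral\<^sup>L ?p (\<lambda>x. v x ^ 2) \<le> \<dots>" .
  have "integral\<^sup>L ?q (\<lambda>x. v x ^ 2) \<le> integral\<^sup>L ?q (\<lambda>x. - (u x ^ (k - 2) * v x ^ 2) + 2 * B\<^sup>2 * (1 + u x ^ k))"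
  proof (rule integral_mono)
    fix x assume "x \<in> space ?q"
    then have x: "x \<in> space M" by (simp add: space_variations[OF \<mu>])
    show "v x ^ 2 \<le> - (u x ^ (k - 2) * v x ^ 2) + 2 * B\<^sup>2 * (1 + u x ^ k)"
      using second_moment_pointwise[OF vB[OF x] _ q[OF x], of "- (u x ^ (k - 2))"] w[OF x] unfolding uk by simp
  qed (use iq in auto)
  also have "\<dots> = - integral\<^sup>L ?q (\<lambda>x. u x ^ (k - 2) * v x ^ 2)
      + 2 * B\<^sup>2 * (measure ?q (space M) + integral\<^sup>L ?q (\<lambda>x. u x ^ k))"
    using iq by (simp add: space_variations[OF \<mu>])
  finally have Q: "integral\<^sup>L ?q (\<lambda>x. v x ^ 2) \<le> \<dots>" .
  have tv: "total_var M \<mu> (space M) = measure ?p (space M) + measure ?q (space M)"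
    by (simp add: measure_pos_variation[OF \<mu>] measure_neg_variation[OF \<mu>] field_simps)
  show ?thesis
    using add_mono[OF P Q] unfolding variation_integral_def signed_integral_def tv by (simp add: algebra_simps)
qed

lemma signed_integral_sum:
  assumes \<mu>: "bounded_signed M \<mu>" and "finite J" and f: "\<And>j. j \<in> J \<Longrightarrow> bdd_measurable M (f j)"
  shows "bdd_measurable M (\<lambda>x. \<Sum>j\<in>J. c j * f j x) \<and>
    signed_integral M \<mu> (\<lambda>x. \<Sum>j\<in>J. c j * f j x) = (\<Sum>j\<in>J. c j * signed_integral M \<mu> (f j))"
  using assms(2,3)
proof (induction J rule: finite_induct)
  case empty
  then show ?case using signed_integral_const[OF \<mu>, of 0] by (simp add: bdd_measurable_const)
next
  case (insert i J)
  then have f: "bdd_measurable M (f i)" and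
    IH: "bdd_measurable M (\<lambda>x. \<Sum>j\<in>J. c j * f j x)"
      "signed_integral M \<mu> (\<lambda>x. \<Sum>j\<in>J. c j * f j x) = (\<Sum>j\<in>J. c j * signed_integral M \<mu> (f j))" by auto
  have "bdd_measurable M (\<lambda>x. c i * f i x + (\<Sum>j\<in>J. c j * f j x))"
    by (intro bdd_measurable_add bdd_measurable_mult bdd_measurable_const f IH)
  then show ?case
    using insert.hyps signed_integral_linear[OF \<mu> f IH(1), of "c i" 1] IH(2) by simp
qed

text \<open>
  Both sides of \<open>R1 (x + t y) + R2 (x + t y) = 2 \<phi>(x)\<^sup>k\<close> are polynomials in \<open>t\<close>, the right-hand side
  being constant; the claim compares the coefficients of \<open>t\<^sup>2\<close>.
\<close>

lemma mixed_moment_zero: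
  fixes \<phi> :: "'a::real_normed_vector \<Rightarrow>\<^sub>L real"
  assumes rep: "represents k \<mu>1 R1" "represents k \<mu>2 R2"
    and sum: "\<And>x. R1 x + R2 x = 2 * \<phi> x ^ k" and y: "\<phi> y = 0" and k: "k \<ge> 2"
  shows "signed_integral ball_borel \<mu>1 (\<lambda>\<psi>. blinfun_apply \<psi> x ^ (k - 2) * blinfun_apply \<psi> y ^ 2)
    + signed_integral ball_borel \<mu>2 (\<lambda>\<psi>. blinfun_apply \<psi> x ^ (k - 2) * blinfun_apply \<psi> y ^ 2) = 0"
proof -
  let ?m = "\<lambda>j (\<psi> :: 'a \<Rightarrow>\<^sub>L real). blinfun_apply \<psi> x ^ (k - j) * blinfun_apply \<psi> y ^ j"
  have bm: "bdd_measurable ball_borel (?m j)" for j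
    by (intro bdd_measurable_mult bdd_measurable_eval_power)
  have expand: "R (x + t *\<^sub>R y) = (\<Sum>j\<le>k. (real (k choose j) * signed_integral ball_borel \<mu> (?m j)) * t ^ j)"
    if "represents k \<mu> R" for R \<mu> t
  proof -
    have "R (x + t *\<^sub>R y) = signed_integral ball_borel \<mu> (\<lambda>\<psi>. blinfun_apply \<psi> (x + t *\<^sub>R y) ^ k)"
      using that by (simp add: represents_def)
    also have "(\<lambda>\<psi> :: 'a \<Rightarrow>\<^sub>L real. blinfun_apply \<psi> (x + t *\<^sub>R y) ^ k) =
        (\<lambda>\<psi>. \<Sum>j\<le>k. (real (k choose j) * t ^ j) * ?m j \<psi>)"
      by (simp add: fun_eq_iff blinfun.add_right blinfun.scaleR_right add.commute[of "blinfun_apply _ x"]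
          binomial_ring power_mult_distrib mult_ac)
    also have "signed_integral ball_borel \<mu> \<dots> = (\<Sum>j\<le>k. (real (k choose j) * t ^ j) * signed_integral ball_borel \<mu> (?m j))"
      by (rule conjunct2[OF signed_integral_sum[OF represents_bounded[OF that]]]) (simp_all add: bm)
    finally show ?thesis by (simp add: mult_ac)
  qed
  define c where "c j = real (k choose j) * (signed_integral ball_borel \<mu>1 (?m j) + signed_integral ball_borel \<mu>2 (?m j))" for j
  have "(\<Sum>j\<le>k. c j * t ^ j) = 2 * \<phi> x ^ k" for t
  proof -
    have "(\<Sum>j\<le>k. c j * t ^ j) = R1 (x + t *\<^sub>R y) + R2 (x + t *\<^sub>R y)"
      unfolding expand[OF rep(1)] expand[OF rep(2)] c_def by (simp add: sum.distrib algebra_simps)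
    then show ?thesis unfolding sum by (simp add: blinfun.add_right blinfun.scaleR_right y)
  qed
  then have "c 2 = 0" using polyfun_eq_const[where n = k and c = c and k = "2 * \<phi> x ^ k"] k by auto
  then show ?thesis using k unfolding c_def by simp
qed

text \<open>
  The vector \<open>z - a x\<close> lies in the kernel of \<open>\<phi>\<close>, so the functionals that matter almost vanish there
  and \<open>\<psi>(z)\<^sup>k\<close> may be replaced by \<open>(a \<psi>(x))\<^sup>k\<close>. Only the square of \<open>\<psi>(z - a x)\<close> is controlled, whence
  the parameter \<open>\<theta>\<close>: its first power is at most \<open>\<theta>/2\<close> plus the square divided by \<open>2\<theta>\<close>.
\<close>

lemma moment_near_maximum:
  fixes \<phi> :: "'a::real_normed_vector \<Rightarrow>\<^sub>L real"
  assumes rep: "represents k \<mu>1 R1" "represents k \<mu>2 R2"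
    and tv: "mass \<mu>1 \<le> 1" "mass \<mu>2 \<le> 1"
    and sum: "\<And>x. R1 x + R2 x = 2 * \<phi> x ^ k" and k: "k \<ge> 2"
    and x: "norm x = 1" "\<phi> x \<noteq> 0"
    and a: "a = \<phi> z / \<phi> x" "\<bar>a\<bar> \<le> A" and B: "B = 1 + norm z + A"
    and \<theta>: "\<theta> > 0"
  shows "\<bar>R1 z - a ^ k * R1 x\<bar> \<le> B ^ k * k * (\<theta> / 2 + 2 * B\<^sup>2 * (1 - \<phi> x ^ k) / \<theta>)"
proof -
  let ?M = "ball_borel :: ('a \<Rightarrow>\<^sub>L real) measure"
  define y where "y = z - a *\<^sub>R x"
  define C where "C = B ^ k * k"
  have y0: "\<phi> y = 0"
    using x a(1) by (simp add: y_def blinfun.diff_right blinfun.scaleR_right)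
  have A0: "0 \<le> A" using a(2) by simp
  have B1: "1 \<le> B" using A0 B by simp
  have C0: "0 \<le> C" using B1 by (simp add: C_def)
  have yB: "norm y \<le> B" using norm_triangle_ineq4[of z "a *\<^sub>R x"] x(1) a(2) B by (simp add: y_def)
  note b1 = represents_bounded[OF rep(1)] and b2 = represents_bounded[OF rep(2)]
  note bme = bdd_measurable_eval and bmp = bdd_measurable_eval_power
  let ?u = "\<lambda>\<psi> :: 'a \<Rightarrow>\<^sub>L real. blinfun_apply \<psi> x" and ?v = "\<lambda>\<psi> :: 'a \<Rightarrow>\<^sub>L real. blinfun_apply \<psi> y"
  have u1: "\<bar>?u \<psi>\<bar> \<le> 1" and vB: "\<bar>?v \<psi>\<bar> \<le> B" if "\<psi> \<in> space ?M" for \<psi>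
    using dual_ball_apply_le[of \<psi> x] dual_ball_apply_le[of \<psi> y] that x(1) yB by (auto simp: space_ball_borel)
  have V: "variation_integral ?M \<mu> (\<lambda>\<psi>. ?v \<psi> ^ 2) \<le> signed_integral ?M \<mu> (\<lambda>\<psi>. ?u \<psi> ^ (k - 2) * ?v \<psi> ^ 2)
      + 2 * B\<^sup>2 * (1 - R x)" if R: "represents k \<mu> R" and t: "mass \<mu> \<le> 1" for \<mu> R
  proof -
    have "R x = signed_integral ?M \<mu> (\<lambda>\<psi>. ?u \<psi> ^ k)" using R by (simp add: represents_def)
    then have "variation_integral ?M \<mu> (\<lambda>\<psi>. ?v \<psi> ^ 2) \<le> signed_integral ?M \<mu> (\<lambda>\<psi>. ?u \<psi> ^ (k - 2) * ?v \<psi> ^ 2)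
      + 2 * B\<^sup>2 * (total_var ?M \<mu> (space ?M) - R x)"
      using second_moment_le[OF represents_bounded[OF R] bme bme u1 vB k] by simp
    also have "\<dots> \<le> signed_integral ?M \<mu> (\<lambda>\<psi>. ?u \<psi> ^ (k - 2) * ?v \<psi> ^ 2) + 2 * B\<^sup>2 * (1 - R x)"
      using t by (intro add_left_mono mult_left_mono) (auto simp: space_ball_borel)
    finally show ?thesis .
  qed
  have "0 \<le> variation_integral ?M \<mu>2 (\<lambda>\<psi>. ?v \<psi> ^ 2)"
    unfolding variation_integral_def by (intro add_nonneg_nonneg Bochner_Integration.integral_nonneg) auto
  then have "variation_integral ?M \<mu>1 (\<lambda>\<psi>. ?v \<psi> ^ 2) \<le> 2 * B\<^sup>2 * (1 - R1 x) + 2 * B\<^sup>2 * (1 - R2 x)"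
    using V[OF rep(1) tv(1)] V[OF rep(2) tv(2)] mixed_moment_zero[OF rep sum y0 k, of x] by linarith
  also have "\<dots> = 2 * B\<^sup>2 * (2 - (R1 x + R2 x))" by (simp add: algebra_simps)
  finally have V1: "variation_integral ?M \<mu>1 (\<lambda>\<psi>. ?v \<psi> ^ 2) \<le> 4 * B\<^sup>2 * (1 - blinfun_apply \<phi> x ^ k)"
    unfolding sum by (simp add: algebra_simps)
  let ?h = "\<lambda>\<psi> :: 'a \<Rightarrow>\<^sub>L real. 1 * blinfun_apply \<psi> z ^ k + (- (a ^ k)) * ?u \<psi> ^ k"
  let ?g = "\<lambda>\<psi> :: 'a \<Rightarrow>\<^sub>L real. (C * \<theta> / 2) * 1 + (C / (2 * \<theta>)) * ?v \<psi> ^ 2"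
  have bh: "bdd_measurable ?M ?h" and bg: "bdd_measurable ?M ?g"
    by (intro bdd_measurable_add bdd_measurable_mult bdd_measurable_const bmp)+
  have hg: "\<bar>?h \<psi>\<bar> \<le> ?g \<psi>" if \<psi>: "\<psi> \<in> space ?M" for \<psi>
  proof -
    have "\<bar>\<psi> z\<bar> \<le> norm z" using dual_ball_apply_le[of \<psi> z] \<psi> by (simp add: space_ball_borel)
    then have s: "\<bar>\<psi> z\<bar> \<le> B" using B A0 by simp
    have "\<bar>a * ?u \<psi>\<bar> \<le> A * 1" unfolding abs_mult using a(2) A0 u1[OF \<psi>] by (intro mult_mono) auto
    then have r: "\<bar>a * ?u \<psi>\<bar> \<le> B" using B by (simp add: add_increasing)
    have "\<bar>\<psi> z ^ k - (a * ?u \<psi>) ^ k\<bar> \<le> B ^ k * (\<Sum>i<k. \<bar>\<psi> z - a * ?u \<psi>\<bar>)"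
      using abs_prod_diff_le[OF B1, of k "\<lambda>_. blinfun_apply \<psi> z" "\<lambda>_. a * ?u \<psi>"] s r by simp
    also have "\<dots> = C * \<bar>?v \<psi>\<bar>"
      by (simp add: C_def y_def blinfun.diff_right blinfun.scaleR_right)
    also have "\<dots> \<le> C * (\<theta> / 2 + ?v \<psi> ^ 2 / (2 * \<theta>))"
    proof (rule mult_left_mono[OF _ C0])
      \<comment> \<open>The inequality of the arithmetic and geometric means for \<open>\<theta>\<close> and \<open>\<psi>(y)\<^sup>2 / \<theta>\<close>.\<close>
      have "0 \<le> (\<bar>?v \<psi>\<bar> - \<theta>)\<^sup>2" by simp
      then have "2 * \<theta> * \<bar>?v \<psi>\<bar> \<le> \<theta>\<^sup>2 + ?v \<psi> ^ 2" by (simp add: power2_diff algebra_simps)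
      then show "\<bar>?v \<psi>\<bar> \<le> \<theta> / 2 + ?v \<psi> ^ 2 / (2 * \<theta>)"
        using \<theta> by (simp add: field_simps power2_eq_square)
    qed
    finally show ?thesis by (simp add: power_mult_distrib algebra_simps)
  qed
  have R1: "R1 w = signed_integral ?M \<mu>1 (\<lambda>\<psi>. blinfun_apply \<psi> w ^ k)" for w
    using rep(1) by (simp add: represents_def)
  have "R1 z - a ^ k * R1 x = signed_integral ?M \<mu>1 ?h"
    unfolding R1 signed_integral_linear[OF b1 bmp bmp] by simp
  also have "\<bar>\<dots>\<bar> \<le> variation_integral ?M \<mu>1 ?g"
    by (rule abs_signed_integral_le_variation_integral[OF b1 bh bg hg])
  also have "\<dots> = C * \<theta> / 2 * mass \<mu>1
      + C / (2 * \<theta>) * variation_integral ?M \<mu>1 (\<lambda>\<psi>. ?v \<psi> ^ 2)"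
    unfolding variation_integral_linear[OF b1 bdd_measurable_const bmp] variation_integral_const[OF b1]
    by (simp add: space_ball_borel)
  also have "\<dots> \<le> C * \<theta> / 2 * 1 + C / (2 * \<theta>) * (4 * B\<^sup>2 * (1 - \<phi> x ^ k))"
    using tv(1) V1 C0 \<theta> by (intro add_mono mult_left_mono) auto
  also have "\<dots> = C * (\<theta> / 2 + 2 * B\<^sup>2 * (1 - \<phi> x ^ k) / \<theta>)"
    using \<theta> by (simp add: field_simps)
  finally show ?thesis unfolding C_def .
qed

lemma almost_norming_vector:
  fixes \<phi> :: "'a::real_normed_vector \<Rightarrow>\<^sub>L real"
  assumes \<phi>: "norm \<phi> = 1" and e: "0 < e" "e < 1"
  shows "\<exists>x. norm x = 1 \<and> 1 - e < \<phi> x"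
proof -
  have "\<exists>x. (1 - e) * norm x < \<bar>\<phi> x\<bar>"
  proof (rule ccontr)
    assume "\<not> ?thesis"
    then have "norm \<phi> \<le> 1 - e" using e by (intro norm_blinfun_bound) (auto simp: not_less)
    then show False using \<phi> e by simp
  qed
  then obtain x where x: "(1 - e) * norm x < \<bar>\<phi> x\<bar>" by blast
  then have x0: "x \<noteq> 0" by auto
  let ?x = "(sgn (\<phi> x) / norm x) *\<^sub>R x"
  have "\<phi> x \<noteq> 0"
  proof
    assume "\<phi> x = 0"
    then have "(1 - e) * norm x < 0" using x by simp
    then show False using e by (simp add: mult_less_0_iff)
  qed
  then have "norm ?x = 1" using x0 by (simp add: abs_sgn_eq)
  moreover have "\<phi> ?x = \<bar>\<phi> x\<bar> / norm x"
    by (simp add: blinfun.scaleR_right abs_sgn mult.commute)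
  moreover have "1 - e < \<bar>\<phi> x\<bar> / norm x" using x x0 by (simp add: field_simps)
  ultimately show ?thesis by metis
qed

text \<open>
  The preceding estimate is applied along unit vectors \<open>x n\<close> with \<open>\<phi>(x n)\<close> tending to 1; such a
  sequence is needed since \<open>\<phi>\<close> may fail to attain its norm. Its error tends to a multiple of
  \<open>\<theta>\<close>, which is arbitrary.
\<close>

lemma power_not_midpoint:
  fixes \<phi> :: "'a::real_normed_vector \<Rightarrow>\<^sub>L real"
  assumes \<phi>: "norm \<phi> = 1" and k: "k \<ge> 2"
    and R1: "R1 \<in> integral_unit_ball k"
    and R2: "R2 \<in> integral_unit_ball k"
    and sum: "\<And>x. R1 x + R2 x = 2 * \<phi> x ^ k"
  shows "R1 z = \<phi> z ^ k"
proof -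
  let ?M = "ball_borel :: ('a \<Rightarrow>\<^sub>L real) measure"
  obtain \<mu>1 where \<mu>1: "represents k \<mu>1 R1" "mass \<mu>1 \<le> 1" by (rule unit_ballE[OF R1])
  obtain \<mu>2 where \<mu>2: "represents k \<mu>2 R2" "mass \<mu>2 \<le> 1" by (rule unit_ballE[OF R2])
  have "\<exists>x. norm x = 1 \<and> 1 - 1 / real (n + 2) < \<phi> x" for n
    by (rule almost_norming_vector[OF \<phi>]) auto
  then obtain x where x: "\<And>n. norm (x n) = 1" "\<And>n. 1 - 1 / real (n + 2) < \<phi> (x n)" by metis
  have x_le: "\<phi> (x n) \<le> 1" for n
    using norm_blinfun[of \<phi> "x n"] \<phi> x(1)[of n] by simp
  have x_ge: "1 / 2 < \<phi> (x n)" for n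
  proof -
    have "1 / real (n + 2) \<le> 1 / 2" by (intro divide_left_mono) auto
    then show ?thesis using x(2)[of n] by linarith
  qed
  \<comment> \<open>The index shift by 2 keeps \<open>\<phi>(x n)\<close> above 1/2, so that the quotients \<open>a n\<close> below are bounded.\<close>
  have lim\<phi>: "(\<lambda>n. blinfun_apply \<phi> (x n)) \<longlonglongrightarrow> 1"
  proof (rule real_tendsto_sandwich)
    have "(\<lambda>n. 1 - 1 / real (n + 2)) \<longlonglongrightarrow> 1 - 0"
      by (intro tendsto_diff tendsto_const LIMSEQ_ignore_initial_segment[OF lim_1_over_n])
    then show "(\<lambda>n. 1 - 1 / real (n + 2)) \<longlonglongrightarrow> 1" by simp
    show "\<forall>\<^sub>F n in sequentially. 1 - 1 / real (n + 2) \<le> \<phi> (x n)"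
      using x(2) by (intro always_eventually allI less_imp_le)
    show "\<forall>\<^sub>F n in sequentially. \<phi> (x n) \<le> 1" using x_le by simp
  qed simp
  define a where "a n = \<phi> z / \<phi> (x n)" for n
  have lima: "a \<longlonglongrightarrow> \<phi> z"
    unfolding a_def using tendsto_divide[OF tendsto_const lim\<phi>, of "\<phi> z"] by simp
  define A where "A = 2 * \<bar>\<phi> z\<bar>"
  have aA: "\<bar>a n\<bar> \<le> A" for n
  proof -
    have "\<bar>\<phi> z\<bar> * 1 \<le> \<bar>\<phi> z\<bar> * (2 * \<phi> (x n))"
      using x_ge[of n] by (intro mult_left_mono) auto
    then show ?thesis using x_ge[of n] by (simp add: a_def A_def abs_divide field_simps)
  qed
  have R_le: "R w \<le> 1" if "represents k \<mu> R" "mass \<mu> \<le> 1" "norm w = 1" for \<mu> R and w :: 'a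
  proof -
    have "\<bar>\<psi> w ^ k\<bar> \<le> 1" if "\<psi> \<in> space ?M" for \<psi>
      unfolding power_abs using dual_ball_apply_le[of \<psi> w] that \<open>norm w = 1\<close>
      by (intro power_le_one) (auto simp: space_ball_borel)
    then have "\<bar>signed_integral ?M \<mu> (\<lambda>\<psi>. blinfun_apply \<psi> w ^ k)\<bar> \<le> 1 * total_var ?M \<mu> (space ?M)"
      by (intro abs_signed_integral_le represents_bounded[OF that(1)] bdd_measurable_eval_power)
    then show ?thesis using that(1,2) by (simp add: represents_def space_ball_borel)
  qed
  have limR: "(\<lambda>n. R1 (x n)) \<longlonglongrightarrow> 1"
  proof (rule real_tendsto_sandwich)
    have "(\<lambda>n. 2 * blinfun_apply \<phi> (x n) ^ k - 1) \<longlonglongrightarrow> 2 * 1 ^ k - 1" by (intro tendsto_intros lim\<phi>)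
    then show "(\<lambda>n. 2 * blinfun_apply \<phi> (x n) ^ k - 1) \<longlonglongrightarrow> 1" by simp
    have "2 * \<phi> (x n) ^ k - 1 \<le> R1 (x n)" for n
      using sum[of "x n"] R_le[OF \<mu>2 x(1), of n] by linarith
    then show "\<forall>\<^sub>F n in sequentially. 2 * \<phi> (x n) ^ k - 1 \<le> R1 (x n)" by simp
    show "\<forall>\<^sub>F n in sequentially. R1 (x n) \<le> 1" using R_le[OF \<mu>1 x(1)] by simp
  qed simp
  define B where "B = 1 + norm z + A"
  define C where "C = B ^ k * k"
  have "0 \<le> A" by (simp add: A_def)
  then have C0: "0 \<le> C" by (simp add: C_def B_def)
  have bound: "\<bar>R1 z - \<phi> z ^ k\<bar> \<le> C * (\<theta> / 2)" if \<theta>: "\<theta> > 0" for \<theta>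
  proof -
    have "(\<lambda>n. \<bar>R1 z - a n ^ k * R1 (x n)\<bar>) \<longlonglongrightarrow> \<bar>R1 z - blinfun_apply \<phi> z ^ k * 1\<bar>"
      by (intro tendsto_intros lima limR)
    moreover have "(\<lambda>n. C * (\<theta> / 2 + 2 * B\<^sup>2 * (1 - blinfun_apply \<phi> (x n) ^ k) / \<theta>))
        \<longlonglongrightarrow> C * (\<theta> / 2 + 2 * B\<^sup>2 * (1 - 1 ^ k) / \<theta>)"
      using \<theta> by (intro tendsto_intros lim\<phi>) auto
    moreover have "\<bar>R1 z - a n ^ k * R1 (x n)\<bar> \<le> C * (\<theta> / 2 + 2 * B\<^sup>2 * (1 - \<phi> (x n) ^ k) / \<theta>)" for n
      unfolding C_def
      by (rule moment_near_maximum[OF \<mu>1(1) \<mu>2(1) \<mu>1(2) \<mu>2(2) sum k x(1) _ a_def aA B_def \<theta>]) (use x_ge[of n] in auto)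
    ultimately have "\<bar>R1 z - \<phi> z ^ k * 1\<bar> \<le> C * (\<theta> / 2 + 2 * B\<^sup>2 * (1 - 1 ^ k) / \<theta>)"
      by (intro LIMSEQ_le[of _ _ "\<lambda>n. C * (\<theta> / 2 + 2 * B\<^sup>2 * (1 - blinfun_apply \<phi> (x n) ^ k) / \<theta>)"]) auto
    then show ?thesis by simp
  qed
  have "\<bar>R1 z - \<phi> z ^ k\<bar> \<le> 0 + e" if e: "e > 0" for e
  proof -
    have "C * ((2 * e / (C + 1)) / 2) \<le> e" using C0 e by (simp add: field_simps)
    then show ?thesis using bound[of "2 * e / (C + 1)"] C0 e by simp
  qed
  then have "\<bar>R1 z - \<phi> z ^ k\<bar> \<le> 0" by (rule field_le_epsilon)
  then show ?thesis by simp
qed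

text \<open>
  Multiplication by the sign \<open>s\<close> reduces to the power itself, which is the midpoint of the two
  perturbations belonging to \<open>\<zeta> = 1\<close> and \<open>\<zeta> = -1\<close>.
\<close>

theorem power_imp_extreme_point:
  fixes \<phi> :: "'a::real_normed_vector \<Rightarrow>\<^sub>L real"
  assumes \<phi>: "norm \<phi> = 1" and k: "k \<ge> 2" and s: "\<bar>s\<bar> = 1"
  shows "(\<lambda>x. s * blinfun_apply \<phi> x ^ k) \<in> real_extreme_points (integral_polynomials k) (integral_norm k)"
  unfolding real_extreme_points_def
proof (intro CollectI conjI ballI impI)
  let ?B = "integral_unit_ball k :: ('a \<Rightarrow> real) set"
  show "(\<lambda>x. s * blinfun_apply \<phi> x ^ k) \<in> ?B"
    using \<phi> s by (intro multiple_of_power_unit_ball) auto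
  fix Q :: "'a \<Rightarrow> real"
  assume "{(\<lambda>x. s * blinfun_apply \<phi> x ^ k + \<zeta> * Q x) |\<zeta>. \<bar>\<zeta>\<bar> \<le> 1} \<subseteq> ?B"
  then have Q: "(\<lambda>x. s * blinfun_apply \<phi> x ^ k + \<zeta> * Q x) \<in> ?B" if "\<bar>\<zeta>\<bar> \<le> 1" for \<zeta>
    using that by blast
  have ss: "s * s = 1" using s by (metis abs_mult_self_eq mult_1)
  have "(\<lambda>x. s * (s * blinfun_apply \<phi> x ^ k + \<zeta> * Q x)) \<in> ?B" if "\<bar>\<zeta>\<bar> \<le> 1" for \<zeta>
    using unit_ball_scale[OF Q[OF that], of s] s by simp
  from this[of 1] this[of "-1"]
  have "s * (s * \<phi> z ^ k + 1 * Q z) = \<phi> z ^ k" for z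
    by (rule power_not_midpoint[OF \<phi> k]) (simp_all add: distrib_left right_diff_distrib mult.assoc[symmetric] ss)
  then have "s * Q z = 0" for z by (simp add: distrib_left mult.assoc[symmetric] ss)
  moreover have "s \<noteq> 0" using s by auto
  ultimately show "Q = (\<lambda>_. 0)" by (simp add: fun_eq_iff)
qed

theorem theorem2p1:
  fixes k :: nat
  assumes "\<exists>x :: 'a::banach. x \<noteq> 0"
    and "k > 1"
  shows "real_extreme_points (integral_polynomials k) (integral_norm k) =
    {P :: 'a \<Rightarrow> real. \<exists>\<phi> :: 'a \<Rightarrow>\<^sub>L real. norm \<phi> = 1 \<and>
       (P = (\<lambda>x. blinfun_apply \<phi> x ^ k) \<or> P = (\<lambda>x. - (blinfun_apply \<phi> x ^ k)))}"
proof (intro equalityI subsetI)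
  fix P :: "'a \<Rightarrow> real"
  assume "P \<in> real_extreme_points (integral_polynomials k) (integral_norm k)"
  moreover have "k > 0" using assms(2) by simp
  ultimately obtain \<phi> :: "'a \<Rightarrow>\<^sub>L real" where "norm \<phi> = 1"
    "P = (\<lambda>x. blinfun_apply \<phi> x ^ k) \<or> P = (\<lambda>x. - (blinfun_apply \<phi> x ^ k))"
    using extreme_point_imp_power[OF assms(1)] by blast
  then show "P \<in> {P. \<exists>\<phi>. norm \<phi> = 1 \<and>
      (P = (\<lambda>x. blinfun_apply \<phi> x ^ k) \<or> P = (\<lambda>x. - (blinfun_apply \<phi> x ^ k)))}" by blast
next
  fix P :: "'a \<Rightarrow> real"
  assume "P \<in> {P. \<exists>\<phi>. norm \<phi> = 1 \<and>
      (P = (\<lambda>x. blinfun_apply \<phi> x ^ k) \<or> P = (\<lambda>x. - (blinfun_apply \<phi> x ^ k)))}"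
  then obtain \<phi> :: "'a \<Rightarrow>\<^sub>L real" where \<phi>: "norm \<phi> = 1"
    and P: "P = (\<lambda>x. 1 * blinfun_apply \<phi> x ^ k) \<or> P = (\<lambda>x. (-1) * blinfun_apply \<phi> x ^ k)" by auto
  have "k \<ge> 2" using assms(2) by simp
  then show "P \<in> real_extreme_points (integral_polynomials k) (integral_norm k)"
    using P power_imp_extreme_point[OF \<phi>, of k 1] power_imp_extreme_point[OF \<phi>, of k "-1"] by auto
qed

end
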